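(* Let $\Lambda$ be an artin algebra, let $M$ be a $\Lambda$-module and let $t\in\mathbb Z^+\cup\{\infty\}$. If $M\in{}^{\perp_1}\mathcal S_t$, then $M$ is $t$-torsionfree.
   Context: $\Lambda$ is an artin algebra over a commutative artin ring $R$. "Module" means finitely generated left $\Lambda$-module; their category is $\Lambda\text{-mod}$. $D$ is the canonical duality between $\Lambda\text{-mod}$ and $\Lambda^{\mathrm{op}}\text{-mod}$. A module $M$ is $t$-torsionfree (respectively, $\infty$-torsionfree) if $\operatorname{Ext}^i_{\Lambda^{\mathrm{op}}}(\operatorname{Tr}M,\Lambda)=0$ for $1\le i\le t$ (respectively, for all $i\ge1$), where $\operatorname{Tr}$ is the Auslander transpose. Let $\cdots\to P_2\xrightarrow{\partial_2}P_1\xrightarrow{\partial_1}P_0\to D(\Lambda_\Lambda)\to 0$ be a minimal projective resolution; put $K_0=D(\Lambda_\Lambda)$ and $K_i=\operatorname{Im}\partial_i$ for $i\ge1$. For $n\in\mathbb N$ let $\mathcal S_n=\{K_0,K_1,\dots,K_n\}$, and let $\mathcal S_\infty=\{K_0,K_1,\dots\}$. For a class $\mathcal X$ of modules, ${}^{\perp_1}\mathcal X=\{Z\in\Lambda\text{-mod}\mid \operatorname{Ext}^1_\Lambda(Z,X)=0\text{ for all }X\in\mathcal X\}$. *)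

theory Defs
  imports "HOL-Algebra.Module" "HOL-Algebra.QuotRing" "HOL-Algebra.Elementary_Groups" "HOL-Library.Extended_Nat"
begin

section \<open>Left modules over a not necessarily commutative ring\<close>

text \<open>
  The library's \<^locale>\<open>module\<close> requires a commutative ring of scalars.  As there, the
  fields \<^const>\<open>mult\<close> and \<^const>\<open>one\<close> inherited by the record of modules
  carry no meaning.  The predicate \<^const>\<open>submodule\<close> of the library makes no
  commutativity assumption and is used as it stands.
\<close>

locale left_module = R?: ring R + M?: abelian_group M
  for R :: "'a ring" (structure) and M :: "('a, 'm) module" (structure) +
  assumes smult_closed:
      "\<lbrakk>a \<in> carrier R; x \<in> carrier M\<rbrakk> \<Longrightarrow> a \<odot>\<^bsub>M\<^esub> x \<in> carrier M"
    and smult_l_distr: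
      "\<lbrakk>a \<in> carrier R; b \<in> carrier R; x \<in> carrier M\<rbrakk> \<Longrightarrow>
        (a \<oplus> b) \<odot>\<^bsub>M\<^esub> x = a \<odot>\<^bsub>M\<^esub> x \<oplus>\<^bsub>M\<^esub> b \<odot>\<^bsub>M\<^esub> x"
    and smult_r_distr:
      "\<lbrakk>a \<in> carrier R; x \<in> carrier M; y \<in> carrier M\<rbrakk> \<Longrightarrow>
        a \<odot>\<^bsub>M\<^esub> (x \<oplus>\<^bsub>M\<^esub> y) = a \<odot>\<^bsub>M\<^esub> x \<oplus>\<^bsub>M\<^esub> a \<odot>\<^bsub>M\<^esub> y"
    and smult_assoc:
      "\<lbrakk>a \<in> carrier R; b \<in> carrier R; x \<in> carrier M\<rbrakk> \<Longrightarrow>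
        (a \<otimes> b) \<odot>\<^bsub>M\<^esub> x = a \<odot>\<^bsub>M\<^esub> (b \<odot>\<^bsub>M\<^esub> x)"
    and smult_one:
      "x \<in> carrier M \<Longrightarrow> \<one> \<odot>\<^bsub>M\<^esub> x = x"

definition opposite_ring :: "'a ring \<Rightarrow> 'a ring" where
  "opposite_ring \<Lambda> = \<Lambda>\<lparr>mult := (\<lambda>x y. y \<otimes>\<^bsub>\<Lambda>\<^esub> x)\<rparr>"

definition regular_module :: "'a ring \<Rightarrow> ('a, 'a) module" where
  "regular_module \<Lambda> =
    \<lparr>carrier = carrier \<Lambda>, mult = undefined, one = undefined,
     zero = \<zero>\<^bsub>\<Lambda>\<^esub>, add = add \<Lambda>, smult = mult \<Lambda>\<rparr>"

definition quotient_module :: "('a, 'm) module \<Rightarrow> 'm set \<Rightarrow> ('a, 'm set) module" where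
  "quotient_module M N =
    \<lparr>carrier = a_rcosets\<^bsub>M\<^esub> N, mult = undefined, one = undefined,
     zero = N, add = set_add M, smult = (\<lambda>a X. \<Union>x\<in>X. N +>\<^bsub>M\<^esub> (a \<odot>\<^bsub>M\<^esub> x))\<rparr>"

definition fg_module :: "'a ring \<Rightarrow> ('a, 'm) module \<Rightarrow> bool" where
  "fg_module \<Lambda> M \<longleftrightarrow> left_module \<Lambda> M \<and>
    (\<exists>S. finite S \<and> S \<subseteq> carrier M \<and>
      (\<forall>N. submodule N \<Lambda> M \<and> S \<subseteq> N \<longrightarrow> N = carrier M))"

text \<open>
  Homomorphisms are extensional, so that equality of functions is equality of morphisms.
\<close>

definition lmod_hom ::
  "'a ring \<Rightarrow> ('a, 'm) module \<Rightarrow> ('a, 'n) module \<Rightarrow> ('m \<Rightarrow> 'n) set" where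
  "lmod_hom \<Lambda> M N = {f \<in> carrier M \<rightarrow>\<^sub>E carrier N.
    (\<forall>x\<in>carrier M. \<forall>y\<in>carrier M. f (x \<oplus>\<^bsub>M\<^esub> y) = f x \<oplus>\<^bsub>N\<^esub> f y) \<and>
    (\<forall>a\<in>carrier \<Lambda>. \<forall>x\<in>carrier M. f (a \<odot>\<^bsub>M\<^esub> x) = a \<odot>\<^bsub>N\<^esub> f x)}"


section \<open>Projective and injective modules, covers and envelopes\<close>

text \<open>
  Projectivity and injectivity are tested on the modules whose elements have type
  \<^typ>\<open>(nat \<Rightarrow> 'a) set\<close>.  Since a finitely generated module is a quotient of some
  $\Lambda^n$, every finitely generated module has an isomorphic copy there.  Hence for finitely
  generated \<open>P\<close>, respectively for arbitrary \<open>E\<close> (Baer), this is projectivity, respectively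
  injectivity, with respect to all modules.
\<close>

definition projective_module :: "'a ring \<Rightarrow> ('a, 'p) module \<Rightarrow> bool" where
  "projective_module \<Lambda> P \<longleftrightarrow> left_module \<Lambda> P \<and>
    (\<forall>(B :: ('a, (nat \<Rightarrow> 'a) set) module) (C :: ('a, (nat \<Rightarrow> 'a) set) module) g f.
      left_module \<Lambda> B \<and> left_module \<Lambda> C \<and>
      g \<in> lmod_hom \<Lambda> B C \<and> g ` carrier B = carrier C \<and> f \<in> lmod_hom \<Lambda> P C \<longrightarrow>
      (\<exists>h\<in>lmod_hom \<Lambda> P B. \<forall>x\<in>carrier P. g (h x) = f x))"

definition injective_module :: "'a ring \<Rightarrow> ('a, 'e) module \<Rightarrow> bool" where
  "injective_module \<Lambda> E \<longleftrightarrow> left_module \<Lambda> E \<and>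
    (\<forall>(A :: ('a, (nat \<Rightarrow> 'a) set) module) (B :: ('a, (nat \<Rightarrow> 'a) set) module) i f.
      left_module \<Lambda> A \<and> left_module \<Lambda> B \<and>
      i \<in> lmod_hom \<Lambda> A B \<and> inj_on i (carrier A) \<and> f \<in> lmod_hom \<Lambda> A E \<longrightarrow>
      (\<exists>h\<in>lmod_hom \<Lambda> B E. \<forall>x\<in>carrier A. h (i x) = f x))"

definition superfluous_submodule :: "'a ring \<Rightarrow> ('a, 'm) module \<Rightarrow> 'm set \<Rightarrow> bool" where
  "superfluous_submodule \<Lambda> M N \<longleftrightarrow> submodule N \<Lambda> M \<and>
    (\<forall>U. submodule U \<Lambda> M \<and> U <+>\<^bsub>M\<^esub> N = carrier M \<longrightarrow> U = carrier M)"

definition essential_submodule :: "'a ring \<Rightarrow> ('a, 'm) module \<Rightarrow> 'm set \<Rightarrow> bool" where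
  "essential_submodule \<Lambda> M N \<longleftrightarrow> submodule N \<Lambda> M \<and>
    (\<forall>U. submodule U \<Lambda> M \<and> U \<inter> N = {\<zero>\<^bsub>M\<^esub>} \<longrightarrow> U = {\<zero>\<^bsub>M\<^esub>})"

definition projective_cover ::
  "'a ring \<Rightarrow> ('a, 'p) module \<Rightarrow> ('p \<Rightarrow> 'm) \<Rightarrow> ('a, 'm) module \<Rightarrow> bool" where
  "projective_cover \<Lambda> P f M \<longleftrightarrow>
    fg_module \<Lambda> P \<and> projective_module \<Lambda> P \<and>
    f \<in> lmod_hom \<Lambda> P M \<and> f ` carrier P = carrier M \<and>
    superfluous_submodule \<Lambda> P (a_kernel P M f)"

definition injective_envelope ::
  "'a ring \<Rightarrow> ('a, 'm) module \<Rightarrow> ('m \<Rightarrow> 'e) \<Rightarrow> ('a, 'e) module \<Rightarrow> bool" where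
  "injective_envelope \<Lambda> M i E \<longleftrightarrow>
    injective_module \<Lambda> E \<and>
    i \<in> lmod_hom \<Lambda> M E \<and> inj_on i (carrier M) \<and>
    essential_submodule \<Lambda> E (i ` carrier M)"


section \<open>Projective resolutions, Ext and the transpose\<close>

text \<open>
  A resolution consists of modules \<open>P 0, P 1, \<dots>\<close>, differentials \<open>d i\<close> from \<open>P i\<close> to
  \<open>P (i - 1)\<close> for \<open>i \<ge> 1\<close> (the value \<open>d 0\<close> is irrelevant) and an augmentation \<open>e\<close>
  from \<open>P 0\<close> to \<open>M\<close>.
\<close>

definition proj_resolution ::
  "'a ring \<Rightarrow> (nat \<Rightarrow> ('a, 'p) module) \<Rightarrow> (nat \<Rightarrow> 'p \<Rightarrow> 'p) \<Rightarrow> ('p \<Rightarrow> 'm) \<Rightarrow> ('a, 'm) module \<Rightarrow> bool"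
where
  "proj_resolution \<Lambda> P d e M \<longleftrightarrow>
    (\<forall>i. fg_module \<Lambda> (P i) \<and> projective_module \<Lambda> (P i)) \<and>
    (\<forall>i. d (Suc i) \<in> lmod_hom \<Lambda> (P (Suc i)) (P i)) \<and>
    e \<in> lmod_hom \<Lambda> (P 0) M \<and> e ` carrier (P 0) = carrier M \<and>
    d 1 ` carrier (P 1) = a_kernel (P 0) M e \<and>
    (\<forall>i. d (Suc (Suc i)) ` carrier (P (Suc (Suc i))) = a_kernel (P (Suc i)) (P i) (d (Suc i)))"

text \<open>The submodule \<open>Im (d i)\<close> of \<open>P (i - 1)\<close>, for \<open>i \<ge> 1\<close>.\<close>

definition syzygy :: "(nat \<Rightarrow> ('a, 'p) module) \<Rightarrow> (nat \<Rightarrow> 'p \<Rightarrow> 'p) \<Rightarrow> nat \<Rightarrow> ('a, 'p) module" where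
  "syzygy P d i = (P (i - 1))\<lparr>carrier := d i ` carrier (P i)\<rparr>"

definition minimal_proj_resolution ::
  "'a ring \<Rightarrow> (nat \<Rightarrow> ('a, 'p) module) \<Rightarrow> (nat \<Rightarrow> 'p \<Rightarrow> 'p) \<Rightarrow> ('p \<Rightarrow> 'm) \<Rightarrow> ('a, 'm) module \<Rightarrow> bool"
where
  "minimal_proj_resolution \<Lambda> P d e M \<longleftrightarrow>
    proj_resolution \<Lambda> P d e M \<and>
    projective_cover \<Lambda> (P 0) e M \<and>
    (\<forall>i\<ge>1. projective_cover \<Lambda> (P i) (d i) (syzygy P d i))"

text \<open>
  Over a left noetherian ring (in particular an artin algebra) every finitely generated module
  has a resolution by free modules $\Lambda^n$, whose elements can be taken of type
  \<^typ>\<open>nat \<Rightarrow> 'a\<close>.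
\<close>

definition some_proj_resolution ::
  "'a ring \<Rightarrow> ('a, 'm) module \<Rightarrow>
    (nat \<Rightarrow> ('a, nat \<Rightarrow> 'a) module) \<times> (nat \<Rightarrow> (nat \<Rightarrow> 'a) \<Rightarrow> nat \<Rightarrow> 'a) \<times> ((nat \<Rightarrow> 'a) \<Rightarrow> 'm)"
where
  "some_proj_resolution \<Lambda> M = (SOME (P, d, e). proj_resolution \<Lambda> P d e M)"

definition hom_group ::
  "'a ring \<Rightarrow> ('a, 'm) module \<Rightarrow> ('a, 'n) module \<Rightarrow> ('m \<Rightarrow> 'n) monoid" where
  "hom_group \<Lambda> M N =
    \<lparr>carrier = lmod_hom \<Lambda> M N,
     mult = (\<lambda>f g. \<lambda>x\<in>carrier M. f x \<oplus>\<^bsub>N\<^esub> g x),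
     one = (\<lambda>x\<in>carrier M. \<zero>\<^bsub>N\<^esub>)\<rparr>"

text \<open>
  The \<open>i\<close>-th cohomology group of the complex
  \<open>0 \<rightarrow> Hom(P 0, X) \<rightarrow> Hom(P 1, X) \<rightarrow> \<dots>\<close>, written as a multiplicative group.
\<close>

definition hom_cohomology ::
  "'a ring \<Rightarrow> (nat \<Rightarrow> ('a, 'p) module) \<Rightarrow> (nat \<Rightarrow> 'p \<Rightarrow> 'p) \<Rightarrow> ('a, 'x) module \<Rightarrow> nat \<Rightarrow>
    ('p \<Rightarrow> 'x) set monoid"
where
  "hom_cohomology \<Lambda> P d X i =
    (let cocycles = kernel (hom_group \<Lambda> (P i) X) (hom_group \<Lambda> (P (Suc i)) X)
           (\<lambda>f. compose (carrier (P (Suc i))) f (d (Suc i)));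
         coboundaries =
           (if i = 0 then {\<one>\<^bsub>hom_group \<Lambda> (P 0) X\<^esub>}
            else (\<lambda>f. compose (carrier (P i)) f (d i)) ` lmod_hom \<Lambda> (P (i - 1)) X)
     in (hom_group \<Lambda> (P i) X)\<lparr>carrier := cocycles\<rparr> Mod coboundaries)"

definition Ext ::
  "'a ring \<Rightarrow> nat \<Rightarrow> ('a, 'm) module \<Rightarrow> ('a, 'x) module \<Rightarrow> ((nat \<Rightarrow> 'a) \<Rightarrow> 'x) set monoid" where
  "Ext \<Lambda> i Z X = (case some_proj_resolution \<Lambda> Z of (P, d, e) \<Rightarrow> hom_cohomology \<Lambda> P d X i)"

definition perp1 :: "'a ring \<Rightarrow> ('a, 'x) module set \<Rightarrow> ('a, 'm) module set" where
  "perp1 \<Lambda> \<X> = {Z. fg_module \<Lambda> Z \<and> (\<forall>X\<in>\<X>. trivial_group (Ext \<Lambda> 1 Z X))}"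

text \<open>
  \<open>Hom(P, \<Lambda>)\<close> for a left \<open>\<Lambda>\<close>-module \<open>P\<close>: a right \<open>\<Lambda>\<close>-module via
  \<open>(f a) x = (f x) a\<close>, that is, a left module over the opposite ring.
\<close>

definition hom_to_ring :: "'a ring \<Rightarrow> ('a, 'p) module \<Rightarrow> ('a, 'p \<Rightarrow> 'a) module" where
  "hom_to_ring \<Lambda> P =
    \<lparr>carrier = lmod_hom \<Lambda> P (regular_module \<Lambda>), mult = undefined, one = undefined,
     zero = (\<lambda>x\<in>carrier P. \<zero>\<^bsub>\<Lambda>\<^esub>),
     add = (\<lambda>f g. \<lambda>x\<in>carrier P. f x \<oplus>\<^bsub>\<Lambda>\<^esub> g x),
     smult = (\<lambda>a f. \<lambda>x\<in>carrier P. f x \<otimes>\<^bsub>\<Lambda>\<^esub> a)\<rparr>"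

definition minimal_proj_presentation ::
  "'a ring \<Rightarrow> ('a, 'q) module \<Rightarrow> ('q \<Rightarrow> 'p) \<Rightarrow> ('a, 'p) module \<Rightarrow> ('p \<Rightarrow> 'm) \<Rightarrow> ('a, 'm) module \<Rightarrow> bool"
where
  "minimal_proj_presentation \<Lambda> P1 d P0 e M \<longleftrightarrow>
    projective_cover \<Lambda> P0 e M \<and>
    projective_cover \<Lambda> P1 d (P0\<lparr>carrier := a_kernel P0 M e\<rparr>)"

text \<open>
  A projective cover of a finitely generated module over an artin algebra is a direct summand
  of some $\Lambda^n$, so that again the element type \<^typ>\<open>nat \<Rightarrow> 'a\<close> suffices.
\<close>

definition some_minimal_proj_presentation ::
  "'a ring \<Rightarrow> ('a, 'm) module \<Rightarrow>
    ('a, nat \<Rightarrow> 'a) module \<times> ((nat \<Rightarrow> 'a) \<Rightarrow> nat \<Rightarrow> 'a) \<times> ('a, nat \<Rightarrow> 'a) module \<times> ((nat \<Rightarrow> 'a) \<Rightarrow> 'm)"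
where
  "some_minimal_proj_presentation \<Lambda> M =
    (SOME (P1, d, P0, e). minimal_proj_presentation \<Lambda> P1 d P0 e M)"

text \<open>The cokernel of \<open>Hom(P0, \<Lambda>) \<rightarrow> Hom(P1, \<Lambda>)\<close>.\<close>

definition transpose_module ::
  "'a ring \<Rightarrow> ('a, 'm) module \<Rightarrow> ('a, ((nat \<Rightarrow> 'a) \<Rightarrow> 'a) set) module" where
  "transpose_module \<Lambda> M = (case some_minimal_proj_presentation \<Lambda> M of (P1, d, P0, e) \<Rightarrow>
    quotient_module (hom_to_ring \<Lambda> P1)
      ((\<lambda>f. compose (carrier P1) f d) ` carrier (hom_to_ring \<Lambda> P0)))"

definition torsionfree :: "'a ring \<Rightarrow> enat \<Rightarrow> ('a, 'm) module \<Rightarrow> bool" where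
  "torsionfree \<Lambda> t M \<longleftrightarrow>
    (\<forall>i::nat. 1 \<le> i \<and> enat i \<le> t \<longrightarrow>
      trivial_group (Ext (opposite_ring \<Lambda>) i (transpose_module \<Lambda> M)
        (regular_module (opposite_ring \<Lambda>))))"


section \<open>Artin algebras and their duality\<close>

definition artinian_cring :: "'r ring \<Rightarrow> bool" where
  "artinian_cring R \<longleftrightarrow> cring R \<and>
    (\<forall>I :: nat \<Rightarrow> 'r set. (\<forall>n. ideal (I n) R \<and> I (Suc n) \<subseteq> I n) \<longrightarrow>
      (\<exists>n. \<forall>m\<ge>n. I m = I n))"

definition restrict_scalars :: "('r \<Rightarrow> 'a) \<Rightarrow> ('a, 'm) module \<Rightarrow> ('r, 'm) module" where
  "restrict_scalars \<phi> M =
    \<lparr>carrier = carrier M, mult = undefined, one = undefined,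
     zero = \<zero>\<^bsub>M\<^esub>, add = add M, smult = (\<lambda>r x. \<phi> r \<odot>\<^bsub>M\<^esub> x)\<rparr>"

text \<open>The \<open>R\<close>-algebra structure is given by the ring homomorphism \<open>\<phi>\<close> into the centre.\<close>

definition artin_algebra :: "'r ring \<Rightarrow> ('r \<Rightarrow> 'a) \<Rightarrow> 'a ring \<Rightarrow> bool" where
  "artin_algebra R \<phi> \<Lambda> \<longleftrightarrow>
    artinian_cring R \<and> ring \<Lambda> \<and> \<phi> \<in> ring_hom R \<Lambda> \<and>
    (\<forall>r\<in>carrier R. \<forall>a\<in>carrier \<Lambda>. \<phi> r \<otimes>\<^bsub>\<Lambda>\<^esub> a = a \<otimes>\<^bsub>\<Lambda>\<^esub> \<phi> r) \<and>
    fg_module R (restrict_scalars \<phi> (regular_module \<Lambda>))"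

text \<open>The carrier is listed separately for the zero ring, which has no maximal ideals.\<close>

definition jacobson_radical :: "'r ring \<Rightarrow> 'r set" where
  "jacobson_radical R = carrier R \<inter> \<Inter>{I. maximalideal I R}"

text \<open>
  The canonical duality is $D = \mathrm{Hom}_R(-, E)$, where \<open>E\<close> is an injective envelope of
  \<open>R / rad R\<close>.  For a left \<open>\<Lambda>\<close>-module \<open>M\<close> the action \<open>(f a) x = f (a x)\<close> makes
  \<open>D M\<close> a left module over the opposite ring.
\<close>

definition dual_module ::
  "'r ring \<Rightarrow> ('r \<Rightarrow> 'a) \<Rightarrow> ('r, 'e) module \<Rightarrow> ('a, 'm) module \<Rightarrow> ('a, 'm \<Rightarrow> 'e) module" where
  "dual_module R \<phi> E M =
    \<lparr>carrier = lmod_hom R (restrict_scalars \<phi> M) E, mult = undefined, one = undefined,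
     zero = (\<lambda>x\<in>carrier M. \<zero>\<^bsub>E\<^esub>),
     add = (\<lambda>f g. \<lambda>x\<in>carrier M. f x \<oplus>\<^bsub>E\<^esub> g x),
     smult = (\<lambda>a f. \<lambda>x\<in>carrier M. f (a \<odot>\<^bsub>M\<^esub> x))\<rparr>"

text \<open>\<open>D(\<Lambda>\<^sub>\<Lambda>)\<close>; the right module \<open>\<Lambda>\<^sub>\<Lambda>\<close> is the regular left module of the opposite ring.\<close>

definition dual_regular ::
  "'r ring \<Rightarrow> ('r \<Rightarrow> 'a) \<Rightarrow> ('r, 'e) module \<Rightarrow> 'a ring \<Rightarrow> ('a, 'a \<Rightarrow> 'e) module" where
  "dual_regular R \<phi> E \<Lambda> = dual_module R \<phi> E (regular_module (opposite_ring \<Lambda>))"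

text \<open>
  The class \<open>\<S>\<^sub>t\<close> of the modules \<open>K 0 = M\<close> and \<open>K i = Im (d i)\<close> for \<open>1 \<le> i \<le> t\<close>, where \<open>P\<close>, \<open>d\<close>
  resolve \<open>M\<close>.  As \<open>K 0\<close> and the other \<open>K i\<close> have elements of different types, its orthogonal
  class is the intersection of the orthogonal classes of the two parts.
\<close>

definition perp1_syzygies ::
  "'a ring \<Rightarrow> ('a, 'k) module \<Rightarrow> (nat \<Rightarrow> ('a, 'p) module) \<Rightarrow> (nat \<Rightarrow> 'p \<Rightarrow> 'p) \<Rightarrow> enat \<Rightarrow>
    ('a, 'm) module set"
where
  "perp1_syzygies \<Lambda> M P d t =
    perp1 \<Lambda> {M} \<inter> perp1 \<Lambda> {syzygy P d i | i::nat. 1 \<le> i \<and> enat i \<le> t}"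

end

theory Submission
  imports Defs
begin

text \<open>
  Let \<open>P1 \<rightarrow> P0 \<rightarrow> M \<rightarrow> 0\<close> be the minimal presentation defining \<open>Tr M\<close>, let \<open>Q\<close> be a projective
  resolution of \<open>Tr M\<close> over the opposite ring, and let \<open>C = Hom(Q, \<Lambda>)\<close>, a complex of left modules.
  Its exactness in degree \<open>i\<close> follows from that of \<open>Hom\<^sub>\<Lambda>(C, D \<Lambda>) = Hom\<^sub>R(C, E)\<close>, because \<open>E\<close> is a
  cogenerator.  The functors \<open>Hom\<^sub>\<Lambda>(C j, _)\<close> are exact, and \<open>Hom\<^sub>\<Lambda>(C, P k)\<close>, which is the tensor
  product of \<open>Q\<close> with \<open>P k\<close>, has no homology in positive degrees.  Hence dimension shifting along
  \<open>0 \<rightarrow> K (k + 1) \<rightarrow> P k \<rightarrow> K k \<rightarrow> 0\<close> identifies the homology in degree \<open>i\<close> with the kernel of the map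
  from \<open>Tr M \<otimes> K i\<close> to \<open>Tr M \<otimes> P (i - 1)\<close>, where \<open>Tr M \<otimes> X\<close> is the cokernel of
  \<open>Hom(P0, X) \<rightarrow> Hom(P1, X)\<close>.  An element of that kernel is given by a map \<open>P1 \<rightarrow> K i\<close> that factors
  through \<open>P0\<close> once it is composed with the inclusion into \<open>P (i - 1)\<close>.  So it vanishes on the
  kernel of \<open>P1 \<rightarrow> P0\<close>, and \<open>Ext\<^sup>1(M, K i) = 0\<close> makes it factor through \<open>P0\<close> already.

  The resolutions and presentations in the definitions are chosen by \<open>SOME\<close>, so their existence has
  to be proved; it rests on the chain conditions for finitely generated modules.
\<close>


text \<open>Two features of the setting shape the proof. First, \<open>projective_module\<close> and
  \<open>injective_module\<close> quantify over modules on one fixed element type, while the modules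
  that occur consist of functions or cosets. A finitely generated projective module is therefore
  replaced by a finite dual basis, which mentions no other module: it gives lifts against modules on
  any type, survives dualising and makes the module reflexive. Injectivity is used by way of copies
  on the fixed type. Second, no tensor product is formed. Since each \<open>Q j\<close> is finitely
  generated projective, maps from its dual to X stand for elements of Q j tensor X, and
  \<open>dual_factors\<close> states the vanishing of homology for such maps. The resolution Q is an
  arbitrary choice unrelated to P1 -> P0, whose duals present Tr M as well; degree 0 is where both
  presentations are compared. As for chain conditions, an artin algebra comes with the descending
  one only, for ideals of R. The ascending one, which makes kernels finitely generated, is derived
  for R and passed on to \<Lambda>-modules.\<close>

section \<open>Linear maps and submodules\<close>

text \<open>No value outside the carrier is prescribed, so that composites and pointwise sums of
  linear maps are linear as plain lambda terms. \<open>restrict\<close> enters only where a member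
  of \<open>lmod_hom\<close> is called for.\<close>

definition lin_map ::
  "'a ring \<Rightarrow> ('a, 'm) module \<Rightarrow> ('a, 'n) module \<Rightarrow> ('m \<Rightarrow> 'n) \<Rightarrow> bool" where
  "lin_map \<Lambda> M N f \<longleftrightarrow> f \<in> carrier M \<rightarrow> carrier N \<and>
    (\<forall>x\<in>carrier M. \<forall>y\<in>carrier M. f (x \<oplus>\<^bsub>M\<^esub> y) = f x \<oplus>\<^bsub>N\<^esub> f y) \<and>
    (\<forall>a\<in>carrier \<Lambda>. \<forall>x\<in>carrier M. f (a \<odot>\<^bsub>M\<^esub> x) = a \<odot>\<^bsub>N\<^esub> f x)"

lemma lin_mapI:
  assumes "\<And>x. x \<in> carrier M \<Longrightarrow> f x \<in> carrier N"
    and "\<And>x y. x \<in> carrier M \<Longrightarrow> y \<in> carrier M \<Longrightarrow> f (x \<oplus>\<^bsub>M\<^esub> y) = f x \<oplus>\<^bsub>N\<^esub> f y"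
    and "\<And>a x. a \<in> carrier \<Lambda> \<Longrightarrow> x \<in> carrier M \<Longrightarrow> f (a \<odot>\<^bsub>M\<^esub> x) = a \<odot>\<^bsub>N\<^esub> f x"
  shows "lin_map \<Lambda> M N f"
  using assms by (auto simp: lin_map_def)

lemma lin_map_closed: "lin_map \<Lambda> M N f \<Longrightarrow> x \<in> carrier M \<Longrightarrow> f x \<in> carrier N"
  and lin_map_add: "lin_map \<Lambda> M N f \<Longrightarrow> x \<in> carrier M \<Longrightarrow> y \<in> carrier M \<Longrightarrow>
    f (x \<oplus>\<^bsub>M\<^esub> y) = f x \<oplus>\<^bsub>N\<^esub> f y"
  and lin_map_smult: "lin_map \<Lambda> M N f \<Longrightarrow> a \<in> carrier \<Lambda> \<Longrightarrow> x \<in> carrier M \<Longrightarrow>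
    f (a \<odot>\<^bsub>M\<^esub> x) = a \<odot>\<^bsub>N\<^esub> f x"
  by (auto simp: lin_map_def)

lemma lmod_hom_iff:
  "f \<in> lmod_hom \<Lambda> M N \<longleftrightarrow> lin_map \<Lambda> M N f \<and> f \<in> extensional (carrier M)"
  by (auto simp: lmod_hom_def lin_map_def PiE_def)

lemma lmod_hom_lin_map: "f \<in> lmod_hom \<Lambda> M N \<Longrightarrow> lin_map \<Lambda> M N f"
  by (simp add: lmod_hom_iff)

lemma lin_map_comp:
  "lin_map \<Lambda> M N f \<Longrightarrow> lin_map \<Lambda> N K g \<Longrightarrow> lin_map \<Lambda> M K (\<lambda>x. g (f x))"
  by (auto simp: lin_map_def Pi_iff)

context left_module
begin

lemma smult_closed' [simp, intro]:
  "a \<in> carrier R \<Longrightarrow> x \<in> carrier M \<Longrightarrow> a \<odot>\<^bsub>M\<^esub> x \<in> carrier M"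
  by (rule smult_closed)

lemma smult_l_null [simp]:
  assumes "x \<in> carrier M" shows "\<zero> \<odot>\<^bsub>M\<^esub> x = \<zero>\<^bsub>M\<^esub>"
proof -
  have "\<zero> \<odot>\<^bsub>M\<^esub> x \<oplus>\<^bsub>M\<^esub> \<zero> \<odot>\<^bsub>M\<^esub> x = \<zero> \<odot>\<^bsub>M\<^esub> x"
    using smult_l_distr[of \<zero> \<zero> x] assms by simp
  then show ?thesis using assms by (metis M.add.r_cancel_one' R.zero_closed smult_closed)
qed

lemma smult_r_null [simp]:
  assumes "a \<in> carrier R" shows "a \<odot>\<^bsub>M\<^esub> \<zero>\<^bsub>M\<^esub> = \<zero>\<^bsub>M\<^esub>"
proof -
  have "a \<odot>\<^bsub>M\<^esub> \<zero>\<^bsub>M\<^esub> \<oplus>\<^bsub>M\<^esub> a \<odot>\<^bsub>M\<^esub> \<zero>\<^bsub>M\<^esub> = a \<odot>\<^bsub>M\<^esub> \<zero>\<^bsub>M\<^esub>"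
    using smult_r_distr[of a "\<zero>\<^bsub>M\<^esub>" "\<zero>\<^bsub>M\<^esub>"] assms by simp
  then show ?thesis using assms by (metis M.add.r_cancel_one' M.zero_closed smult_closed)
qed

lemma smult_l_minus:
  assumes "a \<in> carrier R" "x \<in> carrier M"
  shows "(\<ominus> a) \<odot>\<^bsub>M\<^esub> x = \<ominus>\<^bsub>M\<^esub> (a \<odot>\<^bsub>M\<^esub> x)"
proof -
  have "(\<ominus> a) \<odot>\<^bsub>M\<^esub> x \<oplus>\<^bsub>M\<^esub> a \<odot>\<^bsub>M\<^esub> x = \<zero>\<^bsub>M\<^esub>"
    using smult_l_distr[of "\<ominus> a" a x] assms by (simp add: R.l_neg)
  then show ?thesis using assms by (metis M.minus_equality R.a_inv_closed smult_closed)
qed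

lemma smult_r_minus:
  assumes "a \<in> carrier R" "x \<in> carrier M"
  shows "a \<odot>\<^bsub>M\<^esub> (\<ominus>\<^bsub>M\<^esub> x) = \<ominus>\<^bsub>M\<^esub> (a \<odot>\<^bsub>M\<^esub> x)"
proof -
  have "a \<odot>\<^bsub>M\<^esub> (\<ominus>\<^bsub>M\<^esub> x) \<oplus>\<^bsub>M\<^esub> a \<odot>\<^bsub>M\<^esub> x = \<zero>\<^bsub>M\<^esub>"
    using smult_r_distr[of a "\<ominus>\<^bsub>M\<^esub> x" x] assms by (simp add: M.l_neg)
  then show ?thesis using assms by (metis M.minus_equality M.a_inv_closed smult_closed)
qed

lemma finsum_smult_ldistr:
  "\<lbrakk>finite A; a \<in> carrier R; f \<in> A \<rightarrow> carrier M\<rbrakk> \<Longrightarrow>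
    a \<odot>\<^bsub>M\<^esub> (\<Oplus>\<^bsub>M\<^esub>i\<in>A. f i) = (\<Oplus>\<^bsub>M\<^esub>i\<in>A. a \<odot>\<^bsub>M\<^esub> f i)"
  by (induct set: finite) (simp_all add: Pi_def smult_r_distr)

lemma submoduleI:
  assumes "H \<subseteq> carrier M" "\<zero>\<^bsub>M\<^esub> \<in> H"
    and add: "\<And>a b. \<lbrakk>a \<in> H; b \<in> H\<rbrakk> \<Longrightarrow> a \<oplus>\<^bsub>M\<^esub> b \<in> H"
    and smult: "\<And>a x. \<lbrakk>a \<in> carrier R; x \<in> H\<rbrakk> \<Longrightarrow> a \<odot>\<^bsub>M\<^esub> x \<in> H"
  shows "submodule H R M"
proof -
  have "\<ominus>\<^bsub>M\<^esub> x \<in> H" if "x \<in> H" for x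
  proof -
    have "(\<ominus> \<one>) \<odot>\<^bsub>M\<^esub> x = \<ominus>\<^bsub>M\<^esub> x"
      using that assms(1) smult_l_minus[of \<one> x] smult_one[of x] by auto
    then show ?thesis using smult[of "\<ominus> \<one>" x] that by simp
  qed
  then show ?thesis
    unfolding submodule_def submodule_axioms_def subgroup_def
    using assms by (auto simp: a_inv_def)
qed

lemma submoduleD:
  assumes "submodule H R M"
  shows "H \<subseteq> carrier M" "\<zero>\<^bsub>M\<^esub> \<in> H"
    "a \<in> H \<Longrightarrow> b \<in> H \<Longrightarrow> a \<oplus>\<^bsub>M\<^esub> b \<in> H"
    "r \<in> carrier R \<Longrightarrow> a \<in> H \<Longrightarrow> r \<odot>\<^bsub>M\<^esub> a \<in> H"
    "a \<in> H \<Longrightarrow> \<ominus>\<^bsub>M\<^esub> a \<in> H"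
    "a \<in> H \<Longrightarrow> b \<in> H \<Longrightarrow> a \<ominus>\<^bsub>M\<^esub> b \<in> H"
  using assms unfolding submodule_def submodule_axioms_def subgroup_def
  by (auto simp: a_inv_def a_minus_def)

lemma submodule_finsum:
  assumes "submodule H R M" "finite A" "f \<in> A \<rightarrow> H"
  shows "(\<Oplus>\<^bsub>M\<^esub>i\<in>A. f i) \<in> H"
  using assms(2,3)
proof (induct set: finite)
  case empty
  then show ?case using submoduleD(2)[OF assms(1)] by simp
next
  case (insert x F)
  then show ?case using submoduleD(1,3)[OF assms(1)] by (subst M.finsum_insert) auto
qed

lemma submodule_carrier: "submodule (carrier M) R M"
  by (rule submoduleI) auto

lemma submodule_zero: "submodule {\<zero>\<^bsub>M\<^esub>} R M"
  by (rule submoduleI) auto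

lemma submodule_Int: "submodule A R M \<Longrightarrow> submodule B R M \<Longrightarrow> submodule (A \<inter> B) R M"
  by (rule submoduleI) (auto dest: submoduleD)

lemma set_addI: "a \<in> A \<Longrightarrow> b \<in> B \<Longrightarrow> a \<oplus>\<^bsub>M\<^esub> b \<in> A <+>\<^bsub>M\<^esub> B"
  unfolding set_add_def' by blast

lemma submodule_set_add:
  assumes "submodule A R M" "submodule B R M" shows "submodule (A <+>\<^bsub>M\<^esub> B) R M"
proof (rule submoduleI)
  note A = submoduleD[OF assms(1)] and B = submoduleD[OF assms(2)]
  show "A <+>\<^bsub>M\<^esub> B \<subseteq> carrier M" using A(1) B(1) by (auto simp: set_add_def')
  show "\<zero>\<^bsub>M\<^esub> \<in> A <+>\<^bsub>M\<^esub> B"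
    using set_addI[OF A(2) B(2)] by simp
  fix x y assume "x \<in> A <+>\<^bsub>M\<^esub> B" "y \<in> A <+>\<^bsub>M\<^esub> B"
  then obtain a b a' b' where *: "a \<in> A" "b \<in> B" "a' \<in> A" "b' \<in> B"
    "x = a \<oplus>\<^bsub>M\<^esub> b" "y = a' \<oplus>\<^bsub>M\<^esub> b'" by (auto simp: set_add_def')
  then have "x \<oplus>\<^bsub>M\<^esub> y = (a \<oplus>\<^bsub>M\<^esub> a') \<oplus>\<^bsub>M\<^esub> (b \<oplus>\<^bsub>M\<^esub> b')"
    using A(1) B(1) by (simp add: subset_iff M.a_ac)
  then show "x \<oplus>\<^bsub>M\<^esub> y \<in> A <+>\<^bsub>M\<^esub> B" using set_addI[OF A(3) B(3)] * by simp
next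
  note A = submoduleD[OF assms(1)] and B = submoduleD[OF assms(2)]
  fix r x assume r: "r \<in> carrier R" and "x \<in> A <+>\<^bsub>M\<^esub> B"
  then obtain a b where *: "a \<in> A" "b \<in> B" "x = a \<oplus>\<^bsub>M\<^esub> b" by (auto simp: set_add_def')
  then have "r \<odot>\<^bsub>M\<^esub> x = r \<odot>\<^bsub>M\<^esub> a \<oplus>\<^bsub>M\<^esub> r \<odot>\<^bsub>M\<^esub> b"
    using A(1) B(1) r by (simp add: subset_iff smult_r_distr)
  then show "r \<odot>\<^bsub>M\<^esub> x \<in> A <+>\<^bsub>M\<^esub> B" using set_addI[OF A(4) B(4)] * r by simp
qed

lemma set_add_upper:
  assumes "submodule A R M" "submodule B R M"
  shows "A \<subseteq> A <+>\<^bsub>M\<^esub> B" "B \<subseteq> A <+>\<^bsub>M\<^esub> B"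
proof -
  note A = submoduleD[OF assms(1)] and B = submoduleD[OF assms(2)]
  show "A \<subseteq> A <+>\<^bsub>M\<^esub> B"
  proof
    fix x assume "x \<in> A"
    then show "x \<in> A <+>\<^bsub>M\<^esub> B" using set_addI[OF _ B(2), of x A] A(1) by auto
  qed
  show "B \<subseteq> A <+>\<^bsub>M\<^esub> B"
  proof
    fix x assume "x \<in> B"
    then show "x \<in> A <+>\<^bsub>M\<^esub> B" using set_addI[OF A(2), of x B] B(1) by auto
  qed
qed

lemma submodule_cyclic: "x \<in> carrier M \<Longrightarrow> submodule ((\<lambda>r. r \<odot>\<^bsub>M\<^esub> x) ` carrier R) R M"
  apply (rule submoduleI)
     apply auto[1]
    apply (rule image_eqI[of _ _ \<zero>]; simp)
   apply (auto simp flip: smult_l_distr smult_assoc)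
  done

lemma submodule_left_module:
  assumes "submodule H R M" shows "left_module R (M\<lparr>carrier := H\<rparr>)"
proof -
  note H = submoduleD[OF assms]
  have "abelian_group (M\<lparr>carrier := H\<rparr>)"
  proof (rule abelian_groupI)
    fix x assume "x \<in> carrier (M\<lparr>carrier := H\<rparr>)"
    then show "\<exists>y\<in>carrier (M\<lparr>carrier := H\<rparr>). y \<oplus>\<^bsub>M\<lparr>carrier := H\<rparr>\<^esub> x = \<zero>\<^bsub>M\<lparr>carrier := H\<rparr>\<^esub>"
      using H by (auto intro!: bexI[of _ "\<ominus>\<^bsub>M\<^esub> x"] simp: M.l_neg subset_iff)
  qed (use H in \<open>auto simp: subset_iff M.a_ac\<close>)
  moreover have "left_module_axioms R (M\<lparr>carrier := H\<rparr>)"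
    using H(1,4)
    by unfold_locales (auto simp: subset_iff smult_l_distr smult_r_distr smult_assoc smult_one)
  ultimately show ?thesis
    by (simp add: left_module_def R.ring_axioms)
qed

lemma submodule_restrict_iff:
  assumes "submodule H R M"
  shows "submodule U R (M\<lparr>carrier := H\<rparr>) \<longleftrightarrow> submodule U R M \<and> U \<subseteq> H"
proof -
  interpret H: left_module R "M\<lparr>carrier := H\<rparr>" by (rule submodule_left_module[OF assms])
  show ?thesis
  proof
    assume "submodule U R (M\<lparr>carrier := H\<rparr>)"
    note U = H.submoduleD[OF this]
    show "submodule U R M \<and> U \<subseteq> H"
      using U submoduleD(1)[OF assms] by (auto intro!: submoduleI)
  next
    assume "submodule U R M \<and> U \<subseteq> H"
    then show "submodule U R (M\<lparr>carrier := H\<rparr>)"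
      using submoduleD[of U] by (auto intro!: H.submoduleI)
  qed
qed

end

lemma lin_map_subset:
  "lin_map \<Lambda> M N f \<Longrightarrow> H \<subseteq> carrier M \<Longrightarrow> lin_map \<Lambda> (M\<lparr>carrier := H\<rparr>) N f"
  by (auto simp: lin_map_def subset_iff)

lemma lin_map_into_subset:
  "lin_map \<Lambda> M N f \<Longrightarrow> f ` carrier M \<subseteq> H \<Longrightarrow> lin_map \<Lambda> M (N\<lparr>carrier := H\<rparr>) f"
  by (auto simp: lin_map_def)

lemma lin_map_from_subset:
  "lin_map \<Lambda> M (N\<lparr>carrier := H\<rparr>) f \<Longrightarrow> H \<subseteq> carrier N \<Longrightarrow> lin_map \<Lambda> M N f"
  by (auto simp: lin_map_def subset_iff)

lemma lin_map_id: "lin_map \<Lambda> M M (\<lambda>x. x)"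
  by (auto simp: lin_map_def)

lemma restrict_lmod_hom:
  "left_module \<Lambda> M \<Longrightarrow> lin_map \<Lambda> M N f \<Longrightarrow> restrict f (carrier M) \<in> lmod_hom \<Lambda> M N"
  unfolding lmod_hom_iff lin_map_def
  by (auto simp: left_module.smult_closed' abelian_monoid.a_closed[OF abelian_group.axioms(1)] left_module_def)

lemma lin_map_cong:
  assumes "left_module \<Lambda> M" "lin_map \<Lambda> M N f" "\<And>x. x \<in> carrier M \<Longrightarrow> g x = f x"
  shows "lin_map \<Lambda> M N g"
proof -
  interpret left_module \<Lambda> M by fact
  show ?thesis using assms(2,3) by (auto simp: lin_map_def)
qed

section \<open>Kernels, images and preimages of linear maps\<close>

locale lin = M: left_module \<Lambda> M + N: left_module \<Lambda> N
  for \<Lambda> :: "'a ring" and M :: "('a, 'm) module" and N :: "('a, 'n) module" +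
  fixes f :: "'m \<Rightarrow> 'n"
  assumes map: "lin_map \<Lambda> M N f"
begin

lemma closed [simp, intro]: "x \<in> carrier M \<Longrightarrow> f x \<in> carrier N"
  and add: "x \<in> carrier M \<Longrightarrow> y \<in> carrier M \<Longrightarrow> f (x \<oplus>\<^bsub>M\<^esub> y) = f x \<oplus>\<^bsub>N\<^esub> f y"
  and smult: "a \<in> carrier \<Lambda> \<Longrightarrow> x \<in> carrier M \<Longrightarrow> f (a \<odot>\<^bsub>M\<^esub> x) = a \<odot>\<^bsub>N\<^esub> f x"
  using map by (auto simp: lin_map_def)

lemma zero [simp]: "f \<zero>\<^bsub>M\<^esub> = \<zero>\<^bsub>N\<^esub>"
  using smult[of "\<zero>\<^bsub>\<Lambda>\<^esub>" "\<zero>\<^bsub>M\<^esub>"] by simp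

lemma neg: "x \<in> carrier M \<Longrightarrow> f (\<ominus>\<^bsub>M\<^esub> x) = \<ominus>\<^bsub>N\<^esub> f x"
  by (metis M.M.a_inv_closed M.M.l_neg N.M.minus_equality add closed zero)

lemma minus: "x \<in> carrier M \<Longrightarrow> y \<in> carrier M \<Longrightarrow> f (x \<ominus>\<^bsub>M\<^esub> y) = f x \<ominus>\<^bsub>N\<^esub> f y"
  by (simp add: a_minus_def add neg)

lemma finsum:
  "finite A \<Longrightarrow> g \<in> A \<rightarrow> carrier M \<Longrightarrow> f (\<Oplus>\<^bsub>M\<^esub>i\<in>A. g i) = (\<Oplus>\<^bsub>N\<^esub>i\<in>A. f (g i))"
  by (induct set: finite) (simp_all add: Pi_def add)

lemma a_kernel_iff: "x \<in> a_kernel M N f \<longleftrightarrow> x \<in> carrier M \<and> f x = \<zero>\<^bsub>N\<^esub>"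
  by (simp add: a_kernel_def')

lemma submodule_kernel: "submodule (a_kernel M N f) \<Lambda> M"
  by (rule M.submoduleI) (auto simp: a_kernel_iff add smult)

lemma submodule_image:
  assumes "submodule H \<Lambda> M" shows "submodule (f ` H) \<Lambda> N"
proof (rule N.submoduleI)
  note H = M.submoduleD[OF assms]
  show "f ` H \<subseteq> carrier N" using H(1) by auto
  show "\<zero>\<^bsub>N\<^esub> \<in> f ` H" using H(2) by (metis imageI zero)
  fix x y assume "x \<in> f ` H" "y \<in> f ` H"
  then show "x \<oplus>\<^bsub>N\<^esub> y \<in> f ` H" using H(1,3) by (auto simp: subset_iff simp flip: add)
next
  note H = M.submoduleD[OF assms]
  fix r x assume "r \<in> carrier \<Lambda>" "x \<in> f ` H"
  then show "r \<odot>\<^bsub>N\<^esub> x \<in> f ` H" using H(1,4) by (auto simp: subset_iff simp flip: smult)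
qed

lemma submodule_range: "submodule (f ` carrier M) \<Lambda> N"
  by (rule submodule_image[OF M.submodule_carrier])

lemma submodule_preimage:
  assumes "submodule H \<Lambda> N" shows "submodule {x \<in> carrier M. f x \<in> H} \<Lambda> M"
  using N.submoduleD[OF assms] by (intro M.submoduleI) (auto simp: add smult)

end

lemma linI: "left_module \<Lambda> M \<Longrightarrow> left_module \<Lambda> N \<Longrightarrow> lin_map \<Lambda> M N f \<Longrightarrow> lin \<Lambda> M N f"
  by (simp add: lin_def lin_axioms_def)

lemma lin_map_plus:
  assumes "left_module \<Lambda> N" "lin_map \<Lambda> M N f" "lin_map \<Lambda> M N g"
  shows "lin_map \<Lambda> M N (\<lambda>x. f x \<oplus>\<^bsub>N\<^esub> g x)"
proof -
  interpret N: left_module \<Lambda> N by fact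
  show ?thesis using assms(2,3)
    by (intro lin_mapI) (auto simp: lin_map_def Pi_iff N.smult_r_distr N.M.a_ac)
qed

lemma lin_map_neg:
  assumes "left_module \<Lambda> N" "lin_map \<Lambda> M N f"
  shows "lin_map \<Lambda> M N (\<lambda>x. \<ominus>\<^bsub>N\<^esub> f x)"
proof -
  interpret N: left_module \<Lambda> N by fact
  show ?thesis using assms(2)
    by (intro lin_mapI) (auto simp: lin_map_def Pi_iff N.smult_r_minus N.M.minus_add N.M.a_ac)
qed

lemma lin_map_minus:
  assumes "left_module \<Lambda> N" "lin_map \<Lambda> M N f" "lin_map \<Lambda> M N g"
  shows "lin_map \<Lambda> M N (\<lambda>x. f x \<ominus>\<^bsub>N\<^esub> g x)"
  unfolding a_minus_def by (intro lin_map_plus lin_map_neg assms)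

lemma lin_map_zero:
  assumes "left_module \<Lambda> N" shows "lin_map \<Lambda> M N (\<lambda>x. \<zero>\<^bsub>N\<^esub>)"
proof -
  interpret N: left_module \<Lambda> N by fact
  show ?thesis by (intro lin_mapI) auto
qed

lemma lin_map_finsum:
  assumes "left_module \<Lambda> N" "finite A" "\<And>i. i \<in> A \<Longrightarrow> lin_map \<Lambda> M N (f i)"
  shows "lin_map \<Lambda> M N (\<lambda>x. \<Oplus>\<^bsub>N\<^esub>i\<in>A. f i x)"
proof -
  interpret N: left_module \<Lambda> N by fact
  have c: "f i x \<in> carrier N" if "i \<in> A" "x \<in> carrier M" for i x
    using lin_map_closed[OF assms(3)[OF that(1)] that(2)] .
  show ?thesis
  proof (rule lin_mapI)
    fix x y assume *: "x \<in> carrier M" "y \<in> carrier M"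
    have "(\<Oplus>\<^bsub>N\<^esub>i\<in>A. f i (x \<oplus>\<^bsub>M\<^esub> y)) = (\<Oplus>\<^bsub>N\<^esub>i\<in>A. f i x \<oplus>\<^bsub>N\<^esub> f i y)"
      using * c by (intro N.M.finsum_cong') (auto simp: lin_map_add[OF assms(3)])
    also have "\<dots> = (\<Oplus>\<^bsub>N\<^esub>i\<in>A. f i x) \<oplus>\<^bsub>N\<^esub> (\<Oplus>\<^bsub>N\<^esub>i\<in>A. f i y)"
      using * c by (intro N.M.finsum_addf) auto
    finally show "(\<Oplus>\<^bsub>N\<^esub>i\<in>A. f i (x \<oplus>\<^bsub>M\<^esub> y)) = (\<Oplus>\<^bsub>N\<^esub>i\<in>A. f i x) \<oplus>\<^bsub>N\<^esub> (\<Oplus>\<^bsub>N\<^esub>i\<in>A. f i y)" .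
  next
    fix a x assume *: "a \<in> carrier \<Lambda>" "x \<in> carrier M"
    have "(\<Oplus>\<^bsub>N\<^esub>i\<in>A. f i (a \<odot>\<^bsub>M\<^esub> x)) = (\<Oplus>\<^bsub>N\<^esub>i\<in>A. a \<odot>\<^bsub>N\<^esub> f i x)"
      using * c by (intro N.M.finsum_cong') (auto simp: lin_map_smult[OF assms(3)])
    also have "\<dots> = a \<odot>\<^bsub>N\<^esub> (\<Oplus>\<^bsub>N\<^esub>i\<in>A. f i x)"
      using * c assms(2) by (intro N.finsum_smult_ldistr[symmetric]) auto
    finally show "(\<Oplus>\<^bsub>N\<^esub>i\<in>A. f i (a \<odot>\<^bsub>M\<^esub> x)) = a \<odot>\<^bsub>N\<^esub> (\<Oplus>\<^bsub>N\<^esub>i\<in>A. f i x)" .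
  qed (use c in \<open>auto intro!: N.M.finsum_closed\<close>)
qed

section \<open>The regular module and the opposite ring\<close>

lemma regular_module_simps [simp]:
  "carrier (regular_module \<Lambda>) = carrier \<Lambda>" "\<zero>\<^bsub>regular_module \<Lambda>\<^esub> = \<zero>\<^bsub>\<Lambda>\<^esub>"
  "x \<oplus>\<^bsub>regular_module \<Lambda>\<^esub> y = x \<oplus>\<^bsub>\<Lambda>\<^esub> y" "x \<odot>\<^bsub>regular_module \<Lambda>\<^esub> y = x \<otimes>\<^bsub>\<Lambda>\<^esub> y"
  by (simp_all add: regular_module_def)

lemma regular_left_module:
  assumes "ring \<Lambda>" shows "left_module \<Lambda> (regular_module \<Lambda>)"
proof -
  interpret ring \<Lambda> by fact
  have "abelian_group (regular_module \<Lambda>)"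
    by (rule abelian_groupI) (auto simp: a_ac intro: l_neg)
  then show ?thesis
    by (auto simp: left_module_def left_module_axioms_def ring_axioms l_distr r_distr m_assoc)
qed

text \<open>With \<xi> a coordinate, sums of these maps of rank one give the maps out of free
  modules and the lifts along dual bases; with \<xi> the identity one gets the map from the ring
  onto a cyclic submodule.\<close>

lemma lin_map_smult_elem:
  assumes "left_module \<Lambda> M" "lin_map \<Lambda> N (regular_module \<Lambda>) \<xi>" "x \<in> carrier M"
  shows "lin_map \<Lambda> N M (\<lambda>y. \<xi> y \<odot>\<^bsub>M\<^esub> x)"
proof -
  interpret left_module \<Lambda> M by fact
  show ?thesis using assms(2,3)
    by (intro lin_mapI) (auto simp: lin_map_def Pi_iff smult_l_distr smult_assoc)
qed

lemma opposite_ring_simps [simp]: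
  "carrier (opposite_ring \<Lambda>) = carrier \<Lambda>" "\<zero>\<^bsub>opposite_ring \<Lambda>\<^esub> = \<zero>\<^bsub>\<Lambda>\<^esub>"
  "\<one>\<^bsub>opposite_ring \<Lambda>\<^esub> = \<one>\<^bsub>\<Lambda>\<^esub>" "x \<oplus>\<^bsub>opposite_ring \<Lambda>\<^esub> y = x \<oplus>\<^bsub>\<Lambda>\<^esub> y"
  "x \<otimes>\<^bsub>opposite_ring \<Lambda>\<^esub> y = y \<otimes>\<^bsub>\<Lambda>\<^esub> x" "opposite_ring (opposite_ring \<Lambda>) = \<Lambda>"
  by (simp_all add: opposite_ring_def)

lemma opposite_ring_ring:
  assumes "ring \<Lambda>" shows "ring (opposite_ring \<Lambda>)"
proof -
  interpret ring \<Lambda> by fact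
  have "abelian_group (opposite_ring \<Lambda>)"
    by (rule abelian_groupI) (auto simp: a_ac intro: l_neg)
  moreover have "monoid (opposite_ring \<Lambda>)"
    by (rule monoidI) (auto simp: m_assoc)
  ultimately show ?thesis
    by (intro ringI) (auto simp: l_distr r_distr)
qed

text \<open>Both the quotients of a module and its isomorphic copies arise in this way.\<close>

lemma surj_image_left_module:
  assumes "left_module \<Lambda> M" "lin_map \<Lambda> M N f" "f ` carrier M = carrier N" "\<zero>\<^bsub>N\<^esub> = f \<zero>\<^bsub>M\<^esub>"
  shows "left_module \<Lambda> N"
proof -
  interpret left_module \<Lambda> M by fact
  have f: "\<And>x y. x \<in> carrier M \<Longrightarrow> y \<in> carrier M \<Longrightarrow> f x \<oplus>\<^bsub>N\<^esub> f y = f (x \<oplus>\<^bsub>M\<^esub> y)"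
    "\<And>a x. a \<in> carrier \<Lambda> \<Longrightarrow> x \<in> carrier M \<Longrightarrow> a \<odot>\<^bsub>N\<^esub> f x = f (a \<odot>\<^bsub>M\<^esub> x)"
    using assms(2) by (auto simp: lin_map_def)
  have all: "(\<And>x. x \<in> carrier M \<Longrightarrow> Q (f x)) \<Longrightarrow> y \<in> carrier N \<Longrightarrow> Q y" for Q y
    using assms(3) by (metis imageE)
  have "abelian_group N"
  proof (rule abelian_groupI)
    show "\<zero>\<^bsub>N\<^esub> \<in> carrier N" using assms(3,4) by auto
    fix x assume x: "x \<in> carrier N"
    show "\<zero>\<^bsub>N\<^esub> \<oplus>\<^bsub>N\<^esub> x = x" using x by (rule all[rotated]) (simp add: assms(4) f)
    show "\<exists>y\<in>carrier N. y \<oplus>\<^bsub>N\<^esub> x = \<zero>\<^bsub>N\<^esub>"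
    proof -
      obtain m where m: "m \<in> carrier M" "x = f m" using x assms(3) by auto
      then have "f (\<ominus>\<^bsub>M\<^esub> m) \<in> carrier N" "f (\<ominus>\<^bsub>M\<^esub> m) \<oplus>\<^bsub>N\<^esub> x = \<zero>\<^bsub>N\<^esub>"
        using assms(3) by (auto simp: f M.l_neg assms(4))
      then show ?thesis by blast
    qed
    fix y assume y: "y \<in> carrier N"
    obtain m n where mn: "m \<in> carrier M" "x = f m" "n \<in> carrier M" "y = f n"
      using x y assms(3) by (metis imageE)
    show "x \<oplus>\<^bsub>N\<^esub> y \<in> carrier N" using mn assms(3) by (auto simp: f)
    show "x \<oplus>\<^bsub>N\<^esub> y = y \<oplus>\<^bsub>N\<^esub> x" using mn by (auto simp: f M.a_ac)
    fix z assume z: "z \<in> carrier N"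
    then obtain k where "k \<in> carrier M" "z = f k" using assms(3) by (metis imageE)
    then show "x \<oplus>\<^bsub>N\<^esub> y \<oplus>\<^bsub>N\<^esub> z = x \<oplus>\<^bsub>N\<^esub> (y \<oplus>\<^bsub>N\<^esub> z)"
      using mn by (auto simp: f M.a_ac)
  qed
  moreover have "left_module_axioms \<Lambda> N"
  proof
    fix a x assume a: "a \<in> carrier \<Lambda>" and x: "x \<in> carrier N"
    then obtain m where m: "m \<in> carrier M" "x = f m" using assms(3) by auto
    show "a \<odot>\<^bsub>N\<^esub> x \<in> carrier N" using m a assms(3) by (auto simp: f)
    fix b assume b: "b \<in> carrier \<Lambda>"
    show "(a \<oplus>\<^bsub>\<Lambda>\<^esub> b) \<odot>\<^bsub>N\<^esub> x = a \<odot>\<^bsub>N\<^esub> x \<oplus>\<^bsub>N\<^esub> b \<odot>\<^bsub>N\<^esub> x"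
      using m a b by (simp add: f smult_l_distr)
    show "(a \<otimes>\<^bsub>\<Lambda>\<^esub> b) \<odot>\<^bsub>N\<^esub> x = a \<odot>\<^bsub>N\<^esub> (b \<odot>\<^bsub>N\<^esub> x)"
      using m a b by (simp add: f smult_assoc)
  next
    fix a x y assume a: "a \<in> carrier \<Lambda>" and "x \<in> carrier N" "y \<in> carrier N"
    then obtain m n where "m \<in> carrier M" "x = f m" "n \<in> carrier M" "y = f n"
      using assms(3) by (metis imageE)
    then show "a \<odot>\<^bsub>N\<^esub> (x \<oplus>\<^bsub>N\<^esub> y) = a \<odot>\<^bsub>N\<^esub> x \<oplus>\<^bsub>N\<^esub> a \<odot>\<^bsub>N\<^esub> y"
      using a by (simp add: f smult_r_distr)
  next
    fix x assume "x \<in> carrier N"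
    then show "\<one>\<^bsub>\<Lambda>\<^esub> \<odot>\<^bsub>N\<^esub> x = x" by (rule all[rotated]) (simp add: f smult_one)
  qed
  ultimately show ?thesis by (simp add: left_module_def R.ring_axioms)
qed


lemma (in left_module) quotient_module:
  assumes "submodule N R M"
  shows "left_module R (quotient_module M N)"
    and "lin_map R M (quotient_module M N) (\<lambda>x. N +>\<^bsub>M\<^esub> x)"
    and "(\<lambda>x. N +>\<^bsub>M\<^esub> x) ` carrier M = carrier (quotient_module M N)"
    and "x \<in> carrier M \<Longrightarrow>
      N +>\<^bsub>M\<^esub> x = \<zero>\<^bsub>quotient_module M N\<^esub> \<longleftrightarrow> x \<in> N"
proof -
  interpret N: abelian_subgroup N M
    using assms M.abelian_group_axioms
    by (intro abelian_subgroupI3) (auto simp: additive_subgroup_def submodule_def)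
  note D = submoduleD[OF assms]
  show surj: "(\<lambda>x. N +>\<^bsub>M\<^esub> x) ` carrier M = carrier (quotient_module M N)"
    by (auto simp: quotient_module_def A_RCOSETS_def')
  have eqI: "N +>\<^bsub>M\<^esub> x = N +>\<^bsub>M\<^esub> y" if "x \<in> carrier M" "y \<in> carrier M" "x \<ominus>\<^bsub>M\<^esub> y \<in> N" for x y
    using M.a_repr_independence[OF N.a_rcos_module_rev[of y x] _ N.a_subgroup] that
    by (simp add: a_minus_def)
  \<comment> \<open>The product of a scalar with a coset is defined as a union over the members of
    the coset. All cosets in that union agree, so the union is again a coset.\<close>
  have smult: "(\<Union>x\<in>N +>\<^bsub>M\<^esub> y. N +>\<^bsub>M\<^esub> (a \<odot>\<^bsub>M\<^esub> x)) = N +>\<^bsub>M\<^esub> (a \<odot>\<^bsub>M\<^esub> y)"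
    if "a \<in> carrier R" "y \<in> carrier M" for a y
  proof -
    have "N +>\<^bsub>M\<^esub> (a \<odot>\<^bsub>M\<^esub> x) = N +>\<^bsub>M\<^esub> (a \<odot>\<^bsub>M\<^esub> y)" if x: "x \<in> N +>\<^bsub>M\<^esub> y" for x
    proof -
      have xc: "x \<in> carrier M" using N.a_elemrcos_carrier[OF \<open>y \<in> carrier M\<close> x] .
      have "x \<ominus>\<^bsub>M\<^esub> y \<in> N" using N.a_rcos_module_imp[OF \<open>y \<in> carrier M\<close> x] by (simp add: a_minus_def)
      then have "a \<odot>\<^bsub>M\<^esub> (x \<ominus>\<^bsub>M\<^esub> y) \<in> N" using D(4) \<open>a \<in> carrier R\<close> by blast
      then show ?thesis using \<open>a \<in> carrier R\<close> \<open>y \<in> carrier M\<close> xc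
        by (intro eqI) (auto simp: a_minus_def smult_r_distr smult_r_minus)
    qed
    moreover have "y \<in> N +>\<^bsub>M\<^esub> y" using that by (intro N.a_rcos_self)
    ultimately show ?thesis by blast
  qed
  show lm: "lin_map R M (quotient_module M N) (\<lambda>x. N +>\<^bsub>M\<^esub> x)"
    using surj by (intro lin_mapI) (auto simp: quotient_module_def smult N.a_rcos_sum)
  have z: "\<zero>\<^bsub>quotient_module M N\<^esub> = N +>\<^bsub>M\<^esub> \<zero>\<^bsub>M\<^esub>"
    using D(1) by (simp add: quotient_module_def)
  show "left_module R (quotient_module M N)"
    by (rule surj_image_left_module[OF left_module_axioms lm surj z])
  show "N +>\<^bsub>M\<^esub> x = \<zero>\<^bsub>quotient_module M N\<^esub> \<longleftrightarrow> x \<in> N" if "x \<in> carrier M"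
  proof
    show "x \<in> N" if "N +>\<^bsub>M\<^esub> x = \<zero>\<^bsub>quotient_module M N\<^esub>"
      using M.a_coset_join1[OF _ \<open>x \<in> carrier M\<close> N.a_subgroup] that by (simp add: quotient_module_def)
    show "N +>\<^bsub>M\<^esub> x = \<zero>\<^bsub>quotient_module M N\<^esub>" if "x \<in> N"
      using N.a_rcos_const[OF that] by (simp add: quotient_module_def)
  qed
qed

lemma lin_map_inv:
  assumes "left_module \<Lambda> M" "lin_map \<Lambda> M N f" "bij_betw f (carrier M) (carrier N)"
  shows "lin_map \<Lambda> N M (the_inv_into (carrier M) f)"
proof -
  interpret left_module \<Lambda> M by fact
  have inj: "inj_on f (carrier M)" and im: "carrier N = f ` carrier M"
    using assms(3) by (auto simp: bij_betw_def)
  have f: "\<And>x y. x \<in> carrier M \<Longrightarrow> y \<in> carrier M \<Longrightarrow> f x \<oplus>\<^bsub>N\<^esub> f y = f (x \<oplus>\<^bsub>M\<^esub> y)"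
    "\<And>a x. a \<in> carrier \<Lambda> \<Longrightarrow> x \<in> carrier M \<Longrightarrow> a \<odot>\<^bsub>N\<^esub> f x = f (a \<odot>\<^bsub>M\<^esub> x)"
    using assms(2) by (auto simp: lin_map_def)
  show ?thesis
    by (rule lin_mapI) (auto simp: im f the_inv_into_f_f[OF inj])
qed

text \<open>The bridge to the element type at which projectivity and injectivity are tested; the
  operations of the copy are read back through the inverse of \<theta>.\<close>

lemma transport_module:
  fixes M :: "('a, 'm) module" and \<theta> :: "'m \<Rightarrow> 'n"
  assumes "left_module \<Lambda> M" "inj_on \<theta> (carrier M)"
  obtains C :: "('a, 'n) module" where "left_module \<Lambda> C" "lin_map \<Lambda> M C \<theta>"
    "bij_betw \<theta> (carrier M) (carrier C)" "lin_map \<Lambda> C M (the_inv_into (carrier M) \<theta>)"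
proof -
  interpret left_module \<Lambda> M by fact
  let ?i = "the_inv_into (carrier M) \<theta>"
  define C :: "('a, 'n) module" where "C = \<lparr>carrier = \<theta> ` carrier M, mult = undefined,
    one = undefined, zero = \<theta> \<zero>\<^bsub>M\<^esub>, add = (\<lambda>x y. \<theta> (?i x \<oplus>\<^bsub>M\<^esub> ?i y)),
    smult = (\<lambda>a x. \<theta> (a \<odot>\<^bsub>M\<^esub> ?i x))\<rparr>"
  have lm: "lin_map \<Lambda> M C \<theta>"
    by (rule lin_mapI) (auto simp: C_def the_inv_into_f_f[OF assms(2)])
  moreover have b: "bij_betw \<theta> (carrier M) (carrier C)"
    using assms(2) by (auto simp: C_def bij_betw_def)
  moreover have "left_module \<Lambda> C"
    by (rule surj_image_left_module[OF assms(1) lm]) (auto simp: C_def)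
  ultimately show ?thesis using that lin_map_inv[OF assms(1) lm b] by blast
qed


section \<open>Free modules and generators\<close>

text \<open>Common to free modules, \<open>hom_to_ring\<close>, \<open>dual_module\<close> and
  groups of homomorphisms. Extensionality, contained in \<open>C\<close>, makes the zero function
  neutral although sums are restricted to A.\<close>

lemma pointwise_abelian_group:
  assumes "abelian_group N" and C: "carrier G \<subseteq> A \<rightarrow>\<^sub>E carrier N"
    and z: "\<zero>\<^bsub>G\<^esub> = (\<lambda>x\<in>A. \<zero>\<^bsub>N\<^esub>)"
    and p: "\<And>f g. f \<oplus>\<^bsub>G\<^esub> g = (\<lambda>x\<in>A. f x \<oplus>\<^bsub>N\<^esub> g x)"
    and "\<zero>\<^bsub>G\<^esub> \<in> carrier G"
    and "\<And>f g. f \<in> carrier G \<Longrightarrow> g \<in> carrier G \<Longrightarrow> f \<oplus>\<^bsub>G\<^esub> g \<in> carrier G"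
    and n: "\<And>f. f \<in> carrier G \<Longrightarrow> (\<lambda>x\<in>A. \<ominus>\<^bsub>N\<^esub> f x) \<in> carrier G"
  shows "abelian_group G"
proof -
  interpret N: abelian_group N by fact
  have c: "f x \<in> carrier N" if "f \<in> carrier G" "x \<in> A" for f x using C that by (auto simp: PiE_def)
  show ?thesis
  proof (rule abelian_groupI)
    fix f assume f: "f \<in> carrier G"
    show "\<exists>g\<in>carrier G. g \<oplus>\<^bsub>G\<^esub> f = \<zero>\<^bsub>G\<^esub>"
      by (rule bexI[OF _ n[OF f]]) (auto simp: p z c[OF f] N.l_neg)
    show "\<zero>\<^bsub>G\<^esub> \<oplus>\<^bsub>G\<^esub> f = f"
      using f C by (intro ext) (auto simp: p z c[OF f] PiE_def extensional_def restrict_def)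
  qed (use assms c in \<open>auto simp: N.a_ac\<close>)
qed

text \<open>Extensional functions on an initial segment give every rank the same element type
  \<open>nat => 'a\<close>, the one that the chosen resolutions and presentations have.\<close>

definition free_module :: "'a ring \<Rightarrow> nat \<Rightarrow> ('a, nat \<Rightarrow> 'a) module" where
  "free_module \<Lambda> n =
    \<lparr>carrier = {..<n} \<rightarrow>\<^sub>E carrier \<Lambda>, mult = undefined, one = undefined,
     zero = (\<lambda>i\<in>{..<n}. \<zero>\<^bsub>\<Lambda>\<^esub>), add = (\<lambda>c d. \<lambda>i\<in>{..<n}. c i \<oplus>\<^bsub>\<Lambda>\<^esub> d i),
     smult = (\<lambda>a c. \<lambda>i\<in>{..<n}. a \<otimes>\<^bsub>\<Lambda>\<^esub> c i)\<rparr>"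

definition free_basis :: "'a ring \<Rightarrow> nat \<Rightarrow> nat \<Rightarrow> nat \<Rightarrow> 'a" where
  "free_basis \<Lambda> n i = (\<lambda>j\<in>{..<n}. if i = j then \<one>\<^bsub>\<Lambda>\<^esub> else \<zero>\<^bsub>\<Lambda>\<^esub>)"

abbreviation lincomb :: "('a, 'm) module \<Rightarrow> nat \<Rightarrow> (nat \<Rightarrow> 'm) \<Rightarrow> (nat \<Rightarrow> 'a) \<Rightarrow> 'm" where
  "lincomb M n x c \<equiv> (\<Oplus>\<^bsub>M\<^esub>i\<in>{..<n}. c i \<odot>\<^bsub>M\<^esub> x i)"

lemma free_left_module:
  assumes "ring \<Lambda>" shows "left_module \<Lambda> (free_module \<Lambda> n)"
proof -
  interpret ring \<Lambda> by fact
  have "abelian_group (free_module \<Lambda> n)"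
    by (rule pointwise_abelian_group[where N = \<Lambda> and A = "{..<n}"])
      (auto simp: free_module_def is_abelian_group PiE_iff)
  moreover have "left_module_axioms \<Lambda> (free_module \<Lambda> n)"
    by unfold_locales
      (auto simp: free_module_def PiE_iff l_distr r_distr m_assoc extensional_def fun_eq_iff)
  ultimately show ?thesis by (simp add: left_module_def ring_axioms)
qed

lemma free_coord_lin_map: "i < n \<Longrightarrow> lin_map \<Lambda> (free_module \<Lambda> n) (regular_module \<Lambda>) (\<lambda>c. c i)"
  by (auto simp: lin_map_def free_module_def PiE_iff)

lemma free_basis_closed: "ring \<Lambda> \<Longrightarrow> free_basis \<Lambda> n i \<in> carrier (free_module \<Lambda> n)"
  by (auto simp: free_basis_def free_module_def ring.ring_simprules)

lemma free_carrierD: "c \<in> carrier (free_module \<Lambda> n) \<Longrightarrow> i < n \<Longrightarrow> c i \<in> carrier \<Lambda>"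
  by (auto simp: free_module_def)

lemma lincomb_lin_map:
  assumes "left_module \<Lambda> M" "\<And>i. i < n \<Longrightarrow> x i \<in> carrier M"
  shows "lin_map \<Lambda> (free_module \<Lambda> n) M (lincomb M n x)"
  by (rule lin_map_finsum[OF assms(1)])
    (auto intro: lin_map_smult_elem assms free_coord_lin_map)

lemma lincomb_closed:
  assumes "left_module \<Lambda> M" "\<And>i. i < n \<Longrightarrow> x i \<in> carrier M" "\<And>i. i < n \<Longrightarrow> c i \<in> carrier \<Lambda>"
  shows "lincomb M n x c \<in> carrier M"
proof -
  interpret left_module \<Lambda> M by fact
  show ?thesis using assms by (intro M.finsum_closed) auto
qed

lemma lincomb_restrict:
  assumes "left_module \<Lambda> M" "\<And>i. i < n \<Longrightarrow> x i \<in> carrier M" "\<And>i. i < n \<Longrightarrow> c i \<in> carrier \<Lambda>"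
  shows "lincomb M n x (restrict c {..<n}) = lincomb M n x c"
proof -
  interpret left_module \<Lambda> M by fact
  show ?thesis using assms by (intro M.finsum_cong') auto
qed

lemma lincomb_free_basis:
  assumes "left_module \<Lambda> M" "\<And>i. i < n \<Longrightarrow> x i \<in> carrier M" "j < n"
  shows "lincomb M n x (free_basis \<Lambda> n j) = x j"
proof -
  interpret left_module \<Lambda> M by fact
  have "lincomb M n x (free_basis \<Lambda> n j) = (\<Oplus>\<^bsub>M\<^esub>i\<in>{..<n}. if j = i then x i else \<zero>\<^bsub>M\<^esub>)"
    using assms by (intro M.finsum_cong') (auto simp: free_basis_def smult_one)
  also have "\<dots> = x j" using assms by (intro M.finsum_singleton) auto
  finally show ?thesis .
qed

lemma lin_map_lincomb:
  assumes "lin \<Lambda> M N f" "\<And>i. i < n \<Longrightarrow> x i \<in> carrier M" "\<And>i. i < n \<Longrightarrow> c i \<in> carrier \<Lambda>"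
  shows "f (lincomb M n x c) = lincomb N n (\<lambda>i. f (x i)) c"
proof -
  interpret lin \<Lambda> M N f by fact
  have "f (lincomb M n x c) = (\<Oplus>\<^bsub>N\<^esub>i\<in>{..<n}. f (c i \<odot>\<^bsub>M\<^esub> x i))"
    using assms by (intro finsum) auto
  also have "\<dots> = lincomb N n (\<lambda>i. f (x i)) c"
    using assms by (intro N.M.finsum_cong') (auto simp: smult)
  finally show ?thesis .
qed

lemma lincomb_cong:
  assumes "left_module \<Lambda> M" "\<And>i. i < n \<Longrightarrow> y i \<in> carrier M" "\<And>i. i < n \<Longrightarrow> d i \<in> carrier \<Lambda>"
    "\<And>i. i < n \<Longrightarrow> x i = y i" "\<And>i. i < n \<Longrightarrow> c i = d i"
  shows "lincomb M n x c = lincomb M n y d"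
proof -
  interpret left_module \<Lambda> M by fact
  show ?thesis using assms by (intro M.finsum_cong') auto
qed

section \<open>Generating families and finite generation\<close>

definition generates :: "'a ring \<Rightarrow> ('a, 'm) module \<Rightarrow> nat \<Rightarrow> (nat \<Rightarrow> 'm) \<Rightarrow> bool" where
  "generates \<Lambda> M n x \<longleftrightarrow> (\<forall>i<n. x i \<in> carrier M) \<and>
    lincomb M n x ` carrier (free_module \<Lambda> n) = carrier M"

lemma generatesD:
  assumes "generates \<Lambda> M n x"
  shows "i < n \<Longrightarrow> x i \<in> carrier M"
    "y \<in> carrier M \<Longrightarrow> \<exists>c\<in>carrier (free_module \<Lambda> n). y = lincomb M n x c"
  using assms by (auto simp: generates_def)

lemma generatesI:
  assumes "left_module \<Lambda> M" "\<And>i. i < n \<Longrightarrow> x i \<in> carrier M"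
    "\<And>y. y \<in> carrier M \<Longrightarrow> \<exists>c. (\<forall>i<n. c i \<in> carrier \<Lambda>) \<and> y = lincomb M n x c"
  shows "generates \<Lambda> M n x"
  unfolding generates_def
proof (intro conjI equalityI subsetI allI impI)
  show "i < n \<Longrightarrow> x i \<in> carrier M" for i by (rule assms(2))
  show "y \<in> carrier M" if "y \<in> lincomb M n x ` carrier (free_module \<Lambda> n)" for y
    using that lin_map_closed[OF lincomb_lin_map[of \<Lambda> M n x, OF assms(1,2)]] by auto
  fix y assume "y \<in> carrier M"
  then obtain c where c: "\<And>i. i < n \<Longrightarrow> c i \<in> carrier \<Lambda>" "y = lincomb M n x c" using assms(3) by blast
  have "y = lincomb M n x (restrict c {..<n})"
    using lincomb_restrict[of \<Lambda> M n x c, OF assms(1,2)] c by simp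
  moreover have "restrict c {..<n} \<in> carrier (free_module \<Lambda> n)"
    using c(1) by (auto simp: free_module_def)
  ultimately show "y \<in> lincomb M n x ` carrier (free_module \<Lambda> n)" by blast
qed

lemma (in left_module) submodule_lincomb:
  assumes "submodule N R M" "\<And>i. i < n \<Longrightarrow> x i \<in> N" "\<And>i. i < n \<Longrightarrow> c i \<in> carrier R"
  shows "lincomb M n x c \<in> N"
  using assms by (intro submodule_finsum) (auto intro: submoduleD)

text \<open>Replaces the definition by submodules with a surjection from a free module: the range of
  that map is a submodule containing the generators, and every submodule containing them contains
  their linear combinations.\<close>

lemma fg_module_iff: "fg_module \<Lambda> M \<longleftrightarrow> left_module \<Lambda> M \<and> (\<exists>n x. generates \<Lambda> M n x)"
proof (cases "left_module \<Lambda> M")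
  case True
  interpret left_module \<Lambda> M by fact
  interpret F: left_module \<Lambda> "free_module \<Lambda> n" for n by (rule free_left_module) (rule R.ring_axioms)
  show ?thesis
  proof
    assume "fg_module \<Lambda> M"
    then obtain S where S: "finite S" "S \<subseteq> carrier M"
      "\<And>N. submodule N \<Lambda> M \<Longrightarrow> S \<subseteq> N \<Longrightarrow> N = carrier M"
      unfolding fg_module_def by (elim conjE exE) simp
    obtain x n where x: "S = x ` {i::nat. i < n}" using finite_imp_nat_seg_image_inj_on[OF S(1)] by blast
    have xc: "x i \<in> carrier M" if "i < n" for i using that S(2) x by auto
    interpret L: lin \<Lambda> "free_module \<Lambda> n" M "lincomb M n x"
      by (intro linI lincomb_lin_map xc F.left_module_axioms left_module_axioms)
    have "lincomb M n x ` carrier (free_module \<Lambda> n) = carrier M"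
    proof (rule S(3)[OF L.submodule_range])
      show "S \<subseteq> lincomb M n x ` carrier (free_module \<Lambda> n)"
      proof
        fix s assume "s \<in> S"
        then obtain i where i: "i < n" "s = x i" using x by auto
        then have "s = lincomb M n x (free_basis \<Lambda> n i)"
          using lincomb_free_basis[of \<Lambda> M n x i, OF left_module_axioms xc] by simp
        then show "s \<in> lincomb M n x ` carrier (free_module \<Lambda> n)"
          using free_basis_closed[OF R.ring_axioms, of n i] by blast
      qed
    qed
    then show "left_module \<Lambda> M \<and> (\<exists>n x. generates \<Lambda> M n x)"
      using xc True unfolding generates_def by blast
  next
    assume "left_module \<Lambda> M \<and> (\<exists>n x. generates \<Lambda> M n x)"
    then obtain n x where g: "generates \<Lambda> M n x" by blast
    show "fg_module \<Lambda> M" unfolding fg_module_def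
    proof (intro conjI exI[of _ "x ` {..<n}"] allI impI)
      show "left_module \<Lambda> M" by fact
      show "x ` {..<n} \<subseteq> carrier M" using generatesD(1)[OF g] by auto
      fix N assume N: "submodule N \<Lambda> M \<and> x ` {..<n} \<subseteq> N"
      have "carrier M \<subseteq> N"
      proof
        fix y assume "y \<in> carrier M"
        then obtain c where "c \<in> carrier (free_module \<Lambda> n)" "y = lincomb M n x c"
          using generatesD(2)[OF g] by blast
        then show "y \<in> N" using N by (auto intro!: submodule_lincomb free_carrierD)
      qed
      then show "N = carrier M" using N submoduleD(1) by blast
    qed simp
  qed
next
  case False
  then show ?thesis by (simp add: fg_module_def)
qed

lemma fg_moduleE:
  assumes "fg_module \<Lambda> M"
  obtains n x where "left_module \<Lambda> M" "generates \<Lambda> M n x"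
  using assms fg_module_iff by blast

lemma generates_surj_image:
  assumes "lin \<Lambda> M N f" "f ` carrier M = carrier N" "generates \<Lambda> M n x"
  shows "generates \<Lambda> N n (\<lambda>i. f (x i))"
proof -
  interpret lin \<Lambda> M N f by fact
  note g = generatesD[OF assms(3)]
  show ?thesis
  proof (rule generatesI[OF N.left_module_axioms])
    fix y assume "y \<in> carrier N"
    then obtain z where z: "z \<in> carrier M" "y = f z" using assms(2) by auto
    then obtain c where c: "c \<in> carrier (free_module \<Lambda> n)" "z = lincomb M n x c" using g(2) by blast
    then have "y = lincomb N n (\<lambda>i. f (x i)) c"
      using lin_map_lincomb[OF assms(1), of n x c] g(1) free_carrierD[OF c(1)] z(2) by simp
    then show "\<exists>c. (\<forall>i<n. c i \<in> carrier \<Lambda>) \<and> y = lincomb N n (\<lambda>i. f (x i)) c"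
      using free_carrierD[OF c(1)] by blast
  qed (use g(1) in auto)
qed

lemma fg_module_surj_image:
  assumes "fg_module \<Lambda> M" "left_module \<Lambda> N" "lin_map \<Lambda> M N f" "f ` carrier M = carrier N"
  shows "fg_module \<Lambda> N"
  using assms generates_surj_image[OF linI] unfolding fg_module_iff by blast

lemma fg_module_copy:
  fixes M :: "('a, 'm) module"
  assumes "fg_module \<Lambda> M"
  obtains C :: "('a, (nat \<Rightarrow> 'a) set) module" and \<theta> where "left_module \<Lambda> C" "lin_map \<Lambda> M C \<theta>"
    "bij_betw \<theta> (carrier M) (carrier C)" "lin_map \<Lambda> C M (the_inv_into (carrier M) \<theta>)"
proof -
  obtain n x where lm: "left_module \<Lambda> M" and g: "generates \<Lambda> M n x"
    using assms by (rule fg_moduleE)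
  \<comment> \<open>An element y is encoded by its fibre under \<Lambda>^n -> M. Fibres are nonempty
    and any member determines y, so the encoding is injective.\<close>
  define \<theta> where "\<theta> y = {c \<in> carrier (free_module \<Lambda> n). y = lincomb M n x c}" for y
  have "inj_on \<theta> (carrier M)"
  proof (rule inj_onI)
    fix y z assume *: "y \<in> carrier M" "z \<in> carrier M" "\<theta> y = \<theta> z"
    obtain c where "c \<in> \<theta> y" using generatesD(2)[OF g *(1)] by (auto simp: \<theta>_def)
    then show "y = z" using *(3) by (auto simp: \<theta>_def)
  qed
  from transport_module[OF lm this] that show ?thesis by blast
qed


section \<open>Finite dual bases\<close>

text \<open>Amounts to P being a direct summand of \<Lambda>^n, with \<open>x\<close> and
  \<open>\<xi>\<close> encoding the projection and the inclusion. No module but P is mentioned, so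
  nothing depends on a test type.\<close>

definition dual_basis ::
  "'a ring \<Rightarrow> ('a, 'p) module \<Rightarrow> nat \<Rightarrow> (nat \<Rightarrow> 'p) \<Rightarrow> (nat \<Rightarrow> 'p \<Rightarrow> 'a) \<Rightarrow> bool" where
  "dual_basis \<Lambda> P n x \<xi> \<longleftrightarrow> left_module \<Lambda> P \<and> (\<forall>i<n. x i \<in> carrier P) \<and>
    (\<forall>i<n. lin_map \<Lambda> P (regular_module \<Lambda>) (\<xi> i)) \<and>
    (\<forall>p\<in>carrier P. lincomb P n x (\<lambda>i. \<xi> i p) = p)"

lemma dual_basisD:
  assumes "dual_basis \<Lambda> P n x \<xi>"
  shows "left_module \<Lambda> P" "i < n \<Longrightarrow> x i \<in> carrier P"
    "i < n \<Longrightarrow> lin_map \<Lambda> P (regular_module \<Lambda>) (\<xi> i)"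
    "i < n \<Longrightarrow> p \<in> carrier P \<Longrightarrow> \<xi> i p \<in> carrier \<Lambda>"
    "p \<in> carrier P \<Longrightarrow> lincomb P n x (\<lambda>i. \<xi> i p) = p"
  using assms lin_map_closed[of \<Lambda> P "regular_module \<Lambda>" "\<xi> i" p]
  unfolding dual_basis_def by auto

text \<open>It is enough to choose preimages of the finitely many f (x i): the lift sends p to their
  combination with coefficients \<xi> i p. Unlike in \<open>projective_module\<close>, A and B may
  have any element types.\<close>

lemma dual_basis_lift:
  assumes "dual_basis \<Lambda> P n x \<xi>" "left_module \<Lambda> A" "left_module \<Lambda> B"
    "lin_map \<Lambda> A B s" "lin_map \<Lambda> P B f" "\<And>i. i < n \<Longrightarrow> f (x i) \<in> s ` carrier A"
  obtains h where "lin_map \<Lambda> P A h" "\<And>p. p \<in> carrier P \<Longrightarrow> s (h p) = f p"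
proof -
  note d = dual_basisD[OF assms(1)]
  have "\<exists>a. \<forall>i. i < n \<longrightarrow> a i \<in> carrier A \<and> s (a i) = f (x i)"
    using assms(6) by (intro choice) (metis imageE)
  then obtain a where a: "\<And>i. i < n \<Longrightarrow> a i \<in> carrier A" "\<And>i. i < n \<Longrightarrow> s (a i) = f (x i)" by blast
  define h where "h p = lincomb A n a (\<lambda>i. \<xi> i p)" for p
  interpret s: lin \<Lambda> A B s by (rule linI) fact+
  interpret f: lin \<Lambda> P B f by (rule linI) (fact d(1) assms)+
  show ?thesis
  proof (rule that)
    show "lin_map \<Lambda> P A h"
      unfolding h_def by (intro lin_map_finsum lin_map_smult_elem assms) (auto intro: d a)
    fix p assume p: "p \<in> carrier P"
    have "s (h p) = lincomb B n (\<lambda>i. s (a i)) (\<lambda>i. \<xi> i p)"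
      unfolding h_def using p by (intro lin_map_lincomb[OF s.lin_axioms]) (auto intro: a d)
    also have "\<dots> = lincomb B n (\<lambda>i. f (x i)) (\<lambda>i. \<xi> i p)"
      using p by (intro lincomb_cong[OF assms(3)]) (auto intro: a d)
    also have "\<dots> = f (lincomb P n x (\<lambda>i. \<xi> i p))"
      using p by (intro lin_map_lincomb[OF f.lin_axioms, symmetric]) (auto intro: d)
    finally show "s (h p) = f p" using d(5)[OF p] by simp
  qed
qed

lemma dual_basis_projective:
  assumes "dual_basis \<Lambda> P n x \<xi>" shows "projective_module \<Lambda> P"
  unfolding projective_module_def
proof (intro conjI allI impI)
  show P: "left_module \<Lambda> P" by (rule dual_basisD[OF assms])
  fix B C :: "('a, (nat \<Rightarrow> 'a) set) module" and g f
  assume *: "left_module \<Lambda> B \<and> left_module \<Lambda> C \<and>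
      g \<in> lmod_hom \<Lambda> B C \<and> g ` carrier B = carrier C \<and> f \<in> lmod_hom \<Lambda> P C"
  then have "f p \<in> g ` carrier B" if "p \<in> carrier P" for p
    using that by (auto simp: lmod_hom_iff lin_map_closed)
  with * obtain h where "lin_map \<Lambda> P B h" "\<And>p. p \<in> carrier P \<Longrightarrow> g (h p) = f p"
    using dual_basis_lift[OF assms, of B C g f] dual_basisD(2)[OF assms] by (auto simp: lmod_hom_iff)
  then show "\<exists>h\<in>lmod_hom \<Lambda> P B. \<forall>x\<in>carrier P. g (h x) = f x"
    using restrict_lmod_hom[OF P] by (intro bexI[of _ "restrict h (carrier P)"]) auto
qed

lemma dual_basis_generates:
  assumes "dual_basis \<Lambda> P n x \<xi>" shows "generates \<Lambda> P n x"
proof (rule generatesI)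
  fix p assume "p \<in> carrier P"
  then show "\<exists>c. (\<forall>i<n. c i \<in> carrier \<Lambda>) \<and> p = lincomb P n x c"
    using dual_basisD(4,5)[OF assms] by (intro exI[of _ "\<lambda>i. \<xi> i p"]) simp
qed (use dual_basisD[OF assms] in auto)

lemma dual_basis_fg: "dual_basis \<Lambda> P n x \<xi> \<Longrightarrow> fg_module \<Lambda> P"
  using dual_basis_generates dual_basisD(1) fg_module_iff by blast

lemma free_dual_basis:
  assumes "ring \<Lambda>" shows "dual_basis \<Lambda> (free_module \<Lambda> n) n (free_basis \<Lambda> n) (\<lambda>i c. c i)"
  unfolding dual_basis_def
proof (intro conjI allI impI ballI)
  interpret ring \<Lambda> by fact
  show lm: "left_module \<Lambda> (free_module \<Lambda> n)" by (rule free_left_module[OF assms])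
  interpret F: left_module \<Lambda> "free_module \<Lambda> n" by (rule lm)
  fix c assume c: "c \<in> carrier (free_module \<Lambda> n)"
  show "lincomb (free_module \<Lambda> n) n (free_basis \<Lambda> n) (\<lambda>i. c i) = c"
  proof (rule PiE_ext[of _ "{..<n}" "\<lambda>_. carrier \<Lambda>"])
    show "lincomb (free_module \<Lambda> n) n (free_basis \<Lambda> n) (\<lambda>i. c i) \<in> {..<n} \<rightarrow>\<^sub>E carrier \<Lambda>"
      using lincomb_closed[OF lm, of n "free_basis \<Lambda> n" c] free_basis_closed[OF assms] free_carrierD[OF c]
      by (simp add: free_module_def)
    show "c \<in> {..<n} \<rightarrow>\<^sub>E carrier \<Lambda>" using c by (simp add: free_module_def)
    fix j assume j: "j \<in> {..<n}"
    interpret L: lin \<Lambda> "free_module \<Lambda> n" "regular_module \<Lambda>" "\<lambda>c. c j"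
      using j by (intro linI lm regular_left_module assms free_coord_lin_map) auto
    have "lincomb (free_module \<Lambda> n) n (free_basis \<Lambda> n) (\<lambda>i. c i) j =
      lincomb (regular_module \<Lambda>) n (\<lambda>i. free_basis \<Lambda> n i j) c"
      by (intro lin_map_lincomb[OF L.lin_axioms] free_basis_closed assms free_carrierD[OF c])
    also have "\<dots> = (\<Oplus>\<^bsub>regular_module \<Lambda>\<^esub>i\<in>{..<n}. if j = i then c i else \<zero>\<^bsub>regular_module \<Lambda>\<^esub>)"
      using j free_carrierD[OF c] by (intro L.N.M.finsum_cong') (auto simp: free_basis_def)
    also have "\<dots> = c j"
      using j free_carrierD[OF c] by (intro L.N.M.finsum_singleton) auto
    finally show "lincomb (free_module \<Lambda> n) n (free_basis \<Lambda> n) (\<lambda>i. c i) j = c j" .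
  qed
qed (auto intro: free_coord_lin_map free_basis_closed assms)

lemma dual_basis_retract:
  assumes "dual_basis \<Lambda> F n x \<xi>" "left_module \<Lambda> P" "lin_map \<Lambda> F P r" "lin_map \<Lambda> P F i"
    "\<And>p. p \<in> carrier P \<Longrightarrow> r (i p) = p"
  shows "dual_basis \<Lambda> P n (\<lambda>j. r (x j)) (\<lambda>j p. \<xi> j (i p))"
proof -
  note d = dual_basisD[OF assms(1)]
  interpret r: lin \<Lambda> F P r by (rule linI) (fact d(1) assms)+
  interpret i: lin \<Lambda> P F i by (rule linI) (fact d(1) assms)+
  have "lincomb P n (\<lambda>j. r (x j)) (\<lambda>j. \<xi> j (i p)) = p" if p: "p \<in> carrier P" for p
  proof -
    have "lincomb P n (\<lambda>j. r (x j)) (\<lambda>j. \<xi> j (i p)) = r (lincomb F n x (\<lambda>j. \<xi> j (i p)))"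
      using p by (intro lin_map_lincomb[OF r.lin_axioms, symmetric]) (auto intro: d)
    then show ?thesis using d(5)[OF i.closed[OF p]] assms(5)[OF p] by simp
  qed
  then show ?thesis
    unfolding dual_basis_def using d(2) assms(2) by (auto intro: lin_map_comp[OF assms(4)] d(3))
qed

lemma projective_dual_basis:
  fixes P :: "('a, 'p) module"
  assumes "fg_module \<Lambda> P" "projective_module \<Lambda> P"
  obtains n x \<xi> where "dual_basis \<Lambda> P n x \<xi>"
proof -
  obtain n x where P: "left_module \<Lambda> P" and g: "generates \<Lambda> P n x"
    using assms(1) by (rule fg_moduleE)
  interpret P: left_module \<Lambda> P by fact
  let ?F = "free_module \<Lambda> n"
  have F: "left_module \<Lambda> ?F" by (rule free_left_module) (rule P.R.ring_axioms)
  obtain C :: "('a, (nat \<Rightarrow> 'a) set) module" and \<theta>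
    where C: "left_module \<Lambda> C" "lin_map \<Lambda> P C \<theta>" "bij_betw \<theta> (carrier P) (carrier C)"
    using fg_module_copy[OF assms(1)] by metis
  \<comment> \<open>Singletons embed the free module into the test type.\<close>
  have "inj_on (\<lambda>c::nat \<Rightarrow> 'a. {c}) (carrier ?F)" by (auto intro: inj_onI)
  then obtain B :: "('a, (nat \<Rightarrow> 'a) set) module" and \<tau> where
    B: "left_module \<Lambda> B" "bij_betw (\<lambda>c. {c}) (carrier ?F) (carrier B)" "lin_map \<Lambda> B ?F \<tau>"
    "\<tau> = the_inv_into (carrier ?F) (\<lambda>c. {c})"
    using transport_module[OF F] by metis
  have L: "lin_map \<Lambda> ?F P (lincomb P n x)"
    by (intro lincomb_lin_map P generatesD(1)[OF g])
  \<comment> \<open>The surjection from the free module to P, read between the two copies. Lifting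
    \<theta>, the identity of P in disguise, against it yields a section, so P is a retract of the
    free module.\<close>
  let ?g = "restrict (\<lambda>b. \<theta> (lincomb P n x (\<tau> b))) (carrier B)"
  have "?g \<in> lmod_hom \<Lambda> B C"
    by (intro restrict_lmod_hom B lin_map_comp[OF B(3) lin_map_comp[OF L C(2)]])
  moreover have "?g ` carrier B = carrier C"
  proof -
    have \<tau>: "\<tau> ` carrier B = carrier ?F"
      using bij_betw_the_inv_into[OF B(2)] by (simp add: B(4) bij_betw_def)
    have "?g ` carrier B = \<theta> ` lincomb P n x ` \<tau> ` carrier B"
      by (simp only: image_image image_restrict_eq)
    then show ?thesis using \<tau> g C(3) by (simp add: generates_def bij_betw_def)
  qed
  ultimately have "\<exists>h\<in>lmod_hom \<Lambda> P B. \<forall>p\<in>carrier P. ?g (h p) = restrict \<theta> (carrier P) p"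
    using B(1) C(1) restrict_lmod_hom[OF P C(2)]
    by (intro assms(2)[unfolded projective_module_def, THEN conjunct2, rule_format] conjI)
  then obtain h where h: "h \<in> lmod_hom \<Lambda> P B"
    "\<And>p. p \<in> carrier P \<Longrightarrow> ?g (h p) = restrict \<theta> (carrier P) p" by blast
  have hl: "lin_map \<Lambda> P B h" using h(1) by (rule lmod_hom_lin_map)
  have hF: "lin_map \<Lambda> P ?F (\<lambda>p. \<tau> (h p))" by (rule lin_map_comp[OF hl B(3)])
  have "lincomb P n x (\<tau> (h p)) = p" if p: "p \<in> carrier P" for p
  proof -
    have "\<theta> (lincomb P n x (\<tau> (h p))) = \<theta> p" using h(2)[OF p] p lin_map_closed[OF hl p] by simp
    moreover have "lincomb P n x (\<tau> (h p)) \<in> carrier P" using lin_map_closed[OF lin_map_comp[OF hF L] p] .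
    ultimately show ?thesis using p C(3) by (auto simp: bij_betw_def dest: inj_onD)
  qed
  then have "dual_basis \<Lambda> P n (\<lambda>j. lincomb P n x (free_basis \<Lambda> n j)) (\<lambda>j p. \<tau> (h p) j)"
    by (rule dual_basis_retract[OF free_dual_basis[OF P.R.ring_axioms] P L hF])
  then show ?thesis by (rule that)
qed


section \<open>Duals of modules\<close>

text \<open>Sums depend on the additive structure alone, so a linear combination over the opposite
  ring becomes one over the ring with the two factors of each term exchanged.\<close>

lemma finsum_regular [simp]:
  "finsum (regular_module \<Lambda>) = finsum \<Lambda>" "finsum (opposite_ring \<Lambda>) = finsum \<Lambda>"
  by (simp_all add: fun_eq_iff finsum_def finprod_def regular_module_def opposite_ring_def)

lemma hom_to_ring_simps:
  "carrier (hom_to_ring S Q) = lmod_hom S Q (regular_module S)"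
  "\<zero>\<^bsub>hom_to_ring S Q\<^esub> = (\<lambda>x\<in>carrier Q. \<zero>\<^bsub>S\<^esub>)"
  "f \<oplus>\<^bsub>hom_to_ring S Q\<^esub> g = (\<lambda>x\<in>carrier Q. f x \<oplus>\<^bsub>S\<^esub> g x)"
  "a \<odot>\<^bsub>hom_to_ring S Q\<^esub> f = (\<lambda>x\<in>carrier Q. f x \<otimes>\<^bsub>S\<^esub> a)"
  by (simp_all add: hom_to_ring_def)

lemma hom_to_ring_lin_map: "f \<in> carrier (hom_to_ring S Q) \<Longrightarrow> lin_map S Q (regular_module S) f"
  by (simp add: hom_to_ring_simps lmod_hom_iff)

lemma hom_to_ringI:
  "left_module S Q \<Longrightarrow> lin_map S Q (regular_module S) f \<Longrightarrow>
    restrict f (carrier Q) \<in> carrier (hom_to_ring S Q)"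
  by (simp add: hom_to_ring_simps restrict_lmod_hom)

lemma hom_to_ring_closed:
  "f \<in> carrier (hom_to_ring S Q) \<Longrightarrow> x \<in> carrier Q \<Longrightarrow> f x \<in> carrier S"
  using lin_map_closed[OF hom_to_ring_lin_map, of f S Q x] by simp

lemma hom_to_ring_eqI:
  assumes "f \<in> carrier (hom_to_ring S Q)" "g \<in> carrier (hom_to_ring S Q)"
    "\<And>x. x \<in> carrier Q \<Longrightarrow> f x = g x"
  shows "f = g"
  using assms by (auto simp: hom_to_ring_simps lmod_hom_iff intro: extensionalityI)

lemma hom_to_ring_left_module:
  assumes "left_module S Q" shows "left_module (opposite_ring S) (hom_to_ring S Q)"
proof -
  interpret Q: left_module S Q by fact
  have reg: "left_module S (regular_module S)" by (rule regular_left_module) (rule Q.R.ring_axioms)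
  interpret reg: left_module S "regular_module S" by (rule reg)
  have plus: "(\<lambda>x\<in>carrier Q. f x \<oplus>\<^bsub>S\<^esub> g x) \<in> lmod_hom S Q (regular_module S)"
    if "f \<in> lmod_hom S Q (regular_module S)" "g \<in> lmod_hom S Q (regular_module S)" for f g
    using restrict_lmod_hom[OF assms lin_map_plus[OF reg that[THEN lmod_hom_lin_map]]] by simp
  have neg: "(\<lambda>x\<in>carrier Q. \<ominus>\<^bsub>S\<^esub> f x) \<in> lmod_hom S Q (regular_module S)"
    if f: "f \<in> lmod_hom S Q (regular_module S)" for f
  proof -
    have "lin_map S Q (regular_module S) (\<lambda>x. \<ominus>\<^bsub>S\<^esub> f x)"
      using lmod_hom_lin_map[OF f]
      by (auto simp: lin_map_def Q.R.r_minus Q.R.minus_add Q.R.a_ac Pi_iff)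
    then show ?thesis by (rule restrict_lmod_hom[OF assms])
  qed
  have zero: "(\<lambda>x\<in>carrier Q. \<zero>\<^bsub>S\<^esub>) \<in> lmod_hom S Q (regular_module S)"
    using restrict_lmod_hom[OF assms lin_map_zero[OF reg]] by simp
  have smult: "(\<lambda>x\<in>carrier Q. f x \<otimes>\<^bsub>S\<^esub> a) \<in> lmod_hom S Q (regular_module S)"
    if "f \<in> lmod_hom S Q (regular_module S)" "a \<in> carrier S" for f a
    by (rule restrict_lmod_hom[OF assms])
      (use that lin_map_smult_elem[OF reg lmod_hom_lin_map[OF that(1)]] in simp)
  have "lmod_hom S Q (regular_module S) \<subseteq> carrier Q \<rightarrow>\<^sub>E carrier S"
    by (auto simp: lmod_hom_def)
  then have "abelian_group (hom_to_ring S Q)"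
    by (intro pointwise_abelian_group[where N = S and A = "carrier Q"])
      (simp_all add: hom_to_ring_simps Q.R.abelian_group_axioms plus neg zero)
  moreover have "left_module_axioms (opposite_ring S) (hom_to_ring S Q)"
  proof
    fix a f assume a: "a \<in> carrier (opposite_ring S)" and f: "f \<in> carrier (hom_to_ring S Q)"
    show "a \<odot>\<^bsub>hom_to_ring S Q\<^esub> f \<in> carrier (hom_to_ring S Q)"
      using smult[of f a] a f by (simp add: hom_to_ring_simps)
    fix b assume b: "b \<in> carrier (opposite_ring S)"
    show "(a \<oplus>\<^bsub>opposite_ring S\<^esub> b) \<odot>\<^bsub>hom_to_ring S Q\<^esub> f =
        a \<odot>\<^bsub>hom_to_ring S Q\<^esub> f \<oplus>\<^bsub>hom_to_ring S Q\<^esub> b \<odot>\<^bsub>hom_to_ring S Q\<^esub> f"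
      "(a \<otimes>\<^bsub>opposite_ring S\<^esub> b) \<odot>\<^bsub>hom_to_ring S Q\<^esub> f =
        a \<odot>\<^bsub>hom_to_ring S Q\<^esub> (b \<odot>\<^bsub>hom_to_ring S Q\<^esub> f)"
      using a b hom_to_ring_closed[OF f]
      by (auto simp: hom_to_ring_simps(2-) Q.R.r_distr Q.R.m_assoc)
    fix g assume g: "g \<in> carrier (hom_to_ring S Q)"
    show "a \<odot>\<^bsub>hom_to_ring S Q\<^esub> (f \<oplus>\<^bsub>hom_to_ring S Q\<^esub> g) =
        a \<odot>\<^bsub>hom_to_ring S Q\<^esub> f \<oplus>\<^bsub>hom_to_ring S Q\<^esub> a \<odot>\<^bsub>hom_to_ring S Q\<^esub> g"
      using a hom_to_ring_closed[OF f] hom_to_ring_closed[OF g]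
      by (auto simp: hom_to_ring_simps(2-) Q.R.l_distr)
  next
    fix f assume f: "f \<in> carrier (hom_to_ring S Q)"
    then have "f \<in> extensional (carrier Q)" by (simp add: hom_to_ring_simps lmod_hom_iff)
    then show "\<one>\<^bsub>opposite_ring S\<^esub> \<odot>\<^bsub>hom_to_ring S Q\<^esub> f = f"
      using hom_to_ring_closed[OF f]
      by (auto simp: hom_to_ring_simps(2-) extensional_def fun_eq_iff)
  qed
  ultimately show ?thesis
    by (simp add: left_module_def opposite_ring_ring Q.R.ring_axioms)
qed

lemma hom_to_ring_eval:
  "q \<in> carrier Q \<Longrightarrow>
    lin_map (opposite_ring S) (hom_to_ring S Q) (regular_module (opposite_ring S)) (\<lambda>f. f q)"
  by (rule lin_mapI) (auto simp: hom_to_ring_closed hom_to_ring_simps(2-))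

lemma hom_to_ring_comp:
  assumes "left_module S Q" "lin_map S Q Q' g"
  shows "lin_map (opposite_ring S) (hom_to_ring S Q') (hom_to_ring S Q)
    (\<lambda>f. compose (carrier Q) f g)"
proof -
  interpret left_module S Q by fact
  show ?thesis
  proof (rule lin_mapI)
    fix f assume "f \<in> carrier (hom_to_ring S Q')"
    then show "compose (carrier Q) f g \<in> carrier (hom_to_ring S Q)"
      unfolding compose_def using assms lin_map_comp[OF assms(2) hom_to_ring_lin_map]
      by (intro hom_to_ringI) auto
  qed (use lin_map_closed[OF assms(2)] in \<open>auto simp: hom_to_ring_simps(2-) compose_def fun_eq_iff\<close>)
qed

text \<open>Elements and functionals exchange roles: applying f to the expansion of x in the q i
  writes f x as the sum of the products of w i x with f (q i), and this is the expansion of f in the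
  w i.\<close>

lemma dual_basis_dual:
  assumes "dual_basis S Q n q w"
  shows "dual_basis (opposite_ring S) (hom_to_ring S Q) n
    (\<lambda>i. restrict (w i) (carrier Q)) (\<lambda>i f. f (q i))"
proof -
  note d = dual_basisD[OF assms]
  interpret Q: left_module S Q by (rule d(1))
  have H: "left_module (opposite_ring S) (hom_to_ring S Q)" by (rule hom_to_ring_left_module[OF d(1)])
  have reg: "left_module S (regular_module S)" "left_module (opposite_ring S) (regular_module (opposite_ring S))"
    by (intro regular_left_module opposite_ring_ring Q.R.ring_axioms)+
  have wc: "restrict (w i) (carrier Q) \<in> carrier (hom_to_ring S Q)" if "i < n" for i
    using that by (intro hom_to_ringI d) auto
  have "lincomb (hom_to_ring S Q) n (\<lambda>i. restrict (w i) (carrier Q)) (\<lambda>i. f (q i)) = f"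
    if f: "f \<in> carrier (hom_to_ring S Q)" for f
  proof (rule hom_to_ring_eqI[OF _ f])
    have fq: "\<And>i. i < n \<Longrightarrow> f (q i) \<in> carrier S" using hom_to_ring_closed[OF f] d by auto
    show "lincomb (hom_to_ring S Q) n (\<lambda>i. restrict (w i) (carrier Q)) (\<lambda>i. f (q i))
      \<in> carrier (hom_to_ring S Q)"
      by (rule lincomb_closed[OF H]) (use wc fq in auto)
    fix x assume x: "x \<in> carrier Q"
    interpret e: lin "opposite_ring S" "hom_to_ring S Q" "regular_module (opposite_ring S)" "\<lambda>f. f x"
      by (intro linI H reg hom_to_ring_eval x)
    interpret f: lin S Q "regular_module S" f
      by (intro linI d reg hom_to_ring_lin_map f)
    have "lincomb (hom_to_ring S Q) n (\<lambda>i. restrict (w i) (carrier Q)) (\<lambda>i. f (q i)) x =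
      lincomb (regular_module (opposite_ring S)) n (\<lambda>i. restrict (w i) (carrier Q) x) (\<lambda>i. f (q i))"
      by (rule lin_map_lincomb[OF e.lin_axioms]) (use wc fq in auto)
    also have "\<dots> = lincomb (regular_module S) n (\<lambda>i. f (q i)) (\<lambda>i. w i x)" using x by simp
    also have "\<dots> = f (lincomb Q n q (\<lambda>i. w i x))"
      by (rule lin_map_lincomb[OF f.lin_axioms, symmetric]) (use d x in auto)
    finally show "lincomb (hom_to_ring S Q) n (\<lambda>i. restrict (w i) (carrier Q)) (\<lambda>i. f (q i)) x = f x"
      using d(5)[OF x] by simp
  qed
  then show ?thesis
    unfolding dual_basis_def using H wc hom_to_ring_eval[OF d(2)] by simp
qed

text \<open>The coordinates w i are among the functionals and already determine a point.\<close>

lemma dual_basis_separates: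
  assumes "dual_basis S Q n q w" "p \<in> carrier Q" "p' \<in> carrier Q"
    "\<And>f. f \<in> carrier (hom_to_ring S Q) \<Longrightarrow> f p = f p'"
  shows "p = p'"
proof -
  note d = dual_basisD[OF assms(1)]
  have "w i p = w i p'" if "i < n" for i
    using assms(4)[OF hom_to_ringI[OF d(1) d(3)[OF that]]] assms(2,3) by simp
  then have "lincomb Q n q (\<lambda>i. w i p) = lincomb Q n q (\<lambda>i. w i p')"
    using d assms(3) by (intro lincomb_cong) auto
  then show ?thesis using d(5) assms(2,3) by simp
qed

text \<open>Expanding f in the w i with coefficients f (q i) gives g f = f p, where p is the
  combination of the q i with coefficients g (w i). So Q maps onto its bidual.\<close>

lemma dual_basis_reflexive:
  assumes "dual_basis S Q n q w"
    and "lin_map (opposite_ring S) (hom_to_ring S Q) (regular_module (opposite_ring S)) g"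
  obtains p where "p \<in> carrier Q" "\<And>f. f \<in> carrier (hom_to_ring S Q) \<Longrightarrow> g f = f p"
proof -
  note d = dual_basisD[OF assms(1)] and d' = dual_basisD[OF dual_basis_dual[OF assms(1)]]
  interpret Q: left_module S Q by (rule d(1))
  have reg: "left_module S (regular_module S)" "left_module (opposite_ring S) (regular_module (opposite_ring S))"
    by (intro regular_left_module opposite_ring_ring Q.R.ring_axioms)+
  interpret g: lin "opposite_ring S" "hom_to_ring S Q" "regular_module (opposite_ring S)" g
    by (intro linI d' reg assms)
  define a where "a i = g (restrict (w i) (carrier Q))" for i
  have a: "a i \<in> carrier S" if "i < n" for i using g.closed[OF d'(2)[OF that]] by (simp add: a_def)
  show ?thesis
  proof (rule that)
    show "lincomb Q n q a \<in> carrier Q" by (rule lincomb_closed[OF d(1)]) (auto intro: d a)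
    fix f assume f: "f \<in> carrier (hom_to_ring S Q)"
    interpret f: lin S Q "regular_module S" f
      by (intro linI d reg hom_to_ring_lin_map f)
    have "g f = g (lincomb (hom_to_ring S Q) n (\<lambda>i. restrict (w i) (carrier Q)) (\<lambda>i. f (q i)))"
      using d'(5)[OF f] by simp
    also have "\<dots> = lincomb (regular_module (opposite_ring S)) n a (\<lambda>i. f (q i))"
      unfolding a_def by (rule lin_map_lincomb[OF g.lin_axioms]) (use d' f in auto)
    also have "\<dots> = lincomb (regular_module S) n (\<lambda>i. f (q i)) a" by simp
    also have "\<dots> = f (lincomb Q n q a)"
      by (rule lin_map_lincomb[OF f.lin_axioms, symmetric]) (use d a in auto)
    finally show "g f = f (lincomb Q n q a)" .
  qed
qed


section \<open>Restriction of scalars and the duality\<close>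

lemma restrict_scalars_simps [simp]:
  "carrier (restrict_scalars \<phi> M) = carrier M" "\<zero>\<^bsub>restrict_scalars \<phi> M\<^esub> = \<zero>\<^bsub>M\<^esub>"
  "x \<oplus>\<^bsub>restrict_scalars \<phi> M\<^esub> y = x \<oplus>\<^bsub>M\<^esub> y" "r \<odot>\<^bsub>restrict_scalars \<phi> M\<^esub> x = \<phi> r \<odot>\<^bsub>M\<^esub> x"
  by (simp_all add: restrict_scalars_def)

lemma restrict_scalars_left_module:
  assumes "left_module \<Lambda> M" "ring R" "\<phi> \<in> ring_hom R \<Lambda>"
  shows "left_module R (restrict_scalars \<phi> M)"
proof -
  interpret left_module \<Lambda> M by fact
  note h = ring_hom_memE[OF assms(3)]
  have "abelian_group (restrict_scalars \<phi> M)"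
    by (rule abelian_groupI) (auto simp: M.a_ac intro: M.l_neg)
  moreover have "left_module_axioms R (restrict_scalars \<phi> M)"
    using h by unfold_locales (auto simp: smult_l_distr smult_r_distr smult_assoc smult_one)
  ultimately show ?thesis by (simp add: left_module_def assms(2))
qed

lemma lin_map_restrict_scalars:
  "\<phi> \<in> ring_hom R \<Lambda> \<Longrightarrow> lin_map \<Lambda> M N f \<Longrightarrow>
    lin_map R (restrict_scalars \<phi> M) (restrict_scalars \<phi> N) f"
  by (auto simp: lin_map_def ring_hom_def)

lemma submodule_restrict_scalars:
  fixes R :: "'r ring"
  assumes "left_module \<Lambda> M" "ring R" "\<phi> \<in> ring_hom R \<Lambda>" "submodule H \<Lambda> M"
  shows "submodule H R (restrict_scalars \<phi> M)"
proof -
  interpret left_module \<Lambda> M by fact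
  interpret r: left_module R "restrict_scalars \<phi> M" by (rule restrict_scalars_left_module) fact+
  show ?thesis
    using submoduleD[OF assms(4)] ring_hom_memE[OF assms(3)] by (intro r.submoduleI) auto
qed

text \<open>The products a x i, with a from a finite generating set of \<Lambda> over R and x i from
  one of M over \<Lambda>, generate M over R: pulling a submodule N back along b -> b x i shows that
  N contains all multiples of x i.\<close>

lemma fg_module_restrict_scalars:
  assumes "fg_module \<Lambda> M" "ring R" "\<phi> \<in> ring_hom R \<Lambda>"
    and "fg_module R (restrict_scalars \<phi> (regular_module \<Lambda>))"
  shows "fg_module R (restrict_scalars \<phi> M)"
proof -
  obtain n x where M: "left_module \<Lambda> M" and g: "generates \<Lambda> M n x"
    using assms(1) by (rule fg_moduleE)
  interpret M: left_module \<Lambda> M by fact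
  interpret r: left_module R "restrict_scalars \<phi> M" by (rule restrict_scalars_left_module) fact+
  interpret L: left_module R "restrict_scalars \<phi> (regular_module \<Lambda>)"
    by (rule restrict_scalars_left_module[OF regular_left_module]) (fact M.R.ring_axioms assms)+
  obtain S where S: "finite S" "S \<subseteq> carrier \<Lambda>"
    "\<And>N. submodule N R (restrict_scalars \<phi> (regular_module \<Lambda>)) \<Longrightarrow> S \<subseteq> N \<Longrightarrow> N = carrier \<Lambda>"
    using assms(4) unfolding fg_module_def by (elim conjE exE) simp
  show ?thesis
    unfolding fg_module_def
  proof (intro conjI exI allI impI)
    let ?T = "(\<lambda>(a, i). a \<odot>\<^bsub>M\<^esub> x i) ` (S \<times> {..<n})"
    show "finite ?T" using S(1) by simp
    show "?T \<subseteq> carrier (restrict_scalars \<phi> M)" using S(2) generatesD(1)[OF g] by auto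
    fix N assume N: "submodule N R (restrict_scalars \<phi> M) \<and> ?T \<subseteq> N"
    note D = r.submoduleD[OF conjunct1[OF N]]
    have ax: "a \<odot>\<^bsub>M\<^esub> x i \<in> N" if i: "i < n" and a: "a \<in> carrier \<Lambda>" for a i
    proof -
      have "lin_map \<Lambda> (regular_module \<Lambda>) M (\<lambda>b. b \<odot>\<^bsub>M\<^esub> x i)"
        by (rule lin_map_smult_elem[OF M lin_map_id generatesD(1)[OF g i]])
      then interpret l: lin R "restrict_scalars \<phi> (regular_module \<Lambda>)" "restrict_scalars \<phi> M" "\<lambda>b. b \<odot>\<^bsub>M\<^esub> x i"
        by (intro linI L.left_module_axioms r.left_module_axioms lin_map_restrict_scalars[OF assms(3)])
      have "{b \<in> carrier \<Lambda>. b \<odot>\<^bsub>M\<^esub> x i \<in> N} = carrier \<Lambda>"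
      proof (rule S(3))
        show "S \<subseteq> {b \<in> carrier \<Lambda>. b \<odot>\<^bsub>M\<^esub> x i \<in> N}" using N i S(2) by auto
      qed (use l.submodule_preimage[OF conjunct1[OF N]] in simp)
      then show ?thesis using a by auto
    qed
    have "carrier M \<subseteq> N"
    proof
      fix y assume "y \<in> carrier M"
      then obtain c where c: "c \<in> carrier (free_module \<Lambda> n)" "y = lincomb M n x c"
        using generatesD(2)[OF g] by blast
      have "finsum (restrict_scalars \<phi> M) (\<lambda>i. c i \<odot>\<^bsub>M\<^esub> x i) {..<n} = lincomb M n x c"
        by (simp add: fun_eq_iff finsum_def finprod_def restrict_scalars_def)
      then show "y \<in> N"
        using r.submodule_finsum[OF conjunct1[OF N], of "{..<n}" "\<lambda>i. c i \<odot>\<^bsub>M\<^esub> x i"]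
          ax free_carrierD[OF c(1)] c(2) by auto
    qed
    then show "N = carrier (restrict_scalars \<phi> M)" using D(1) by auto
  qed (rule r.left_module_axioms)
qed

lemma dual_module_simps:
  "carrier (dual_module R \<phi> E X) = lmod_hom R (restrict_scalars \<phi> X) E"
  "\<zero>\<^bsub>dual_module R \<phi> E X\<^esub> = (\<lambda>x\<in>carrier X. \<zero>\<^bsub>E\<^esub>)"
  "f \<oplus>\<^bsub>dual_module R \<phi> E X\<^esub> g = (\<lambda>x\<in>carrier X. f x \<oplus>\<^bsub>E\<^esub> g x)"
  "a \<odot>\<^bsub>dual_module R \<phi> E X\<^esub> f = (\<lambda>x\<in>carrier X. f (a \<odot>\<^bsub>X\<^esub> x))"
  by (simp_all add: dual_module_def)

lemma dual_module_left_module: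
  assumes "left_module S X" "left_module R E" "\<phi> \<in> ring_hom R S"
    and central: "\<And>r a. r \<in> carrier R \<Longrightarrow> a \<in> carrier S \<Longrightarrow> \<phi> r \<otimes>\<^bsub>S\<^esub> a = a \<otimes>\<^bsub>S\<^esub> \<phi> r"
  shows "left_module (opposite_ring S) (dual_module R \<phi> E X)"
proof -
  interpret X: left_module S X by fact
  interpret E: left_module R E by fact
  let ?X = "restrict_scalars \<phi> X"
  have rX: "left_module R ?X"
    by (rule restrict_scalars_left_module) (fact assms E.R.ring_axioms)+
  note h = ring_hom_memE(1)[OF assms(3)]
  have plus: "(\<lambda>x\<in>carrier X. f x \<oplus>\<^bsub>E\<^esub> g x) \<in> lmod_hom R ?X E"
    if "f \<in> lmod_hom R ?X E" "g \<in> lmod_hom R ?X E" for f g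
    using restrict_lmod_hom[OF rX lin_map_plus[OF assms(2) that[THEN lmod_hom_lin_map]]] by simp
  have neg: "(\<lambda>x\<in>carrier X. \<ominus>\<^bsub>E\<^esub> f x) \<in> lmod_hom R ?X E"
    if "f \<in> lmod_hom R ?X E" for f
    using restrict_lmod_hom[OF rX lin_map_neg[OF assms(2) that[THEN lmod_hom_lin_map]]] by simp
  have zero: "(\<lambda>x\<in>carrier X. \<zero>\<^bsub>E\<^esub>) \<in> lmod_hom R ?X E"
    using restrict_lmod_hom[OF rX lin_map_zero[OF assms(2)]] by simp
  \<comment> \<open>Multiplication by a is linear over R because \<phi> maps into the
    centre.\<close>
  have act: "lin_map R ?X ?X (\<lambda>x. a \<odot>\<^bsub>X\<^esub> x)" if "a \<in> carrier S" for a
    using that h by (intro lin_mapI) (auto simp: X.smult_r_distr central simp flip: X.smult_assoc)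
  have smult: "(\<lambda>x\<in>carrier X. f (a \<odot>\<^bsub>X\<^esub> x)) \<in> lmod_hom R ?X E"
    if "f \<in> lmod_hom R ?X E" "a \<in> carrier S" for f a
    using restrict_lmod_hom[OF rX lin_map_comp[OF act[OF that(2)] lmod_hom_lin_map[OF that(1)]]] by simp
  have "lmod_hom R ?X E \<subseteq> carrier X \<rightarrow>\<^sub>E carrier E"
    by (auto simp: lmod_hom_def)
  then have "abelian_group (dual_module R \<phi> E X)"
    by (intro pointwise_abelian_group[where N = E and A = "carrier X"])
      (simp_all add: dual_module_simps E.M.abelian_group_axioms plus neg zero)
  moreover have "left_module_axioms (opposite_ring S) (dual_module R \<phi> E X)"
  proof
    fix a f assume a: "a \<in> carrier (opposite_ring S)" and f: "f \<in> carrier (dual_module R \<phi> E X)"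
    then have lf: "lin_map R ?X E f" by (simp add: dual_module_simps lmod_hom_iff)
    show "a \<odot>\<^bsub>dual_module R \<phi> E X\<^esub> f \<in> carrier (dual_module R \<phi> E X)"
      using smult[of f a] a f by (simp add: dual_module_simps)
    fix b assume b: "b \<in> carrier (opposite_ring S)"
    show "(a \<oplus>\<^bsub>opposite_ring S\<^esub> b) \<odot>\<^bsub>dual_module R \<phi> E X\<^esub> f =
        a \<odot>\<^bsub>dual_module R \<phi> E X\<^esub> f \<oplus>\<^bsub>dual_module R \<phi> E X\<^esub> b \<odot>\<^bsub>dual_module R \<phi> E X\<^esub> f"
      "(a \<otimes>\<^bsub>opposite_ring S\<^esub> b) \<odot>\<^bsub>dual_module R \<phi> E X\<^esub> f =
        a \<odot>\<^bsub>dual_module R \<phi> E X\<^esub> (b \<odot>\<^bsub>dual_module R \<phi> E X\<^esub> f)"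
      using a b lin_map_add[OF lf]
      by (auto simp: dual_module_simps X.smult_l_distr X.smult_assoc)
    fix g assume g: "g \<in> carrier (dual_module R \<phi> E X)"
    show "a \<odot>\<^bsub>dual_module R \<phi> E X\<^esub> (f \<oplus>\<^bsub>dual_module R \<phi> E X\<^esub> g) =
        a \<odot>\<^bsub>dual_module R \<phi> E X\<^esub> f \<oplus>\<^bsub>dual_module R \<phi> E X\<^esub> a \<odot>\<^bsub>dual_module R \<phi> E X\<^esub> g"
      using a by (auto simp: dual_module_simps)
  next
    fix f assume f: "f \<in> carrier (dual_module R \<phi> E X)"
    then have "f \<in> extensional (carrier X)" by (simp add: dual_module_simps lmod_hom_iff)
    then show "\<one>\<^bsub>opposite_ring S\<^esub> \<odot>\<^bsub>dual_module R \<phi> E X\<^esub> f = f"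
      by (auto simp: dual_module_simps extensional_def fun_eq_iff X.smult_one)
  qed
  ultimately show ?thesis
    by (simp add: left_module_def opposite_ring_ring X.R.ring_axioms)
qed

lemma injective_extend:
  fixes X :: "('r, 'x) module"
  assumes E: "injective_module R E" and X: "fg_module R X" and A: "submodule A R X"
    and f: "lin_map R (X\<lparr>carrier := A\<rparr>) E f"
  obtains h where "lin_map R X E h" "\<And>a. a \<in> A \<Longrightarrow> h a = f a"
proof -
  have lX: "left_module R X" using X fg_module_iff by blast
  interpret X: left_module R X by (rule lX)
  note D = X.submoduleD[OF A]
  let ?A = "X\<lparr>carrier := A\<rparr>"
  have lA: "left_module R ?A" by (rule X.submodule_left_module[OF A])
  obtain C :: "('r, (nat \<Rightarrow> 'r) set) module" and \<theta>
    where C: "left_module R C" "lin_map R X C \<theta>" "bij_betw \<theta> (carrier X) (carrier C)"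
    using fg_module_copy[OF X] by metis
  have inj: "inj_on \<theta> (carrier X)" using C(3) by (simp add: bij_betw_def)
  then have "inj_on \<theta> (carrier ?A)" using D(1) by (auto intro: inj_on_subset)
  \<comment> \<open>The copy of A is made with the same \<theta> as the copy C of X. So B lies
    inside C, and the embedding to which injectivity is applied is the identity on B.\<close>
  then obtain B :: "('r, (nat \<Rightarrow> 'r) set) module"
    where B: "left_module R B" "lin_map R ?A B \<theta>" "bij_betw \<theta> (carrier ?A) (carrier B)"
      "lin_map R B ?A (the_inv_into (carrier ?A) \<theta>)"
    using transport_module[OF lA] by metis
  let ?j = "the_inv_into (carrier ?A) \<theta>"
  have jinv: "?j (\<theta> a) = a" "\<theta> a \<in> carrier B" if "a \<in> A" for a
    using that B(3) by (auto simp: bij_betw_def the_inv_into_f_f)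
  have jA: "?j b \<in> A" "\<theta> (?j b) = b" if "b \<in> carrier B" for b
    using that B(3) f_the_inv_into_f[of \<theta> A b] lin_map_closed[OF B(4) that]
    by (auto simp: bij_betw_def)
  have "lin_map R B C (\<lambda>b. \<theta> (?j b))"
    by (rule lin_map_comp[OF B(4) lin_map_subset[OF C(2) D(1)]])
  then have i: "restrict (\<lambda>b. b) (carrier B) \<in> lmod_hom R B C"
    using jA lin_map_cong[OF B(1), of C "\<lambda>b. \<theta> (?j b)" "\<lambda>b. b"] by (intro restrict_lmod_hom B) auto
  have g: "restrict (\<lambda>b. f (?j b)) (carrier B) \<in> lmod_hom R B E"
    by (intro restrict_lmod_hom B lin_map_comp[OF B(4) f])
  have "\<exists>h\<in>lmod_hom R C E. \<forall>x\<in>carrier B.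
    h (restrict (\<lambda>b. b) (carrier B) x) = restrict (\<lambda>b. f (?j b)) (carrier B) x"
    by (rule E[unfolded injective_module_def, THEN conjunct2, rule_format],
      intro conjI B(1) C(1) i g inj_onI) simp
  then obtain h where h: "h \<in> lmod_hom R C E" "\<And>b. b \<in> carrier B \<Longrightarrow> h b = f (?j b)" by auto
  show ?thesis
  proof (rule that[of "\<lambda>x. h (\<theta> x)"])
    show "lin_map R X E (\<lambda>x. h (\<theta> x))" by (rule lin_map_comp[OF C(2) lmod_hom_lin_map[OF h(1)]])
    show "h (\<theta> a) = f a" if "a \<in> A" for a using h(2) jinv[OF that] by simp
  qed
qed


section \<open>Chain conditions\<close>

text \<open>Well-foundedness provides minimal members and lexicographic products directly. The bound
  V allows the condition to be extended from a submodule by one generator at a time.\<close>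

definition dcc :: "'a ring \<Rightarrow> ('a, 'm) module \<Rightarrow> 'm set \<Rightarrow> bool" where
  "dcc \<Lambda> M V \<longleftrightarrow> wf {(A, B). submodule A \<Lambda> M \<and> submodule B \<Lambda> M \<and> A \<subset> B \<and> B \<subseteq> V}"

definition acc :: "'a ring \<Rightarrow> ('a, 'm) module \<Rightarrow> 'm set \<Rightarrow> bool" where
  "acc \<Lambda> M V \<longleftrightarrow> wf {(B, A). submodule A \<Lambda> M \<and> submodule B \<Lambda> M \<and> A \<subset> B \<and> B \<subseteq> V}"

lemma dcc_minimal:
  assumes "dcc \<Lambda> M V" "A \<in> X" "\<And>B. B \<in> X \<Longrightarrow> submodule B \<Lambda> M \<and> B \<subseteq> V"
  obtains B where "B \<in> X" "\<And>C. C \<in> X \<Longrightarrow> \<not> C \<subset> B"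
proof -
  from wfE_min[OF assms(1)[unfolded dcc_def] assms(2)] obtain B where B: "B \<in> X"
    "\<And>C. (C, B) \<in> {(A, B). submodule A \<Lambda> M \<and> submodule B \<Lambda> M \<and> A \<subset> B \<and> B \<subseteq> V} \<Longrightarrow> C \<notin> X"
    by blast
  then have "\<not> C \<subset> B" if "C \<in> X" for C using that assms(3) by blast
  with B(1) show ?thesis by (rule that)
qed

lemma acc_maximal:
  assumes "acc \<Lambda> M V" "A \<in> X" "\<And>B. B \<in> X \<Longrightarrow> submodule B \<Lambda> M \<and> B \<subseteq> V"
  obtains B where "B \<in> X" "\<And>C. C \<in> X \<Longrightarrow> \<not> B \<subset> C"
proof -
  from wfE_min[OF assms(1)[unfolded acc_def] assms(2)] obtain B where B: "B \<in> X"
    "\<And>C. (C, B) \<in> {(B, A). submodule A \<Lambda> M \<and> submodule B \<Lambda> M \<and> A \<subset> B \<and> B \<subseteq> V} \<Longrightarrow> C \<notin> X"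
    by blast
  then have "\<not> B \<subset> C" if "C \<in> X" for C using that assms(3) by blast
  with B(1) show ?thesis by (rule that)
qed

lemma wf_lex_measure:
  assumes "wf r" "wf s" "\<And>A B. (A, B) \<in> q \<Longrightarrow> (f A, f B) \<in> r \<or> f A = f B \<and> (g A, g B) \<in> s"
  shows "wf q"
  by (rule wf_subset[OF wf_inv_image[OF wf_lex_prod[OF assms(1,2)], of "\<lambda>A. (f A, g A)"]])
    (use assms(3) in \<open>auto simp: inv_image_def\<close>)

text \<open>Meant for f A the part of A in a region already understood and g A a record of the rest:
  a step that leaves f A unchanged must show up in g A.\<close>

lemma dcc_lex:
  assumes "dcc \<Lambda> N V" "wf s"
    and "\<And>A B. submodule A \<Lambda> M \<Longrightarrow> submodule B \<Lambda> M \<Longrightarrow> A \<subset> B \<Longrightarrow> B \<subseteq> W \<Longrightarrow>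
      submodule (f A) \<Lambda> N \<and> submodule (f B) \<Lambda> N \<and> f A \<subset> f B \<and> f B \<subseteq> V \<or> f A = f B \<and> (g A, g B) \<in> s"
  shows "dcc \<Lambda> M W"
  unfolding dcc_def
  by (rule wf_lex_measure[OF assms(1)[unfolded dcc_def] assms(2), of _ f g]) (use assms(3) in auto)

lemma acc_lex:
  assumes "acc \<Lambda> N V" "wf s"
    and "\<And>A B. submodule A \<Lambda> M \<Longrightarrow> submodule B \<Lambda> M \<Longrightarrow> A \<subset> B \<Longrightarrow> B \<subseteq> W \<Longrightarrow>
      submodule (f A) \<Lambda> N \<and> submodule (f B) \<Lambda> N \<and> f A \<subset> f B \<and> f B \<subseteq> V \<or> f A = f B \<and> (g B, g A) \<in> s"
  shows "acc \<Lambda> M W"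
  unfolding acc_def
proof (rule wf_lex_measure[OF assms(1)[unfolded acc_def] assms(2), of _ f g])
  fix B A assume "(B, A) \<in> {(B, A). submodule A \<Lambda> M \<and> submodule B \<Lambda> M \<and> A \<subset> B \<and> B \<subseteq> W}"
  then show "(f B, f A) \<in> {(B, A). submodule A \<Lambda> N \<and> submodule B \<Lambda> N \<and> A \<subset> B \<and> B \<subseteq> V} \<or>
      f B = f A \<and> (g B, g A) \<in> s"
    using assms(3)[of A B] by auto
qed

context left_module
begin

lemma add_diff:
  assumes "a \<in> carrier M" "b \<in> carrier M"
  shows "a \<oplus>\<^bsub>M\<^esub> (b \<ominus>\<^bsub>M\<^esub> a) = b" "(a \<oplus>\<^bsub>M\<^esub> b) \<ominus>\<^bsub>M\<^esub> a = b"
  using assms by (simp_all add: a_minus_def M.a_comm[of _ "\<ominus>\<^bsub>M\<^esub> a"] M.r_neg1 M.r_neg2)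

lemma modular_law:
  assumes "submodule A R M" "submodule B R M" "submodule N R M"
    "A \<subseteq> B" "A \<inter> N = B \<inter> N" "B \<subseteq> A <+>\<^bsub>M\<^esub> N"
  shows "A = B"
proof -
  note A = submoduleD[OF assms(1)] and B = submoduleD[OF assms(2)] and N = submoduleD[OF assms(3)]
  have "b \<in> A" if "b \<in> B" for b
  proof -
    have "b \<in> A <+>\<^bsub>M\<^esub> N" using that assms(6) by blast
    then obtain a n where an: "a \<in> A" "n \<in> N" "b = a \<oplus>\<^bsub>M\<^esub> n" by (auto simp: set_add_def')
    then have "n = b \<ominus>\<^bsub>M\<^esub> a" using A(1) N(1) by (auto simp: subset_iff add_diff)
    then have "n \<in> B \<inter> N" using B(6)[OF that, of a] an assms(4) by auto
    then have "n \<in> A" using assms(5) by blast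
    then show ?thesis using an A(3) by simp
  qed
  then show ?thesis using assms(4) by blast
qed

text \<open>If the left ideal of the r with r x in A + N did not grow from A to B, then B would lie
  in A + N, because modulo N its elements are multiples of x; the modular law would give A =
  B.\<close>

lemma chain_step:
  assumes "submodule A R M" "submodule B R M" "submodule N R M" "x \<in> carrier M"
    and "A \<subset> B" "B \<subseteq> N <+>\<^bsub>M\<^esub> ((\<lambda>r. r \<odot>\<^bsub>M\<^esub> x) ` carrier R)" "A \<inter> N = B \<inter> N"
  shows "{r \<in> carrier R. r \<odot>\<^bsub>M\<^esub> x \<in> A <+>\<^bsub>M\<^esub> N} \<subset> {r \<in> carrier R. r \<odot>\<^bsub>M\<^esub> x \<in> B <+>\<^bsub>M\<^esub> N}"
proof
  note A = submoduleD[OF assms(1)] and B = submoduleD[OF assms(2)] and N = submoduleD[OF assms(3)]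
  note AN = submoduleD[OF submodule_set_add[OF assms(1,3)]]
  show "{r \<in> carrier R. r \<odot>\<^bsub>M\<^esub> x \<in> A <+>\<^bsub>M\<^esub> N} \<subseteq> {r \<in> carrier R. r \<odot>\<^bsub>M\<^esub> x \<in> B <+>\<^bsub>M\<^esub> N}"
    using assms(5) unfolding set_add_def' by blast
  show "{r \<in> carrier R. r \<odot>\<^bsub>M\<^esub> x \<in> A <+>\<^bsub>M\<^esub> N} \<noteq> {r \<in> carrier R. r \<odot>\<^bsub>M\<^esub> x \<in> B <+>\<^bsub>M\<^esub> N}"
  proof
    assume eq: "{r \<in> carrier R. r \<odot>\<^bsub>M\<^esub> x \<in> A <+>\<^bsub>M\<^esub> N} = {r \<in> carrier R. r \<odot>\<^bsub>M\<^esub> x \<in> B <+>\<^bsub>M\<^esub> N}"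
    have "B \<subseteq> A <+>\<^bsub>M\<^esub> N"
    proof
      fix b assume b: "b \<in> B"
      then obtain n r where nr: "n \<in> N" "r \<in> carrier R" "b = n \<oplus>\<^bsub>M\<^esub> r \<odot>\<^bsub>M\<^esub> x"
        using assms(6) unfolding set_add_def' by blast
      then have "r \<odot>\<^bsub>M\<^esub> x = b \<oplus>\<^bsub>M\<^esub> \<ominus>\<^bsub>M\<^esub> n"
        using N(1) assms(4) by (auto simp: subset_iff M.a_ac M.r_neg1 M.r_neg2)
      then have "r \<odot>\<^bsub>M\<^esub> x \<in> B <+>\<^bsub>M\<^esub> N" using set_addI[OF b N(5)[OF nr(1)]] by simp
      then have "r \<odot>\<^bsub>M\<^esub> x \<in> A <+>\<^bsub>M\<^esub> N" using eq nr(2) by blast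
      moreover have "n \<in> A <+>\<^bsub>M\<^esub> N" using set_add_upper[OF assms(1,3)] nr(1) by blast
      ultimately show "b \<in> A <+>\<^bsub>M\<^esub> N" using nr(3) AN(3) by simp
    qed
    then show False using modular_law[OF assms(1-3) _ assms(7)] assms(5) by blast
  qed
qed

lemma submodule_colon:
  assumes "submodule A R M" "x \<in> carrier M"
  shows "submodule {r \<in> carrier R. r \<odot>\<^bsub>M\<^esub> x \<in> A} R (regular_module R)"
proof -
  interpret l: lin R "regular_module R" M "\<lambda>r. r \<odot>\<^bsub>M\<^esub> x"
    by (intro linI regular_left_module R.ring_axioms left_module_axioms lin_map_smult_elem lin_map_id assms)
  show ?thesis using l.submodule_preimage[OF assms(1)] by simp
qed

text \<open>Lexicographic in the intersection with N, where the condition is assumed, and the left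
  ideal of \<open>chain_step\<close>, where the condition for the ring applies.\<close>

lemma dcc_extend:
  assumes "dcc R (regular_module R) (carrier R)" "dcc R M N" "submodule N R M" "x \<in> carrier M"
  shows "dcc R M (N <+>\<^bsub>M\<^esub> ((\<lambda>r. r \<odot>\<^bsub>M\<^esub> x) ` carrier R))"
proof (rule dcc_lex[OF assms(2) assms(1)[unfolded dcc_def], of _ _ "\<lambda>A. A \<inter> N"
      "\<lambda>A. {r \<in> carrier R. r \<odot>\<^bsub>M\<^esub> x \<in> A <+>\<^bsub>M\<^esub> N}"], rule disj_imp[THEN iffD2], rule impI)
  fix A B assume *: "submodule A R M" "submodule B R M" "A \<subset> B"
    "B \<subseteq> N <+>\<^bsub>M\<^esub> ((\<lambda>r. r \<odot>\<^bsub>M\<^esub> x) ` carrier R)"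
    and "\<not> (submodule (A \<inter> N) R M \<and> submodule (B \<inter> N) R M \<and> A \<inter> N \<subset> B \<inter> N \<and> B \<inter> N \<subseteq> N)"
  then have "A \<inter> N = B \<inter> N" using submodule_Int assms(3) by blast
  then show "A \<inter> N = B \<inter> N \<and> ({r \<in> carrier R. r \<odot>\<^bsub>M\<^esub> x \<in> A <+>\<^bsub>M\<^esub> N},
      {r \<in> carrier R. r \<odot>\<^bsub>M\<^esub> x \<in> B <+>\<^bsub>M\<^esub> N}) \<in> {(A, B).
        submodule A R (regular_module R) \<and> submodule B R (regular_module R) \<and> A \<subset> B \<and> B \<subseteq> carrier R}"
    using chain_step[OF *(1,2) assms(3,4) *(3,4)]
      submodule_colon[OF submodule_set_add[OF *(1) assms(3)] assms(4)]
      submodule_colon[OF submodule_set_add[OF *(2) assms(3)] assms(4)] by auto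
qed

lemma acc_extend:
  assumes "acc R (regular_module R) (carrier R)" "acc R M N" "submodule N R M" "x \<in> carrier M"
  shows "acc R M (N <+>\<^bsub>M\<^esub> ((\<lambda>r. r \<odot>\<^bsub>M\<^esub> x) ` carrier R))"
proof (rule acc_lex[OF assms(2) assms(1)[unfolded acc_def], of _ _ "\<lambda>A. A \<inter> N"
      "\<lambda>A. {r \<in> carrier R. r \<odot>\<^bsub>M\<^esub> x \<in> A <+>\<^bsub>M\<^esub> N}"], rule disj_imp[THEN iffD2], rule impI)
  fix A B assume *: "submodule A R M" "submodule B R M" "A \<subset> B"
    "B \<subseteq> N <+>\<^bsub>M\<^esub> ((\<lambda>r. r \<odot>\<^bsub>M\<^esub> x) ` carrier R)"
    and "\<not> (submodule (A \<inter> N) R M \<and> submodule (B \<inter> N) R M \<and> A \<inter> N \<subset> B \<inter> N \<and> B \<inter> N \<subseteq> N)"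
  then have "A \<inter> N = B \<inter> N" using submodule_Int assms(3) by blast
  then show "A \<inter> N = B \<inter> N \<and> ({r \<in> carrier R. r \<odot>\<^bsub>M\<^esub> x \<in> B <+>\<^bsub>M\<^esub> N},
      {r \<in> carrier R. r \<odot>\<^bsub>M\<^esub> x \<in> A <+>\<^bsub>M\<^esub> N}) \<in> {(B, A).
        submodule A R (regular_module R) \<and> submodule B R (regular_module R) \<and> A \<subset> B \<and> B \<subseteq> carrier R}"
    using chain_step[OF *(1,2) assms(3,4) *(3,4)]
      submodule_colon[OF submodule_set_add[OF *(1) assms(3)] assms(4)]
      submodule_colon[OF submodule_set_add[OF *(2) assms(3)] assms(4)] by auto
qed

lemma no_chain_zero: "submodule A R M \<Longrightarrow> submodule B R M \<Longrightarrow> A \<subset> B \<Longrightarrow> \<not> B \<subseteq> {\<zero>\<^bsub>M\<^esub>}"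
  using submoduleD(2)[of A] by blast

lemma dcc_zero: "dcc R M {\<zero>\<^bsub>M\<^esub>}" and acc_zero: "acc R M {\<zero>\<^bsub>M\<^esub>}"
proof -
  have "{(A, B). submodule A R M \<and> submodule B R M \<and> A \<subset> B \<and> B \<subseteq> {\<zero>\<^bsub>M\<^esub>}} = {}"
    "{(B, A). submodule A R M \<and> submodule B R M \<and> A \<subset> B \<and> B \<subseteq> {\<zero>\<^bsub>M\<^esub>}} = {}"
    using no_chain_zero by blast+
  then show "dcc R M {\<zero>\<^bsub>M\<^esub>}" "acc R M {\<zero>\<^bsub>M\<^esub>}"
    unfolding dcc_def acc_def by (simp_all only: wf_on_bot wf_def)
qed

lemma fg_chain_conditions:
  assumes "dcc R (regular_module R) (carrier R)" "acc R (regular_module R) (carrier R)"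
    and "fg_module R M"
  shows "dcc R M (carrier M)" "acc R M (carrier M)"
proof -
  obtain S where S: "finite S" "S \<subseteq> carrier M"
    "\<And>N. submodule N R M \<Longrightarrow> S \<subseteq> N \<Longrightarrow> N = carrier M"
    using assms(3) unfolding fg_module_def by (elim conjE exE) simp
  have "\<exists>V. submodule V R M \<and> S \<subseteq> V \<and> dcc R M V \<and> acc R M V"
    using S(1,2)
  proof (induct set: finite)
    case empty
    then show ?case using submodule_zero dcc_zero acc_zero by blast
  next
    case (insert x S)
    then obtain V where V: "submodule V R M" "S \<subseteq> V" "dcc R M V" "acc R M V" by auto
    have x: "x \<in> carrier M" using insert by simp
    let ?C = "(\<lambda>r. r \<odot>\<^bsub>M\<^esub> x) ` carrier R"
    have "x \<in> ?C" using x smult_one[OF x] by (metis R.one_closed image_eqI)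
    then have "insert x S \<subseteq> V <+>\<^bsub>M\<^esub> ?C"
      using set_add_upper[OF V(1) submodule_cyclic[OF x]] V(2) by blast
    then show ?case
      using submodule_set_add[OF V(1) submodule_cyclic[OF x]]
        dcc_extend[OF assms(1) V(3,1) x] acc_extend[OF assms(2) V(4,1) x] by blast
  qed
  then show "dcc R M (carrier M)" "acc R M (carrier M)" using S(3) by metis+
qed

text \<open>A maximal finitely generated submodule inside H is all of H, since one more element of H
  could be added to its generators.\<close>

lemma submodule_fg:
  assumes "acc R M (carrier M)" "submodule H R M"
  shows "fg_module R (M\<lparr>carrier := H\<rparr>)"
proof -
  let ?X = "{V. submodule V R M \<and> V \<subseteq> H \<and> fg_module R (M\<lparr>carrier := V\<rparr>)}"
  note H = submoduleD[OF assms(2)]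
  have zero: "{\<zero>\<^bsub>M\<^esub>} \<in> ?X"
  proof -
    interpret Z: left_module R "M\<lparr>carrier := {\<zero>\<^bsub>M\<^esub>}\<rparr>" by (rule submodule_left_module[OF submodule_zero])
    have "fg_module R (M\<lparr>carrier := {\<zero>\<^bsub>M\<^esub>}\<rparr>)"
      unfolding fg_module_def
      by (intro conjI exI[of _ "{}"] allI impI) (use Z.left_module_axioms Z.submoduleD(1,2) in auto)
    then show ?thesis using submodule_zero H(2) by simp
  qed
  obtain W where W: "W \<in> ?X" "\<And>C. C \<in> ?X \<Longrightarrow> \<not> W \<subset> C"
    using acc_maximal[OF assms(1) zero] submoduleD(1) by (metis (no_types, lifting) mem_Collect_eq)
  have Ws: "submodule W R M" "W \<subseteq> H" using W(1) by auto
  have "W = H"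
  proof (rule ccontr)
    assume "W \<noteq> H"
    then obtain x where x: "x \<in> H" "x \<notin> W" using Ws(2) by blast
    then have xc: "x \<in> carrier M" using H(1) by auto
    let ?C = "(\<lambda>r. r \<odot>\<^bsub>M\<^esub> x) ` carrier R"
    let ?V = "W <+>\<^bsub>M\<^esub> ?C"
    have V: "submodule ?V R M" by (intro submodule_set_add Ws submodule_cyclic xc)
    have xC: "x \<in> ?C" using smult_one[OF xc] by (metis R.one_closed image_eqI)
    note up = set_add_upper[OF Ws(1) submodule_cyclic[OF xc]]
    have "?V \<subseteq> H" unfolding set_add_def' using Ws(2) H(3) H(4) x(1) by auto
    moreover have "fg_module R (M\<lparr>carrier := ?V\<rparr>)"
    proof -
      obtain S where S: "finite S" "S \<subseteq> W"
        "\<And>N. submodule N R (M\<lparr>carrier := W\<rparr>) \<Longrightarrow> S \<subseteq> N \<Longrightarrow> N = W"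
        using W(1) unfolding fg_module_def by (elim CollectE conjE exE) simp
      show ?thesis
        unfolding fg_module_def
      proof (intro conjI exI[of _ "insert x S"] allI impI)
        show "left_module R (M\<lparr>carrier := ?V\<rparr>)" by (rule submodule_left_module[OF V])
        show "insert x S \<subseteq> carrier (M\<lparr>carrier := ?V\<rparr>)" using up S(2) xC by auto
        fix N assume N: "submodule N R (M\<lparr>carrier := ?V\<rparr>) \<and> insert x S \<subseteq> N"
        then have N': "submodule N R M" "N \<subseteq> ?V" using submodule_restrict_iff[OF V] by blast+
        note D = submoduleD[OF N'(1)]
        have "W \<inter> N = W"
          by (rule S(3)) (use submodule_Int[OF Ws(1) N'(1)] submodule_restrict_iff[OF Ws(1)] S(2) N in auto)
        then have "W \<subseteq> N" by blast
        then have "?V \<subseteq> N" unfolding set_add_def' using D(3) D(4) N by auto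
        then show "N = carrier (M\<lparr>carrier := ?V\<rparr>)" using N'(2) by auto
      qed (use S(1) in simp)
    qed
    ultimately have "?V \<in> ?X" using V by simp
    moreover have "W \<subset> ?V" using up xC x(2) by blast
    ultimately show False using W(2) by blast
  qed
  then show ?thesis using W(1) by simp
qed

end

text \<open>Submodules over \<Lambda> are submodules over R, so chains over \<Lambda> are chains
  over R.\<close>

lemma chain_conditions_restrict_scalars:
  fixes R :: "'r ring"
  assumes "left_module \<Lambda> M" "ring R" "\<phi> \<in> ring_hom R \<Lambda>"
  shows "dcc R (restrict_scalars \<phi> M) V \<Longrightarrow> dcc \<Lambda> M V"
    and "acc R (restrict_scalars \<phi> M) V \<Longrightarrow> acc \<Lambda> M V"
  unfolding dcc_def acc_def
  by (erule wf_subset; use submodule_restrict_scalars[OF assms] in blast)+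

lemma lin_image_chain:
  assumes "lin \<Lambda> M N f" "submodule A \<Lambda> M" "submodule B \<Lambda> M" "A \<subset> B"
    "A \<inter> a_kernel M N f = B \<inter> a_kernel M N f"
  shows "f ` A \<subset> f ` B"
proof -
  interpret lin \<Lambda> M N f by fact
  note A = M.submoduleD[OF assms(2)] and B = M.submoduleD[OF assms(3)]
  obtain b where b: "b \<in> B" "b \<notin> A" using assms(4) by blast
  have "f b \<notin> f ` A"
  proof
    assume "f b \<in> f ` A"
    then obtain a where a: "a \<in> A" "f b = f a" by blast
    have ba: "a \<in> carrier M" "b \<in> carrier M" using A(1) B(1) a b by auto
    then have "b \<ominus>\<^bsub>M\<^esub> a \<in> B \<inter> a_kernel M N f"
      using a b assms(4) B(6) by (auto simp: a_kernel_iff minus) (simp add: a_minus_def N.M.r_neg)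
    then have "b \<ominus>\<^bsub>M\<^esub> a \<in> A" using assms(5) by blast
    then have "a \<oplus>\<^bsub>M\<^esub> (b \<ominus>\<^bsub>M\<^esub> a) \<in> A" using A(3) a(1) by blast
    then show False using ba b(2) by (simp add: M.add_diff)
  qed
  then show ?thesis using assms(4) b by blast
qed

text \<open>A strict step that is invisible in the kernel is visible in the image by
  \<open>lin_image_chain\<close>, so kernel and image together measure chains
  lexicographically.\<close>

lemma acc_lin_image:
  assumes "lin \<Lambda> M N f" "submodule I \<Lambda> M" "acc \<Lambda> M (I \<inter> a_kernel M N f)" "acc \<Lambda> N (f ` I)"
  shows "acc \<Lambda> M I"
proof -
  interpret lin \<Lambda> M N f by fact
  show ?thesis
  proof (rule acc_lex[OF assms(3) assms(4)[unfolded acc_def], of _ _ "\<lambda>A. A \<inter> a_kernel M N f" "\<lambda>A. f ` A"], rule disj_imp[THEN iffD2], rule impI)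
    fix A B assume *: "submodule A \<Lambda> M" "submodule B \<Lambda> M" "A \<subset> B" "B \<subseteq> I"
      and "\<not> (submodule (A \<inter> a_kernel M N f) \<Lambda> M \<and> submodule (B \<inter> a_kernel M N f) \<Lambda> M \<and>
        A \<inter> a_kernel M N f \<subset> B \<inter> a_kernel M N f \<and> B \<inter> a_kernel M N f \<subseteq> I \<inter> a_kernel M N f)"
    then have "A \<inter> a_kernel M N f = B \<inter> a_kernel M N f"
      using M.submodule_Int submodule_kernel by blast
    then show "A \<inter> a_kernel M N f = B \<inter> a_kernel M N f \<and> (f ` B, f ` A) \<in>
        {(B, A). submodule A \<Lambda> N \<and> submodule B \<Lambda> N \<and> A \<subset> B \<and> B \<subseteq> f ` I}"
      using lin_image_chain[OF assms(1) *(1,2,3)] submodule_image[OF *(1)] submodule_image[OF *(2)] *(4) by auto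
  qed
qed


section \<open>Commutative artinian rings are noetherian\<close>

lemma ideal_iff_submodule:
  fixes R :: "'r ring" (structure)
  assumes "cring R" shows "ideal I R \<longleftrightarrow> submodule I R (regular_module R)"
proof -
  interpret cring R by fact
  interpret X: left_module R "regular_module R" by (rule regular_left_module) (rule ring_axioms)
  show ?thesis
  proof
    assume "ideal I R"
    then interpret ideal I R .
    show "submodule I R (regular_module R)"
      by (rule X.submoduleI) (auto intro: a_subset[THEN subsetD] I_l_closed)
  next
    assume "submodule I R (regular_module R)"
    note D = X.submoduleD[OF this]
    show "ideal I R"
    proof (rule idealI)
      show "ring R" by (rule ring_axioms)
      show "subgroup I (add_monoid R)"
        using \<open>submodule I R (regular_module R)\<close>
        unfolding submodule_def subgroup_def by (simp add: regular_module_def m_inv_def)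
      fix a x assume ax: "a \<in> I" "x \<in> carrier R"
      show "x \<otimes> a \<in> I" using D(4)[of x a] ax by simp
      then show "a \<otimes> x \<in> I" using m_comm[of x a] D(1) ax by auto
    qed
  qed
qed

lemma artinian_dcc:
  fixes R :: "'r ring" (structure)
  assumes "artinian_cring R" shows "dcc R (regular_module R) (carrier R)"
proof -
  interpret cring R using assms by (simp add: artinian_cring_def)
  show ?thesis
    unfolding dcc_def wf_iff_no_infinite_down_chain
  proof
    assume "\<exists>I. \<forall>i. (I (Suc i), I i) \<in> {(A, B). submodule A R (regular_module R) \<and>
      submodule B R (regular_module R) \<and> A \<subset> B \<and> B \<subseteq> carrier R}"
    then obtain I where "\<forall>i. (I (Suc i), I i) \<in> {(A, B). submodule A R (regular_module R) \<and>
      submodule B R (regular_module R) \<and> A \<subset> B \<and> B \<subseteq> carrier R}" by blast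
    then have "\<And>i. ideal (I i) R" "\<And>i. I (Suc i) \<subset> I i"
      using ideal_iff_submodule[OF is_cring] by simp_all
    moreover from this assms have "\<exists>n. \<forall>m\<ge>n. I m = I n"
      unfolding artinian_cring_def by (elim conjE allE[of _ I]) blast
    ultimately show False by (metis le_Suc_eq order_refl psubsetE)
  qed
qed

text \<open>
  A minimal ideal \<open>I\<close> among those violating the ascending chain condition is, for every scalar
  \<open>r\<close>, either killed by \<open>r\<close> or mapped bijectively onto itself; so \<open>I\<close> is a vector space over a
  field, all of whose proper subspaces satisfy the chain condition.
\<close>

lemma dcc_imp_acc:
  fixes R :: "'r ring" (structure)
  assumes "cring R" "dcc R (regular_module R) (carrier R)"
  shows "acc R (regular_module R) (carrier R)"
proof (rule ccontr)
  interpret cring R by fact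
  let ?X = "regular_module R"
  have X: "left_module R ?X" by (rule regular_left_module) (rule ring_axioms)
  interpret X: left_module R ?X by (rule X)
  assume "\<not> acc R ?X (carrier R)"
  then have "carrier R \<in> {I. submodule I R ?X \<and> \<not> acc R ?X I}"
    using X.submodule_carrier by simp
  then obtain I where "I \<in> {I. submodule I R ?X \<and> \<not> acc R ?X I}"
    "\<And>J. J \<in> {I. submodule I R ?X \<and> \<not> acc R ?X I} \<Longrightarrow> \<not> J \<subset> I"
    using dcc_minimal[OF assms(2)] X.submoduleD(1) by (metis (no_types, lifting) mem_Collect_eq regular_module_simps(1))
  then have I: "submodule I R ?X" "\<not> acc R ?X I"
    and sub: "\<And>J. submodule J R ?X \<Longrightarrow> J \<subset> I \<Longrightarrow> acc R ?X J" by auto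
  note D = X.submoduleD[OF I(1), simplified]
  have mult: "lin R ?X ?X (\<lambda>x. r \<otimes> x)" if "r \<in> carrier R" for r
    using that by (intro linI X lin_mapI) (auto simp: r_distr m_lcomm)
  \<comment> \<open>The source of the field structure: a scalar that does not kill I has an inverse
    on I that is again a scalar.\<close>
  have inverse: "\<exists>s\<in>carrier R. \<forall>y\<in>I. s \<otimes> (r \<otimes> y) = y"
    if r: "r \<in> carrier R" and y0: "y0 \<in> I" "r \<otimes> y0 \<noteq> \<zero>" for r y0
  proof -
    interpret l: lin R ?X ?X "\<lambda>x. r \<otimes> x" by (rule mult[OF r])
    \<comment> \<open>Otherwise r I and the part of I killed by r are both proper in I, hence
      satisfy the ascending condition by minimality, and then so does I.\<close>
    have rI: "(\<lambda>x. r \<otimes> x) ` I = I"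
    proof (rule ccontr)
      assume "(\<lambda>x. r \<otimes> x) ` I \<noteq> I"
      then have "(\<lambda>x. r \<otimes> x) ` I \<subset> I" using D(4) r by blast
      then have 1: "acc R ?X ((\<lambda>x. r \<otimes> x) ` I)" using sub l.submodule_image[OF I(1)] by blast
      have "y0 \<notin> a_kernel ?X ?X (\<lambda>x. r \<otimes> x)" using y0 by (simp add: l.a_kernel_iff)
      then have "I \<inter> a_kernel ?X ?X (\<lambda>x. r \<otimes> x) \<subset> I" using y0(1) by blast
      then have "acc R ?X (I \<inter> a_kernel ?X ?X (\<lambda>x. r \<otimes> x))"
        using sub X.submodule_Int[OF I(1) l.submodule_kernel] by blast
      then show False using acc_lin_image[OF l.lin_axioms I(1) _ 1] I(2) by blast
    qed
    \<comment> \<open>The chain of the ideals r^n R becomes stationary, so r^n = r^(n+1) s for some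
      s. As r^n I = I, every y in I has the form r^n z, and s r y = r^(n+1) s z = y.\<close>
    define P where "P n = (\<lambda>a. r [^] n \<otimes> a) ` carrier R" for n :: nat
    have P: "submodule (P n) R ?X" for n
      using lin.submodule_range[OF mult[of "r [^] n"]] r by (simp add: P_def)
    have PX: "submodule B R ?X \<and> B \<subseteq> carrier R" if "B \<in> range P" for B
      using that P X.submoduleD(1)[OF P] by (elim rangeE) simp
    obtain B where B: "B \<in> range P" "\<And>C. C \<in> range P \<Longrightarrow> \<not> C \<subset> B"
      by (rule dcc_minimal[OF assms(2) rangeI[of P 0] PX]) (assumption, rule that)
    from B(1) obtain n where "B = P n" by (rule rangeE)
    then have n: "\<not> P (Suc n) \<subset> P n" using B(2)[OF rangeI[of P "Suc n"]] by simp
    have "P (Suc n) \<subseteq> P n"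
    proof
      fix x assume "x \<in> P (Suc n)"
      then obtain a where "a \<in> carrier R" "x = r [^] Suc n \<otimes> a" by (auto simp: P_def)
      then have "x = r [^] n \<otimes> (r \<otimes> a)" "r \<otimes> a \<in> carrier R" using r by (auto simp: m_assoc)
      then show "x \<in> P n" by (auto simp: P_def)
    qed
    moreover have "r [^] n \<in> P n" using r by (auto simp: P_def intro!: image_eqI[of _ _ \<one>])
    ultimately have "r [^] n \<in> P (Suc n)" using n by blast
    then obtain s where s: "s \<in> carrier R" "r [^] n = r [^] Suc n \<otimes> s" by (auto simp: P_def)
    have pow: "\<exists>z\<in>I. y = r [^] k \<otimes> z" if "y \<in> I" for k :: nat and y
      using that
    proof (induct k arbitrary: y)
      case 0
      then show ?case using D(1) by (intro bexI[of _ y]) auto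
    next
      case (Suc k)
      then obtain z where z: "z \<in> I" "y = r [^] k \<otimes> z" by blast
      then obtain z' where "z' \<in> I" "z = r \<otimes> z'" using rI by blast
      then show ?case using z D(1) r by (auto simp: m_assoc intro!: bexI[of _ z'])
    qed
    have "s \<otimes> (r \<otimes> y) = y" if y: "y \<in> I" for y
    proof -
      obtain z where z: "z \<in> I" "y = r [^] n \<otimes> z" using pow[OF y] by blast
      then have c: "z \<in> carrier R" "r [^] n \<in> carrier R" using D(1) r by auto
      have "s \<otimes> (r \<otimes> y) = (r [^] Suc n \<otimes> s) \<otimes> z"
        unfolding z(2) nat_pow_Suc using c r s(1) by (simp add: m_ac)
      also have "\<dots> = y" unfolding s(2)[symmetric] by (rule z(2)[symmetric])
      finally show ?thesis .
    qed
    then show ?thesis using s(1) by blast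
  qed
  have "I \<noteq> {\<zero>}" using I(2) X.acc_zero by auto
  then obtain x where x: "x \<in> I" "x \<noteq> \<zero>" using D(2) by blast
  have xR: "x \<in> carrier R" using x D(1) by blast
  let ?Z = "{C. submodule C R ?X \<and> C \<subseteq> I \<and> x \<notin> C}"
  have "\<exists>C\<in>?Z. \<forall>B\<in>?Z. C \<subseteq> B \<longrightarrow> B = C"
  proof (rule subset_Zorn_nonempty)
    show "?Z \<noteq> {}" using X.submodule_zero D(2) x(2) by auto
    fix \<C> assume C: "\<C> \<noteq> {}" "subset.chain ?Z \<C>"
    then have c: "\<C> \<subseteq> ?Z" "\<And>A B. A \<in> \<C> \<Longrightarrow> B \<in> \<C> \<Longrightarrow> A \<subseteq> B \<or> B \<subseteq> A"
      by (auto simp: subset_chain_def)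
    have "submodule (\<Union>\<C>) R ?X"
    proof (rule X.submoduleI)
      show "\<Union>\<C> \<subseteq> carrier ?X" using c(1) D(1) by auto
      from C(1) obtain A0 where "A0 \<in> \<C>" by blast
      moreover from this have "submodule A0 R ?X" using c(1) by blast
      ultimately show "\<zero>\<^bsub>?X\<^esub> \<in> \<Union>\<C>" using X.submoduleD(2) by blast
    next
      fix a u assume a: "a \<in> carrier R" and "u \<in> \<Union>\<C>"
      then obtain A where A: "u \<in> A" "A \<in> \<C>" by blast
      then have "submodule A R ?X" using c(1) by blast
      from X.submoduleD(4)[OF this a A(1)] A(2) show "a \<odot>\<^bsub>?X\<^esub> u \<in> \<Union>\<C>" by blast
    next
      fix u v assume "u \<in> \<Union>\<C>" "v \<in> \<Union>\<C>"
      then obtain A B where AB: "u \<in> A" "v \<in> B" "A \<in> \<C>" "B \<in> \<C>" by blast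
      from c(2)[OF AB(3,4)] obtain D where D: "u \<in> D" "v \<in> D" "D \<in> \<C>"
        using AB by blast
      then have "submodule D R ?X" using c(1) by blast
      from X.submoduleD(3)[OF this D(1,2)] D(3) show "u \<oplus>\<^bsub>?X\<^esub> v \<in> \<Union>\<C>" by blast
    qed
    then show "\<Union>\<C> \<in> ?Z" using c(1) by blast
  qed
  then obtain C where "C \<in> ?Z" and C_max: "\<forall>B\<in>?Z. C \<subseteq> B \<longrightarrow> B = C" by (rule bexE)
  then have C: "submodule C R ?X" "C \<subseteq> I" "x \<notin> C" by simp_all
  have max: "x \<in> B" if "submodule B R ?X" "B \<subseteq> I" "C \<subset> B" for B
    using bspec[OF C_max, of B] that by auto
  note DC = X.submoduleD[OF C(1), simplified]
  have accC: "acc R ?X C" using sub C x(1) by blast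
  have sum_I: "A <+>\<^bsub>?X\<^esub> B \<subseteq> I" if "A \<subseteq> I" "B \<subseteq> I" for A B
    using that D(3) by (auto simp: set_add_def')
  \<comment> \<open>For y outside C, maximality gives x = c + r y with r y nonzero, and the inverse
    of r on I solves this equation for y.\<close>
  have span: "I \<subseteq> C <+>\<^bsub>?X\<^esub> ((\<lambda>r. r \<odot>\<^bsub>?X\<^esub> x) ` carrier R)"
  proof
    have cx: "submodule ((\<lambda>r. r \<odot>\<^bsub>?X\<^esub> x) ` carrier R) R ?X" by (rule X.submodule_cyclic) (simp add: xR)
    fix y assume y: "y \<in> I"
    then have yR: "y \<in> carrier R" using D(1) by blast
    show "y \<in> C <+>\<^bsub>?X\<^esub> ((\<lambda>r. r \<odot>\<^bsub>?X\<^esub> x) ` carrier R)"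
    proof (cases "y \<in> C")
      case True
      then show ?thesis using X.set_add_upper(1)[OF C(1) cx] by blast
    next
      case False
      have cy: "submodule ((\<lambda>r. r \<odot>\<^bsub>?X\<^esub> y) ` carrier R) R ?X" by (rule X.submodule_cyclic) (simp add: yR)
      have "y \<in> (\<lambda>r. r \<odot>\<^bsub>?X\<^esub> y) ` carrier R" using yR by (auto intro!: image_eqI[of _ _ \<one>])
      then have "C \<subset> C <+>\<^bsub>?X\<^esub> ((\<lambda>r. r \<odot>\<^bsub>?X\<^esub> y) ` carrier R)"
        using X.set_add_upper[OF C(1) cy] False by blast
      moreover have "(\<lambda>r. r \<odot>\<^bsub>?X\<^esub> y) ` carrier R \<subseteq> I" using D(4) y by auto
      ultimately have "x \<in> C <+>\<^bsub>?X\<^esub> ((\<lambda>r. r \<odot>\<^bsub>?X\<^esub> y) ` carrier R)"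
        using max X.submodule_set_add[OF C(1) cy] sum_I[OF C(2)] by blast
      then obtain c r where cr: "c \<in> C" "r \<in> carrier R" "x = c \<oplus> r \<otimes> y" by (auto simp: set_add_def')
      have cR: "c \<in> carrier R" using DC(1) cr(1) by blast
      have "r \<otimes> y \<noteq> \<zero>" using cr C(3) cR by auto
      then obtain s where s: "s \<in> carrier R" "s \<otimes> (r \<otimes> y) = y" using inverse[OF cr(2) y] y by blast
      have "s \<otimes> x = s \<otimes> c \<oplus> y" using s cr cR yR by (simp add: r_distr)
      then have "y = \<ominus> (s \<otimes> c) \<oplus> s \<otimes> x" using s(1) cR yR by (simp add: r_neg1)
      moreover have "\<ominus> (s \<otimes> c) \<in> C"
        using X.submoduleD(5)[OF C(1) DC(4)[OF s(1) cr(1)]]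
        by (simp add: regular_module_def a_inv_def m_inv_def)
      ultimately show ?thesis using s(1) by (auto simp: set_add_def')
    qed
  qed
  \<comment> \<open>The quotient of I by C is a line. So a strict step from A to B with the same
    trace on C starts inside C and leaves it, and the second component only has to record whether a
    submodule lies in C.\<close>
  have "acc R ?X I"
  proof (rule acc_lex[OF accC, of "{(False, True)}" _ _ "\<lambda>A. A \<inter> C" "\<lambda>A. A \<subseteq> C"],
      simp, rule disj_imp[THEN iffD2], rule impI)
    fix A B assume AB: "submodule A R ?X" "submodule B R ?X" "A \<subset> B" "B \<subseteq> I"
      and "\<not> (submodule (A \<inter> C) R ?X \<and> submodule (B \<inter> C) R ?X \<and> A \<inter> C \<subset> B \<inter> C \<and> B \<inter> C \<subseteq> C)"
    then have eq: "A \<inter> C = B \<inter> C" using X.submodule_Int C(1) by blast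
    have "A \<subseteq> C"
    proof (rule ccontr)
      assume "\<not> A \<subseteq> C"
      note up = X.set_add_upper[OF AB(1) C(1)]
      have AC: "submodule (A <+>\<^bsub>?X\<^esub> C) R ?X" by (intro X.submodule_set_add AB C)
      have "C \<subset> A <+>\<^bsub>?X\<^esub> C" using \<open>\<not> A \<subseteq> C\<close> up by blast
      then have "x \<in> A <+>\<^bsub>?X\<^esub> C" using max[OF AC sum_I] AB(3,4) C(2) by blast
      then have "C <+>\<^bsub>?X\<^esub> ((\<lambda>r. r \<odot>\<^bsub>?X\<^esub> x) ` carrier R) \<subseteq> A <+>\<^bsub>?X\<^esub> C"
        using X.submoduleD(3,4)[OF AC] up(2) by (force simp: set_add_def'[of ?X C])
      then have "B \<subseteq> A <+>\<^bsub>?X\<^esub> C" using span AB(4) by blast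
      then show False using X.modular_law[OF AB(1,2) C(1) _ eq] AB(3) by blast
    qed
    then show "A \<inter> C = B \<inter> C \<and> (B \<subseteq> C, A \<subseteq> C) \<in> {(False, True)}"
      using eq AB(3) by auto
  qed
  then show False using I(2) by blast
qed


section \<open>The minimal injective cogenerator\<close>

context
  fixes R :: "'r ring" (structure)
  assumes cring: "cring R"
begin

interpretation cring R by (rule cring)

lemma exists_maximal_ideal:
  assumes "acc R (regular_module R) (carrier R)" "submodule I R (regular_module R)" "\<one> \<notin> I"
  obtains m where "maximalideal m R" "I \<subseteq> m"
proof -
  let ?X = "{J. submodule J R (regular_module R) \<and> I \<subseteq> J \<and> \<one> \<notin> J}"
  interpret X: left_module R "regular_module R" by (rule regular_left_module) (rule ring_axioms)
  obtain m where m: "m \<in> ?X" "\<And>J. J \<in> ?X \<Longrightarrow> \<not> m \<subset> J"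
    by (rule acc_maximal[OF assms(1), of I ?X]) (use assms X.submoduleD(1) in auto)
  have full: "J = carrier R" if "ideal J R" "\<one> \<in> J" for J using that by (rule ideal.one_imp_carrier)
  have "maximalideal m R"
  proof (rule maximalidealI)
    show "ideal m R" using m(1) ideal_iff_submodule[OF cring] by simp
    show "carrier R \<noteq> m" using m(1) by auto
    fix J assume "ideal J R" "m \<subseteq> J" "J \<subseteq> carrier R"
    then show "J = m \<or> J = carrier R" using m(1) m(2)[of J] full[of J] ideal_iff_submodule[OF cring] by auto
  qed
  then show ?thesis using that m(1) by blast
qed

lemma submodule_jacobson_radical: "submodule (jacobson_radical R) R (regular_module R)"
proof -
  interpret X: left_module R "regular_module R" by (rule regular_left_module) (rule ring_axioms)
  have "submodule I R (regular_module R)" if "maximalideal I R" for I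
    using that ideal_iff_submodule[OF cring] by (simp add: maximalideal_def)
  note D = X.submoduleD[OF this, simplified]
  show ?thesis
    by (rule X.submoduleI) (auto simp: jacobson_radical_def D(2,3,4))
qed

text \<open>The class of the element found here generates a copy of \<open>R / m\<close> in \<open>R / rad R\<close>.\<close>

lemma simple_in_semisimple_quotient:
  assumes "dcc R (regular_module R) (carrier R)" "maximalideal m R"
  obtains y where "y \<in> carrier R" "y \<notin> m" "\<And>r. r \<in> m \<Longrightarrow> r \<otimes> y \<in> jacobson_radical R"
proof -
  interpret X: left_module R "regular_module R" by (rule regular_left_module) (rule ring_axioms)
  interpret m: maximalideal m R by fact
  interpret mp: primeideal m R by (rule maximalideal_prime[OF assms(2)])
  \<comment> \<open>The minimal Y chosen below lies in every maximal ideal m' other than m: as m is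
    prime, Y \<inter> m' is still not contained in m. So r y lies in m' because of y, and in m
    because of r.\<close>
  let ?X = "{J. submodule J R (regular_module R) \<and> \<not> J \<subseteq> m}"
  have "\<not> carrier R \<subseteq> m" using m.I_notcarr m.a_subset by blast
  then have "carrier R \<in> ?X" using X.submodule_carrier by simp
  then obtain Y where Y: "Y \<in> ?X" "\<And>J. J \<in> ?X \<Longrightarrow> \<not> J \<subset> Y"
    by (rule dcc_minimal[OF assms(1)]) (use X.submoduleD(1) in auto)
  note D = X.submoduleD[of Y, simplified]
  have Ys: "submodule Y R (regular_module R)" using Y(1) by simp
  obtain y where y: "y \<in> Y" "y \<notin> m" using Y(1) by blast
  have yR: "y \<in> carrier R" using D(1)[OF Ys] y by blast
  have "r \<otimes> y \<in> jacobson_radical R" if r: "r \<in> m" for r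
  proof -
    have rR: "r \<in> carrier R" using r m.a_subset by blast
    have "r \<otimes> y \<in> m'" if m': "maximalideal m' R" for m'
    proof (cases "m' = m")
      case True
      then show ?thesis using m.I_r_closed[OF r yR] by simp
    next
      case False
      interpret m': maximalideal m' R by fact
      have "\<not> m' \<subseteq> m"
        using m'.I_maximal[OF m.is_ideal] m.a_subset m.I_notcarr False by blast
      then obtain u where u: "u \<in> m'" "u \<notin> m" by blast
      have uR: "u \<in> carrier R" using u m'.a_subset by blast
      have "u \<otimes> y \<in> Y" using D(4)[OF Ys uR y(1)] .
      moreover have "u \<otimes> y \<in> m'" using m'.I_r_closed[OF u(1) yR] .
      moreover have "u \<otimes> y \<notin> m" using mp.I_prime[OF uR yR] u(2) y(2) by blast
      ultimately have "Y \<inter> m' \<in> ?X"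
        using X.submodule_Int[OF Ys] ideal_iff_submodule[OF cring] m'.is_ideal by blast
      then have "Y \<subseteq> m'" using Y(2) by blast
      then show ?thesis using m'.I_l_closed[OF _ rR] y(1) by blast
    qed
    then show ?thesis using rR yR by (auto simp: jacobson_radical_def)
  qed
  then show ?thesis using that yR y(2) by blast
qed

end

text \<open>The scalars carrying z into B form a proper ideal, contained in a maximal m. So (B + R
  z) / B maps onto R / m, which embeds into R / rad R and thence into E; injectivity extends the
  composite to X.\<close>

lemma injective_envelope_cogenerates:
  fixes R :: "'r ring" (structure) and X :: "('r, 'x) module"
  assumes "artinian_cring R"
    and env: "injective_envelope R (quotient_module (regular_module R) (jacobson_radical R)) \<iota> E"
    and "fg_module R X" "submodule B R X" "z \<in> carrier X" "z \<notin> B"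
  obtains \<psi> where "lin_map R X E \<psi>" "\<psi> z \<noteq> \<zero>\<^bsub>E\<^esub>" "\<And>b. b \<in> B \<Longrightarrow> \<psi> b = \<zero>\<^bsub>E\<^esub>"
proof -
  interpret cring R using assms(1) by (simp add: artinian_cring_def)
  note dcc = artinian_dcc[OF assms(1)]
  note acc = dcc_imp_acc[OF is_cring dcc]
  interpret X: left_module R X using assms(3) fg_module_iff by blast
  interpret E: left_module R E using env by (simp add: injective_envelope_def injective_module_def)
  interpret reg: left_module R "regular_module R" by (rule regular_left_module) (rule ring_axioms)
  let ?J = "jacobson_radical R" and ?Q = "quotient_module (regular_module R) (jacobson_radical R)"
  note J = submodule_jacobson_radical[OF is_cring]
  let ?p = "\<lambda>x. ?J +>\<^bsub>regular_module R\<^esub> x"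
  note p = reg.quotient_module[OF J]
  note B = X.submoduleD[OF assms(4)]
  define I where "I = {r \<in> carrier R. r \<odot>\<^bsub>X\<^esub> z \<in> B}"
  have "submodule I R (regular_module R)" unfolding I_def by (rule X.submodule_colon) fact+
  moreover have "\<one> \<notin> I" using assms(5,6) by (simp add: I_def X.smult_one)
  ultimately obtain m where m: "maximalideal m R" "I \<subseteq> m" using exists_maximal_ideal[OF is_cring acc] by blast
  obtain y where y: "y \<in> carrier R" "y \<notin> m" "\<And>r. r \<in> m \<Longrightarrow> r \<otimes> y \<in> ?J"
    using simple_in_semisimple_quotient[OF is_cring dcc m(1)] by blast
  interpret \<iota>: lin R ?Q E \<iota>
    using env by (intro linI p E.left_module_axioms) (auto simp: injective_envelope_def lmod_hom_iff)
  have inj: "inj_on \<iota> (carrier ?Q)" using env by (simp add: injective_envelope_def)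
  define e where "e = \<iota> (?p y)"
  have pc: "?p x \<in> carrier ?Q" if "x \<in> carrier R" for x using lin_map_closed[OF p(2)] that by simp
  have eE: "e \<in> carrier E" unfolding e_def using pc[OF y(1)] by simp
  have "y \<notin> ?J" using y(2) m(1) by (auto simp: jacobson_radical_def)
  then have e0: "e \<noteq> \<zero>\<^bsub>E\<^esub>"
    using inj_onD[OF inj, of "?p y" "\<zero>\<^bsub>?Q\<^esub>"] pc[OF y(1)] p(4)[of y] y(1) by (auto simp: e_def)
  have me: "r \<odot>\<^bsub>E\<^esub> e = \<zero>\<^bsub>E\<^esub>" if r: "r \<in> m" for r
  proof -
    have rR: "r \<in> carrier R" using r m(1) by (metis ideal.Icarr maximalideal_def)
    have "r \<odot>\<^bsub>E\<^esub> e = \<iota> (r \<odot>\<^bsub>?Q\<^esub> ?p y)"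
      using \<iota>.smult[OF rR pc[OF y(1)]] by (simp add: e_def)
    also have "r \<odot>\<^bsub>?Q\<^esub> ?p y = ?p (r \<otimes> y)" using lin_map_smult[OF p(2) rR, of y] y(1) by simp
    also have "\<dots> = \<zero>\<^bsub>?Q\<^esub>" using p(4)[of "r \<otimes> y"] y(3)[OF r] rR y(1) by simp
    finally show ?thesis by simp
  qed
  let ?A = "B <+>\<^bsub>X\<^esub> ((\<lambda>r. r \<odot>\<^bsub>X\<^esub> z) ` carrier R)"
  have cz: "submodule ((\<lambda>r. r \<odot>\<^bsub>X\<^esub> z) ` carrier R) R X" by (rule X.submodule_cyclic) fact
  have A: "submodule ?A R X" by (rule X.submodule_set_add) fact+
  have repr: "\<exists>r b. r \<in> carrier R \<and> b \<in> B \<and> a = b \<oplus>\<^bsub>X\<^esub> r \<odot>\<^bsub>X\<^esub> z" if "a \<in> ?A" for a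
    using that by (auto simp: set_add_def')
  \<comment> \<open>The map b + r z -> r e. In two representations of the same element the scalars
    differ by a member of I \<subseteq> m, and m annihilates e, so every choice gives the same
    value.\<close>
  define f where "f a = (SOME e'. \<exists>r b. r \<in> carrier R \<and> b \<in> B \<and> a = b \<oplus>\<^bsub>X\<^esub> r \<odot>\<^bsub>X\<^esub> z \<and> e' = r \<odot>\<^bsub>E\<^esub> e)" for a
  have f: "f (b \<oplus>\<^bsub>X\<^esub> r \<odot>\<^bsub>X\<^esub> z) = r \<odot>\<^bsub>E\<^esub> e" if b: "b \<in> B" and r: "r \<in> carrier R" for b r
    unfolding f_def
  proof (rule some_equality)
    show "\<exists>r' b'. r' \<in> carrier R \<and> b' \<in> B \<and>
      b \<oplus>\<^bsub>X\<^esub> r \<odot>\<^bsub>X\<^esub> z = b' \<oplus>\<^bsub>X\<^esub> r' \<odot>\<^bsub>X\<^esub> z \<and> r \<odot>\<^bsub>E\<^esub> e = r' \<odot>\<^bsub>E\<^esub> e" using b r by blast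
    fix e' assume "\<exists>r' b'. r' \<in> carrier R \<and> b' \<in> B \<and>
      b \<oplus>\<^bsub>X\<^esub> r \<odot>\<^bsub>X\<^esub> z = b' \<oplus>\<^bsub>X\<^esub> r' \<odot>\<^bsub>X\<^esub> z \<and> e' = r' \<odot>\<^bsub>E\<^esub> e"
    then obtain r' b' where *: "r' \<in> carrier R" "b' \<in> B"
      "b \<oplus>\<^bsub>X\<^esub> r \<odot>\<^bsub>X\<^esub> z = b' \<oplus>\<^bsub>X\<^esub> r' \<odot>\<^bsub>X\<^esub> z" "e' = r' \<odot>\<^bsub>E\<^esub> e" by blast
    have c: "b \<in> carrier X" "b' \<in> carrier X" "r \<odot>\<^bsub>X\<^esub> z \<in> carrier X" "r' \<odot>\<^bsub>X\<^esub> z \<in> carrier X"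
      using b * B(1) r assms(5) by auto
    have "(r \<ominus> r') \<odot>\<^bsub>X\<^esub> z = r \<odot>\<^bsub>X\<^esub> z \<ominus>\<^bsub>X\<^esub> r' \<odot>\<^bsub>X\<^esub> z"
      using r *(1) assms(5) by (simp add: a_minus_def X.smult_l_distr X.smult_l_minus)
    also have "r \<odot>\<^bsub>X\<^esub> z = (b' \<oplus>\<^bsub>X\<^esub> r' \<odot>\<^bsub>X\<^esub> z) \<ominus>\<^bsub>X\<^esub> b"
      using X.add_diff(2)[OF c(1,3)] *(3) by simp
    also have "(b' \<oplus>\<^bsub>X\<^esub> r' \<odot>\<^bsub>X\<^esub> z) \<ominus>\<^bsub>X\<^esub> b \<ominus>\<^bsub>X\<^esub> r' \<odot>\<^bsub>X\<^esub> z = b' \<ominus>\<^bsub>X\<^esub> b"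
      using c by (simp add: a_minus_def X.M.a_ac X.M.r_neg2 X.M.r_neg1 X.M.r_neg)
    finally have "r \<ominus> r' \<in> I" using B(6)[OF *(2) b] r *(1) by (simp add: I_def)
    then have "(r \<ominus> r') \<odot>\<^bsub>E\<^esub> e = \<zero>\<^bsub>E\<^esub>" using me m(2) by blast
    then have "r \<odot>\<^bsub>E\<^esub> e \<ominus>\<^bsub>E\<^esub> r' \<odot>\<^bsub>E\<^esub> e = \<zero>\<^bsub>E\<^esub>"
      using r *(1) eE by (simp add: a_minus_def E.smult_l_distr E.smult_l_minus)
    then show "e' = r \<odot>\<^bsub>E\<^esub> e"
      using r *(1,4) eE E.add_diff(1)[of "r' \<odot>\<^bsub>E\<^esub> e" "r \<odot>\<^bsub>E\<^esub> e"] by simp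
  qed
  have "lin_map R (X\<lparr>carrier := ?A\<rparr>) E f"
  proof (rule lin_mapI)
    fix a assume "a \<in> carrier (X\<lparr>carrier := ?A\<rparr>)"
    then obtain r b where rb: "r \<in> carrier R" "b \<in> B" "a = b \<oplus>\<^bsub>X\<^esub> r \<odot>\<^bsub>X\<^esub> z"
      using repr[of a] by auto
    then show "f a \<in> carrier E" using f eE by simp
    show "f (s \<odot>\<^bsub>X\<lparr>carrier := ?A\<rparr>\<^esub> a) = s \<odot>\<^bsub>E\<^esub> f a" if s: "s \<in> carrier R" for s
    proof -
      have "s \<odot>\<^bsub>X\<^esub> a = s \<odot>\<^bsub>X\<^esub> b \<oplus>\<^bsub>X\<^esub> (s \<otimes> r) \<odot>\<^bsub>X\<^esub> z"
        using rb s B(1) assms(5) by (simp add: subset_iff X.smult_r_distr X.smult_assoc)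
      then show ?thesis using f[OF B(4)[OF s rb(2)], of "s \<otimes> r"] f[OF rb(2,1)] rb s eE
        by (simp add: E.smult_assoc)
    qed
    fix a' assume "a' \<in> carrier (X\<lparr>carrier := ?A\<rparr>)"
    then obtain r' b' where rb': "r' \<in> carrier R" "b' \<in> B" "a' = b' \<oplus>\<^bsub>X\<^esub> r' \<odot>\<^bsub>X\<^esub> z"
      using repr[of a'] by auto
    have "a \<oplus>\<^bsub>X\<^esub> a' = (b \<oplus>\<^bsub>X\<^esub> b') \<oplus>\<^bsub>X\<^esub> (r \<oplus> r') \<odot>\<^bsub>X\<^esub> z"
      using rb rb' B(1) assms(5) by (simp add: subset_iff X.smult_l_distr X.M.a_ac)
    then show "f (a \<oplus>\<^bsub>X\<lparr>carrier := ?A\<rparr>\<^esub> a') = f a \<oplus>\<^bsub>E\<^esub> f a'"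
      using f[OF B(3)[OF rb(2) rb'(2)], of "r \<oplus> r'"] f[OF rb(2,1)] f[OF rb'(2,1)] rb rb' eE
      by (simp add: E.smult_l_distr)
  qed
  moreover have "injective_module R E" using env by (simp add: injective_envelope_def)
  ultimately obtain \<psi> where \<psi>: "lin_map R X E \<psi>" "\<And>a. a \<in> ?A \<Longrightarrow> \<psi> a = f a"
    using assms(3) A by (metis injective_extend)
  show ?thesis
  proof (rule that[OF \<psi>(1)])
    have "z \<in> (\<lambda>r. r \<odot>\<^bsub>X\<^esub> z) ` carrier R"
      using assms(5) by (auto simp: X.smult_one intro!: image_eqI[of _ _ \<one>])
    then have "z \<in> ?A" using X.set_add_upper[OF assms(4) cz] by blast
    then show "\<psi> z \<noteq> \<zero>\<^bsub>E\<^esub>"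
      using \<psi>(2) f[OF B(2), of \<one>] assms(5) e0 eE by (simp add: X.smult_one E.smult_one)
    fix b assume b: "b \<in> B"
    then have "b \<in> ?A" using X.set_add_upper[OF assms(4) cz] by blast
    then show "\<psi> b = \<zero>\<^bsub>E\<^esub>"
      using \<psi>(2) f[OF b, of \<zero>] b B(1) assms(5) eE by (simp add: subset_iff)
  qed
qed


section \<open>Artin algebras\<close>

lemma artin_algebraD:
  assumes "artin_algebra R \<phi> \<Lambda>"
  shows "artinian_cring R" "cring R" "ring R" "ring \<Lambda>" "\<phi> \<in> ring_hom R \<Lambda>"
    "r \<in> carrier R \<Longrightarrow> a \<in> carrier \<Lambda> \<Longrightarrow> \<phi> r \<otimes>\<^bsub>\<Lambda>\<^esub> a = a \<otimes>\<^bsub>\<Lambda>\<^esub> \<phi> r"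
    "fg_module R (restrict_scalars \<phi> (regular_module \<Lambda>))"
  using assms by (auto simp: artin_algebra_def artinian_cring_def cring_def)

text \<open>Since \<phi> maps into the centre, both regular modules have the same structure over R,
  and the identity transfers finite generation.\<close>

lemma artin_algebra_opposite:
  fixes R :: "'r ring"
  assumes "artin_algebra R \<phi> \<Lambda>" shows "artin_algebra R \<phi> (opposite_ring \<Lambda>)"
proof -
  note D = artin_algebraD[OF assms]
  interpret ring \<Lambda> by (rule D(4))
  have op: "ring (opposite_ring \<Lambda>)" by (rule opposite_ring_ring[OF D(4)])
  note h = ring_hom_memE[OF D(5)]
  have hom: "\<phi> \<in> ring_hom R (opposite_ring \<Lambda>)"
  proof (rule ring_hom_memI)
    fix x y assume "x \<in> carrier R" "y \<in> carrier R"
    then show "\<phi> (x \<otimes>\<^bsub>R\<^esub> y) = \<phi> x \<otimes>\<^bsub>opposite_ring \<Lambda>\<^esub> \<phi> y"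
      using h(1,2) D(6)[of x "\<phi> y"] by simp
  qed (use h in auto)
  have "fg_module R (restrict_scalars \<phi> (regular_module (opposite_ring \<Lambda>)))"
  proof (rule fg_module_surj_image[OF D(7)])
    show "left_module R (restrict_scalars \<phi> (regular_module (opposite_ring \<Lambda>)))"
      by (intro restrict_scalars_left_module[OF regular_left_module[OF op] D(3)] hom)
    show "lin_map R (restrict_scalars \<phi> (regular_module \<Lambda>))
      (restrict_scalars \<phi> (regular_module (opposite_ring \<Lambda>))) (\<lambda>x. x)"
      using D(6) h(1) by (intro lin_mapI) simp_all
  qed simp
  then show ?thesis using D op hom by (simp add: artin_algebra_def)
qed

lemma artin_algebra_chain_conditions:
  fixes R :: "'r ring"
  assumes "artin_algebra R \<phi> \<Lambda>" "fg_module \<Lambda> M"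
  shows "dcc \<Lambda> M (carrier M)" "acc \<Lambda> M (carrier M)"
proof -
  note D = artin_algebraD[OF assms(1)]
  have M: "left_module \<Lambda> M" using assms(2) fg_module_iff by blast
  interpret r: left_module R "restrict_scalars \<phi> M" by (rule restrict_scalars_left_module) (fact M D)+
  note dcc = artinian_dcc[OF D(1)]
  note c = r.fg_chain_conditions[OF dcc dcc_imp_acc[OF D(2) dcc]
      fg_module_restrict_scalars[OF assms(2) D(3,5,7)]]
  show "dcc \<Lambda> M (carrier M)" "acc \<Lambda> M (carrier M)"
    using c by (auto intro: chain_conditions_restrict_scalars[OF M D(3,5)])
qed


section \<open>Existence of resolutions and projective covers\<close>

text \<open>The inductive step for resolutions: the ascending chain condition makes a kernel inside
  a free module finitely generated, so that it is covered by a free module of finite rank.\<close>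

lemma free_module_onto_submodule:
  assumes "artin_algebra R \<phi> \<Lambda>" "submodule K \<Lambda> (free_module \<Lambda> n)"
  shows "\<exists>k. \<exists>f\<in>lmod_hom \<Lambda> (free_module \<Lambda> k) (free_module \<Lambda> n). f ` carrier (free_module \<Lambda> k) = K"
proof -
  have \<Lambda>: "ring \<Lambda>" by (rule artin_algebraD[OF assms(1)])
  have F: "left_module \<Lambda> (free_module \<Lambda> n)" for n by (rule free_left_module[OF \<Lambda>])
  let ?K = "(free_module \<Lambda> n)\<lparr>carrier := K\<rparr>"
  have "fg_module \<Lambda> ?K"
    by (rule left_module.submodule_fg[OF F _ assms(2)])
      (rule artin_algebra_chain_conditions(2)[OF assms(1) dual_basis_fg[OF free_dual_basis[OF \<Lambda>]]])
  then obtain k x where K: "left_module \<Lambda> ?K" and g: "generates \<Lambda> ?K k x" by (rule fg_moduleE)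
  have "lin_map \<Lambda> (free_module \<Lambda> k) ?K (lincomb ?K k x)"
    by (intro lincomb_lin_map K generatesD(1)[OF g])
  then have "lin_map \<Lambda> (free_module \<Lambda> k) (free_module \<Lambda> n) (lincomb ?K k x)"
    by (rule lin_map_from_subset) (rule left_module.submoduleD(1)[OF F assms(2)])
  then have "restrict (lincomb ?K k x) (carrier (free_module \<Lambda> k))
      \<in> lmod_hom \<Lambda> (free_module \<Lambda> k) (free_module \<Lambda> n)"
    by (rule restrict_lmod_hom[OF F])
  moreover have "restrict (lincomb ?K k x) (carrier (free_module \<Lambda> k)) ` carrier (free_module \<Lambda> k) = K"
    using g by (simp add: generates_def)
  ultimately show ?thesis by blast
qed

lemma proj_resolution_exists:
  fixes M :: "('a, 'm) module"
  assumes "artin_algebra R \<phi> \<Lambda>" "fg_module \<Lambda> M"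
  obtains P :: "nat \<Rightarrow> ('a, nat \<Rightarrow> 'a) module" and d e where "proj_resolution \<Lambda> P d e M"
proof -
  have \<Lambda>: "ring \<Lambda>" by (rule artin_algebraD[OF assms(1)])
  let ?F = "free_module \<Lambda>"
  have F: "left_module \<Lambda> (?F n)" for n by (rule free_left_module[OF \<Lambda>])
  obtain n x where M: "left_module \<Lambda> M" and g: "generates \<Lambda> M n x"
    using assms(2) by (rule fg_moduleE)
  define e where "e = restrict (lincomb M n x) (carrier (?F n))"
  have e: "e \<in> lmod_hom \<Lambda> (?F n) M"
    unfolding e_def by (intro restrict_lmod_hom F lincomb_lin_map M generatesD(1)[OF g])
  have ker: "submodule (a_kernel (?F n) N f) \<Lambda> (?F n)"
    if "left_module \<Lambda> N" "f \<in> lmod_hom \<Lambda> (?F n) N" for n f and N :: "('a, 'n) module"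
    using that by (intro lin.submodule_kernel linI F) (auto simp: lmod_hom_iff)
  \<comment> \<open>A state (m, k, f) is a map f from \<Lambda>^k to \<Lambda>^m. At stage 0 its
    image must be the kernel of the augmentation; every later state is tied to its predecessor by
    \<open>next\<close>.\<close>
  define good where "good i s \<longleftrightarrow> (case s of (m, k, f) \<Rightarrow> f \<in> lmod_hom \<Lambda> (?F k) (?F m) \<and>
    (i = 0 \<longrightarrow> m = n \<and> f ` carrier (?F k) = a_kernel (?F n) M e))"
    for i :: nat and s :: "nat \<times> nat \<times> ((nat \<Rightarrow> 'a) \<Rightarrow> nat \<Rightarrow> 'a)"
  define "next" where "next s s' \<longleftrightarrow> (case s of (m, k, f) \<Rightarrow> case s' of (m', k', f') \<Rightarrow>
    m' = k \<and> f' ` carrier (?F k') = a_kernel (?F k) (?F m) f)"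
    for s s' :: "nat \<times> nat \<times> ((nat \<Rightarrow> 'a) \<Rightarrow> nat \<Rightarrow> 'a)"
  have "\<exists>s. \<forall>i. good i (s i) \<and> next (s i) (s (Suc i))"
  proof (rule dependent_nat_choice)
    show "\<exists>s. good 0 s"
      using free_module_onto_submodule[OF assms(1) ker[OF M e]] by (auto simp: good_def)
    show "\<exists>s'. good (Suc i) s' \<and> next s s'" if "good i s" for s i
    proof -
      obtain m k f where s: "s = (m, k, f)" by (cases s)
      then have "f \<in> lmod_hom \<Lambda> (?F k) (?F m)" using that by (simp add: good_def)
      from free_module_onto_submodule[OF assms(1) ker[OF F this]]
      show ?thesis by (auto simp: good_def next_def s)
    qed
  qed
  then obtain s where s: "\<And>i. good i (s i)" "\<And>i. next (s i) (s (Suc i))" by blast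
  define P where "P i = ?F (fst (s i))" for i
  \<comment> \<open>State i stores the differential d (Suc i), whence the shift; truncated
    subtraction affects only the irrelevant d 0.\<close>
  define d where "d i = snd (snd (s (i - 1)))" for i :: nat
  have P: "P (Suc i) = ?F (fst (snd (s i)))" for i
    using s(2)[of i] by (auto simp: next_def P_def split: prod.splits)
  have P0: "P 0 = ?F n"
    using s(1)[of 0] by (auto simp: good_def P_def split: prod.splits)
  have "proj_resolution \<Lambda> P d e M"
    unfolding proj_resolution_def
  proof (intro conjI allI)
    fix i
    show "fg_module \<Lambda> (P i)" "projective_module \<Lambda> (P i)"
      using free_dual_basis[OF \<Lambda>] by (auto simp: P_def intro: dual_basis_fg dual_basis_projective)
    show "d (Suc i) \<in> lmod_hom \<Lambda> (P (Suc i)) (P i)"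
      using s(1)[of i] by (auto simp: good_def P d_def P_def[of i] split: prod.splits)
    show "d (Suc (Suc i)) ` carrier (P (Suc (Suc i))) = a_kernel (P (Suc i)) (P i) (d (Suc i))"
      using s(2)[of i] by (auto simp: next_def P d_def P_def[of i] split: prod.splits)
  next
    show "e \<in> lmod_hom \<Lambda> (P 0) M" using e P0 by simp
    show "e ` carrier (P 0) = carrier M" using g by (simp add: P0 e_def generates_def)
    show "d 1 ` carrier (P 1) = a_kernel (P 0) M e"
      using s(1)[of 0] P[of 0] P0 by (auto simp: good_def d_def split: prod.splits)
  qed
  then show ?thesis by (rule that)
qed

text \<open>
  Fitting's lemma: the endomorphism \<open>f\<close> restricts to an automorphism of the image of a high
  power of \<open>f\<close>, which is therefore a direct summand.
\<close>

lemma fitting_projection: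
  assumes F: "left_module \<Lambda> F" and dcc: "dcc \<Lambda> F (carrier F)" and acc: "acc \<Lambda> F (carrier F)"
    and f: "lin_map \<Lambda> F F f"
  obtains J e where "J > 0" "lin_map \<Lambda> F F e" "\<And>c. c \<in> carrier F \<Longrightarrow> e (e c) = e c"
    "e ` carrier F = (f ^^ J) ` carrier F"
proof -
  interpret F: left_module \<Lambda> F by (rule F)
  have lm: "lin_map \<Lambda> F F (f ^^ j)" for j
  proof (induct j)
    case 0
    then show ?case using lin_map_id by (simp add: id_def)
  next
    case (Suc j)
    show ?case using lin_map_comp[OF Suc f] by (simp add: comp_def)
  qed
  interpret f: lin \<Lambda> F F "f ^^ j" for j by (intro linI F lm)
  define Im where "Im j = (f ^^ j) ` carrier F" for j
  define Ker where "Ker j = a_kernel F F (f ^^ j)" for j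
  have Im: "submodule (Im j) \<Lambda> F" for j unfolding Im_def by (rule f.submodule_range)
  have Ker: "submodule (Ker j) \<Lambda> F" for j unfolding Ker_def by (rule f.submodule_kernel)
  have Im_mono: "Im (i + j) \<subseteq> Im i" for i j
  proof
    fix y assume "y \<in> Im (i + j)"
    then obtain c where "c \<in> carrier F" "y = (f ^^ i) ((f ^^ j) c)" by (auto simp: Im_def funpow_add)
    then show "y \<in> Im i" by (auto simp: Im_def)
  qed
  have Ker_mono: "Ker j \<subseteq> Ker (i + j)" for i j
    unfolding Ker_def subset_iff f.a_kernel_iff by (simp add: funpow_add)
  have IX: "submodule A \<Lambda> F \<and> A \<subseteq> carrier F" if "A \<in> range Im" for A
    using that Im F.submoduleD(1)[OF Im] by (elim rangeE) simp
  obtain A where A: "A \<in> range Im" "\<And>C. C \<in> range Im \<Longrightarrow> \<not> C \<subset> A"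
    by (rule dcc_minimal[OF dcc rangeI[of Im 0] IX]) (assumption, rule that)
  from A(1) obtain J1 where "A = Im J1" by (rule rangeE)
  then have J1: "\<not> Im j \<subset> Im J1" for j using A(2)[OF rangeI[of Im j]] by simp
  have KX: "submodule B \<Lambda> F \<and> B \<subseteq> carrier F" if "B \<in> range Ker" for B
    using that Ker F.submoduleD(1)[OF Ker] by (elim rangeE) simp
  obtain B where B: "B \<in> range Ker" "\<And>C. C \<in> range Ker \<Longrightarrow> \<not> B \<subset> C"
    by (rule acc_maximal[OF acc rangeI[of Ker 0] KX]) (assumption, rule that)
  from B(1) obtain J2 where "B = Ker J2" by (rule rangeE)
  then have J2: "\<not> Ker J2 \<subset> Ker j" for j using B(2)[OF rangeI[of Ker j]] by simp
  \<comment> \<open>Beyond both points of stabilisation, and positive as the conclusion asks. Images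
    and kernels agree at J and at J + J.\<close>
  define J where "J = Suc (J1 + J2)"
  have Im_eq: "Im j = Im J1" if "j \<ge> J1" for j using J1[of j] Im_mono[of J1 "j - J1"] that by auto
  have Ker_eq: "Ker j = Ker J2" if "j \<ge> J2" for j using J2[of j] Ker_mono[of J2 "j - J2"] that by auto
  have ImJ: "Im (J + J) = Im J" and KerJ: "Ker (J + J) = Ker J"
    using Im_eq[of "J + J"] Im_eq[of J] Ker_eq[of "J + J"] Ker_eq[of J] by (simp_all add: J_def)
  let ?k = "f ^^ J"
  have kk: "(f ^^ (J + J)) c = ?k (?k c)" for c by (simp add: funpow_add)
  have ImD: "q \<in> carrier F" if "q \<in> Im J" for q using F.submoduleD(1)[OF Im] that by blast
  have inj: "q = q'" if q: "q \<in> Im J" "q' \<in> Im J" "?k q = ?k q'" for q q'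
  proof -
    have "q \<ominus>\<^bsub>F\<^esub> q' \<in> Im J" by (rule F.submoduleD(6)[OF Im q(1,2)])
    then obtain z where z: "z \<in> carrier F" "q \<ominus>\<^bsub>F\<^esub> q' = ?k z" by (auto simp: Im_def)
    have "?k (?k z) = ?k q \<ominus>\<^bsub>F\<^esub> ?k q'" using f.minus[of q q' J] ImD q z(2) by simp
    also have "\<dots> = \<zero>\<^bsub>F\<^esub>" using q ImD by (simp add: a_minus_def F.M.r_neg)
    finally have "z \<in> Ker (J + J)" using z(1) by (simp add: Ker_def f.a_kernel_iff kk)
    then have "?k z = \<zero>\<^bsub>F\<^esub>" unfolding KerJ by (simp add: Ker_def f.a_kernel_iff)
    then show ?thesis using F.add_diff(1)[of q' q] ImD q z(2) by simp
  qed
  have ex: "\<exists>q\<in>Im J. ?k q = ?k c" if "c \<in> carrier F" for c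
  proof -
    have "?k c \<in> Im (J + J)" using that unfolding ImJ by (auto simp: Im_def)
    then obtain z where "z \<in> carrier F" "?k c = ?k (?k z)" by (auto simp: Im_def kk)
    then show ?thesis by (auto simp: Im_def)
  qed
  \<comment> \<open>The projection onto the image of f^J along the kernel of f^J: f^J is bijective
    on that image, so the equation has exactly one solution there.\<close>
  define e where "e c = (THE q. q \<in> Im J \<and> ?k q = ?k c)" for c
  have e: "e c \<in> Im J" "?k (e c) = ?k c" if "c \<in> carrier F" for c
  proof -
    have "\<exists>!q. q \<in> Im J \<and> ?k q = ?k c" using ex[OF that] inj by metis
    from theI'[OF this] show "e c \<in> Im J" "?k (e c) = ?k c" by (simp_all add: e_def)
  qed
  have e_eq: "e c = q" if "c \<in> carrier F" "q \<in> Im J" "?k q = ?k c" for c q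
    using inj[of "e c" q] e[OF that(1)] that by simp
  show ?thesis
  proof (rule that)
    show "J > 0" by (simp add: J_def)
    show "lin_map \<Lambda> F F e"
    proof (rule lin_mapI)
      fix x y assume xy: "x \<in> carrier F" "y \<in> carrier F"
      show "e x \<in> carrier F" using e[OF xy(1)] ImD by blast
      show "e (x \<oplus>\<^bsub>F\<^esub> y) = e x \<oplus>\<^bsub>F\<^esub> e y"
        using xy e F.submoduleD(3)[OF Im] ImD by (intro e_eq) (auto simp: f.add)
    next
      fix a x assume ax: "a \<in> carrier \<Lambda>" "x \<in> carrier F"
      show "e (a \<odot>\<^bsub>F\<^esub> x) = a \<odot>\<^bsub>F\<^esub> e x"
        using ax e F.submoduleD(4)[OF Im] ImD by (intro e_eq) (auto simp: f.smult)
    qed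
    have fix_e: "e q = q" if "q \<in> Im J" for q using that ImD by (intro e_eq) auto
    then show "e (e c) = e c" if "c \<in> carrier F" for c using e(1)[OF that] by blast
    show "e ` carrier F = ?k ` carrier F"
      unfolding Im_def[symmetric] using e(1) fix_e ImD by force
  qed
qed

text \<open>P is minimal among the summands of a free module F that still map onto N. If U
  supplements the kernel in P, then U maps onto N and p lifts through U, which gives an endomorphism
  of F with values in U. Fitting's lemma turns a power of it into a summand inside U that maps onto
  N, and minimality leaves only U = P.\<close>

lemma projective_cover_exists:
  fixes N :: "('a, 'n) module"
  assumes "artin_algebra R \<phi> \<Lambda>" "fg_module \<Lambda> N"
  obtains P :: "('a, nat \<Rightarrow> 'a) module" and f where "projective_cover \<Lambda> P f N"
proof -
  have \<Lambda>: "ring \<Lambda>" by (rule artin_algebraD[OF assms(1)])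
  obtain n x where N: "left_module \<Lambda> N" and g: "generates \<Lambda> N n x"
    using assms(2) by (rule fg_moduleE)
  define F where "F = free_module \<Lambda> n"
  have db: "dual_basis \<Lambda> F n (free_basis \<Lambda> n) (\<lambda>i c. c i)"
    unfolding F_def by (rule free_dual_basis[OF \<Lambda>])
  note chain = artin_algebra_chain_conditions[OF assms(1) dual_basis_fg[OF db]]
  have F: "left_module \<Lambda> F" by (rule dual_basisD[OF db])
  interpret F: left_module \<Lambda> F by (rule F)
  define p where "p = lincomb N n x"
  have lp: "lin_map \<Lambda> F N p"
    unfolding p_def F_def by (intro lincomb_lin_map N generatesD(1)[OF g])
  interpret p: lin \<Lambda> F N p by (intro linI F N lp)
  have p_surj: "p ` carrier F = carrier N" using g by (simp add: generates_def p_def F_def)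
  let ?X = "{e ` carrier F |e. lin_map \<Lambda> F F e \<and> (\<forall>c\<in>carrier F. e (e c) = e c) \<and>
    p ` e ` carrier F = carrier N}"
  have "carrier F \<in> ?X" using lin_map_id p_surj by (intro CollectI exI[of _ "\<lambda>c. c"]) auto
  moreover have "submodule Q \<Lambda> F \<and> Q \<subseteq> carrier F" if "Q \<in> ?X" for Q
    using that lin.submodule_range[OF linI[OF F F]] F.submoduleD(1) by blast
  ultimately obtain Q where Q: "Q \<in> ?X" "\<And>C. C \<in> ?X \<Longrightarrow> \<not> C \<subset> Q"
    by (rule dcc_minimal[OF chain(1)]) (assumption, rule that)
  then obtain e where e: "lin_map \<Lambda> F F e" "\<And>c. c \<in> carrier F \<Longrightarrow> e (e c) = e c"
    "p ` Q = carrier N" "Q = e ` carrier F" by blast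
  interpret e: lin \<Lambda> F F e by (intro linI F e)
  have Qs: "submodule Q \<Lambda> F" unfolding e(4) by (rule e.submodule_range)
  have QF: "Q \<subseteq> carrier F" using F.submoduleD(1)[OF Qs] .
  have eQ: "e q = q" if "q \<in> Q" for q using that e(2,4) by auto
  define P where "P = F\<lparr>carrier := Q\<rparr>"
  have P: "left_module \<Lambda> P" unfolding P_def by (rule F.submodule_left_module[OF Qs])
  have incl: "lin_map \<Lambda> P F (\<lambda>c. c)"
    unfolding P_def by (rule lin_map_subset[OF lin_map_id QF])
  have eP: "lin_map \<Lambda> F P e"
    unfolding P_def by (rule lin_map_into_subset[OF e(1)]) (simp add: e(4))
  have dbP: "dual_basis \<Lambda> P n (\<lambda>j. e (free_basis \<Lambda> n j)) (\<lambda>j c. c j)"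
    using dual_basis_retract[OF db P eP incl] eQ by (simp add: P_def)
  have pP: "lin_map \<Lambda> P N p" using lin_map_comp[OF incl lp] .
  define f where "f = restrict p Q"
  have f: "f \<in> lmod_hom \<Lambda> P N" using restrict_lmod_hom[OF P pP] by (simp add: f_def P_def)
  have kerf: "a_kernel P N f = {c \<in> Q. p c = \<zero>\<^bsub>N\<^esub>}" by (auto simp: a_kernel_def' f_def P_def)
  have "superfluous_submodule \<Lambda> P (a_kernel P N f)"
    unfolding superfluous_submodule_def
  proof (intro conjI allI impI)
    show "submodule (a_kernel P N f) \<Lambda> P"
      by (rule lin.submodule_kernel[OF linI[OF P N lmod_hom_lin_map[OF f]]])
    fix U assume "submodule U \<Lambda> P \<and> U <+>\<^bsub>P\<^esub> a_kernel P N f = carrier P"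
    then have U: "submodule U \<Lambda> F" "U \<subseteq> Q" and sum: "U <+>\<^bsub>P\<^esub> {c \<in> Q. p c = \<zero>\<^bsub>N\<^esub>} = Q"
      using F.submodule_restrict_iff[OF Qs] kerf by (auto simp: P_def)
    have pU: "p ` U = carrier N"
    proof
      show "p ` U \<subseteq> carrier N" using U(2) QF by auto
      show "carrier N \<subseteq> p ` U"
      proof
        fix y assume "y \<in> carrier N"
        then obtain q where q: "q \<in> Q" "y = p q" using e(3) by auto
        then have "q \<in> U <+>\<^bsub>P\<^esub> {c \<in> Q. p c = \<zero>\<^bsub>N\<^esub>}" using sum by simp
        then obtain u c where "u \<in> U" "c \<in> Q" "p c = \<zero>\<^bsub>N\<^esub>" "q = u \<oplus>\<^bsub>F\<^esub> c"
          by (auto simp: set_add_def' P_def)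
        then have "p q = p u" using p.add[of u c] U(2) QF by (auto simp: subset_iff)
        then show "y \<in> p ` U" using q \<open>u \<in> U\<close> by auto
      qed
    qed
    let ?U = "F\<lparr>carrier := U\<rparr>"
    have UF: "U \<subseteq> carrier F" using U(2) QF by blast
    have lU: "left_module \<Lambda> ?U" by (rule F.submodule_left_module[OF U(1)])
    obtain h where h: "lin_map \<Lambda> P ?U h" "\<And>q. q \<in> carrier P \<Longrightarrow> p (h q) = p q"
    proof (rule dual_basis_lift[OF dbP lU N lin_map_subset[OF lp UF] pP])
      show "p (e (free_basis \<Lambda> n i)) \<in> p ` carrier ?U" if "i < n" for i
        using pU dual_basisD(2)[OF db that] by simp
    qed (rule that)
    let ?k = "\<lambda>c. h (e c)"
    have k: "lin_map \<Lambda> F F ?k"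
      by (rule lin_map_from_subset[OF lin_map_comp[OF eP h(1)] UF])
    have kU: "?k c \<in> U" if "c \<in> carrier F" for c
      using lin_map_closed[OF lin_map_comp[OF eP h(1)] that] by simp
    obtain J e' where J: "J > 0" "lin_map \<Lambda> F F e'" "\<And>c. c \<in> carrier F \<Longrightarrow> e' (e' c) = e' c"
      "e' ` carrier F = (?k ^^ J) ` carrier F"
      using fitting_projection[OF F chain k] by metis
    \<comment> \<open>The values of \<open>?k\<close> lie in U \<subseteq> Q, where e is the
      identity; so further applications of \<open>?k\<close> do not change the image under
      p.\<close>
    have pow: "(?k ^^ Suc j) c \<in> U \<and> p ((?k ^^ Suc j) c) = p (e c)" if c: "c \<in> carrier F" for j c
    proof (induct j)
      case 0
      then show ?case using kU[OF c] h(2)[of "e c"] lin_map_closed[OF eP c] by simp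
    next
      case (Suc j)
      then have *: "(?k ^^ Suc j) c \<in> U" "p ((?k ^^ Suc j) c) = p (e c)" by auto
      then have "p (?k ((?k ^^ Suc j) c)) = p (e c)"
        using h(2)[of "(?k ^^ Suc j) c"] U(2) eQ by (auto simp: P_def)
      moreover have "?k ((?k ^^ Suc j) c) \<in> U" using kU * UF by blast
      ultimately show ?case by simp
    qed
    obtain j where "J = Suc j" using J(1) by (cases J) auto
    then have powJ: "(?k ^^ J) c \<in> U" "p ((?k ^^ J) c) = p (e c)" if "c \<in> carrier F" for c
      using pow[OF that, of j] by auto
    have "p ` (?k ^^ J) ` carrier F = p ` e ` carrier F"
      unfolding image_image using powJ(2) by (rule image_cong[OF refl])
    then have "p ` e' ` carrier F = carrier N" using e(3,4) by (simp add: J(4))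
    then have "(?k ^^ J) ` carrier F \<in> ?X" using J(2,3) by (intro CollectI exI[of _ e']) (auto simp: J(4))
    then have "\<not> (?k ^^ J) ` carrier F \<subset> Q" by (rule Q(2))
    moreover have "(?k ^^ J) ` carrier F \<subseteq> U" using powJ(1) by blast
    ultimately show "U = carrier P" using U(2) by (auto simp: P_def)
  qed
  then have "projective_cover \<Lambda> P f N"
    unfolding projective_cover_def
    using dual_basis_fg[OF dbP] dual_basis_projective[OF dbP] f e(3) by (simp add: f_def P_def)
  then show ?thesis by (rule that)
qed

lemma minimal_proj_presentation_exists:
  fixes M :: "('a, 'm) module"
  assumes "artin_algebra R \<phi> \<Lambda>" "fg_module \<Lambda> M"
  obtains P1 :: "('a, nat \<Rightarrow> 'a) module" and d and P0 :: "('a, nat \<Rightarrow> 'a) module" and e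
  where "minimal_proj_presentation \<Lambda> P1 d P0 e M"
proof -
  obtain P0 :: "('a, nat \<Rightarrow> 'a) module" and e where c: "projective_cover \<Lambda> P0 e M"
    using projective_cover_exists[OF assms] by metis
  have fg: "fg_module \<Lambda> P0" and e: "e \<in> lmod_hom \<Lambda> P0 M" using c by (auto simp: projective_cover_def)
  interpret lin \<Lambda> P0 M e
    using fg assms(2) e by (intro linI) (auto simp: fg_module_def lmod_hom_iff)
  have "fg_module \<Lambda> (P0\<lparr>carrier := a_kernel P0 M e\<rparr>)"
    by (rule M.submodule_fg[OF artin_algebra_chain_conditions(2)[OF assms(1) fg] submodule_kernel])
  then obtain P1 :: "('a, nat \<Rightarrow> 'a) module" and d
    where "projective_cover \<Lambda> P1 d (P0\<lparr>carrier := a_kernel P0 M e\<rparr>)"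
    using projective_cover_exists[OF assms(1)] by metis
  with c show ?thesis by (intro that) (auto simp: minimal_proj_presentation_def)
qed


section \<open>Vanishing of Ext\<close>

lemma hom_group_comm_group:
  assumes "left_module \<Lambda> M" "left_module \<Lambda> N" shows "comm_group (hom_group \<Lambda> M N)"
proof -
  interpret N: left_module \<Lambda> N by fact
  \<comment> \<open>A record with additive fields, so that \<open>pointwise_abelian_group\<close>
    applies to the group written multiplicatively.\<close>
  let ?G = "\<lparr>carrier = lmod_hom \<Lambda> M N, mult = undefined, one = undefined,
    zero = (\<lambda>x\<in>carrier M. \<zero>\<^bsub>N\<^esub>), add = (\<lambda>f g. \<lambda>x\<in>carrier M. f x \<oplus>\<^bsub>N\<^esub> g x)\<rparr>"
  note r = restrict_lmod_hom[OF assms(1)]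
  have "lmod_hom \<Lambda> M N \<subseteq> carrier M \<rightarrow>\<^sub>E carrier N" by (auto simp: lmod_hom_def)
  then have "abelian_group ?G"
    by (intro pointwise_abelian_group[where N = N and A = "carrier M"] N.M.abelian_group_axioms)
      (simp_all add: lmod_hom_lin_map r lin_map_zero lin_map_plus lin_map_neg assms(2))
  then show ?thesis
    using abelian_group.a_comm_group by (fastforce simp: hom_group_def)
qed

lemma hom_group_precomp:
  assumes "left_module \<Lambda> M" "left_module \<Lambda> M'" "left_module \<Lambda> N" "lin_map \<Lambda> M' M d"
  shows "group_hom (hom_group \<Lambda> M N) (hom_group \<Lambda> M' N) (\<lambda>f. compose (carrier M') f d)"
proof -
  have "(\<lambda>f. compose (carrier M') f d) \<in> hom (hom_group \<Lambda> M N) (hom_group \<Lambda> M' N)"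
    using lin_map_closed[OF assms(4)] lin_map_comp[OF assms(4)]
    by (intro homI)
      (auto simp: hom_group_def compose_def fun_eq_iff intro!: restrict_lmod_hom[OF assms(2)] dest: lmod_hom_lin_map)
  then show ?thesis
    using hom_group_comm_group[OF assms(1,3)] hom_group_comm_group[OF assms(2,3)]
    by (intro group_hom.intro group_hom_axioms.intro) (auto simp: comm_group_def)
qed

lemma (in comm_group) trivial_quotient_iff:
  assumes "subgroup Z G" "subgroup B G" "B \<subseteq> Z"
  shows "trivial_group (G\<lparr>carrier := Z\<rparr> Mod B) \<longleftrightarrow> Z \<subseteq> B"
proof -
  let ?Z = "G\<lparr>carrier := Z\<rparr>"
  have gZ: "group ?Z" by (rule subgroup.subgroup_is_group[OF assms(1) is_group])
  interpret Z: comm_group ?Z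
    by (rule group.group_comm_groupI[OF gZ]) (use subgroup.subset[OF assms(1)] in \<open>auto simp: subset_iff m_comm\<close>)
  have B: "subgroup B ?Z" by (rule subgroup_incl[OF assms(2,1,3)])
  interpret normal B ?Z by (rule Z.subgroup_imp_normal[OF B])
  interpret Q: group "?Z Mod B" by (rule factorgroup_is_group)
  show ?thesis
    unfolding Q.trivial_group_subset
  proof
    assume *: "carrier (?Z Mod B) \<subseteq> {\<one>\<^bsub>?Z Mod B\<^esub>}"
    show "Z \<subseteq> B"
    proof
      fix z assume z: "z \<in> Z"
      then have "B #>\<^bsub>?Z\<^esub> z \<in> carrier (?Z Mod B)"
        using assms(3) by (auto simp: FactGroup_def RCOSETS_def)
      then have "B #>\<^bsub>?Z\<^esub> z = B" using * by (auto simp: FactGroup_def)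
      then show "z \<in> B" using Z.rcos_self[OF _ B, of z] z by simp
    qed
  next
    assume "Z \<subseteq> B"
    then show "carrier (?Z Mod B) \<subseteq> {\<one>\<^bsub>?Z Mod B\<^esub>}"
      using Z.coset_join2[OF _ B] by (auto simp: FactGroup_def RCOSETS_def)
  qed
qed

text \<open>Brings vanishing into the form that cocycles are coboundaries. The quotient makes sense
  because coboundaries are cocycles, which comes from \<open>dd\<close>.\<close>

lemma trivial_hom_cohomology_iff:
  assumes X: "left_module \<Lambda> X" and P: "\<And>i. left_module \<Lambda> (P i)"
    and d: "\<And>i. lin_map \<Lambda> (P (Suc i)) (P i) (d (Suc i))"
    and dd: "\<And>i x. x \<in> carrier (P (Suc (Suc i))) \<Longrightarrow> d (Suc i) (d (Suc (Suc i)) x) = \<zero>\<^bsub>P i\<^esub>"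
  shows "trivial_group (hom_cohomology \<Lambda> P d X (Suc i)) \<longleftrightarrow>
    (\<forall>f\<in>lmod_hom \<Lambda> (P (Suc i)) X.
      (\<forall>x\<in>carrier (P (Suc (Suc i))). f (d (Suc (Suc i)) x) = \<zero>\<^bsub>X\<^esub>) \<longrightarrow>
      (\<exists>g\<in>lmod_hom \<Lambda> (P i) X. \<forall>x\<in>carrier (P (Suc i)). f x = g (d (Suc i) x)))"
proof -
  let ?H = "\<lambda>i. hom_group \<Lambda> (P i) X" and ?\<delta> = "\<lambda>i f. compose (carrier (P (Suc i))) f (d (Suc i))"
  interpret \<delta>: group_hom "?H j" "?H (Suc j)" "?\<delta> j" for j by (rule hom_group_precomp[OF P P X d])
  interpret G: comm_group "?H (Suc i)" by (rule hom_group_comm_group[OF P X])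
  let ?Z = "kernel (?H (Suc i)) (?H (Suc (Suc i))) (?\<delta> (Suc i))" and ?B = "?\<delta> i ` lmod_hom \<Lambda> (P i) X"
  have Z: "f \<in> ?Z \<longleftrightarrow> f \<in> lmod_hom \<Lambda> (P (Suc i)) X \<and>
    (\<forall>x\<in>carrier (P (Suc (Suc i))). f (d (Suc (Suc i)) x) = \<zero>\<^bsub>X\<^esub>)" for f
    by (auto simp: kernel_def hom_group_def compose_def fun_eq_iff restrict_def)
  have carr: "lmod_hom \<Lambda> (P i) X = carrier (?H i)" for i by (simp add: hom_group_def)
  have "?B \<subseteq> ?Z"
  proof
    fix f assume "f \<in> ?B"
    then obtain g where g: "g \<in> lmod_hom \<Lambda> (P i) X" "f = ?\<delta> i g" by blast
    interpret g: lin \<Lambda> "P i" X g by (intro linI P X lmod_hom_lin_map g)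
    have "f \<in> lmod_hom \<Lambda> (P (Suc i)) X" using \<delta>.hom_closed[of g i] g by (simp add: carr)
    then show "f \<in> ?Z" unfolding Z using g(2) dd lin_map_closed[OF d] by (simp add: compose_def)
  qed
  moreover have "subgroup ?B (?H (Suc i))" unfolding carr by (rule \<delta>.img_is_subgroup)
  ultimately have triv: "trivial_group (hom_cohomology \<Lambda> P d X (Suc i)) \<longleftrightarrow> ?Z \<subseteq> ?B"
    unfolding hom_cohomology_def Let_def
    using G.trivial_quotient_iff[OF \<delta>.subgroup_kernel[of "Suc i"]] by simp
  have B: "f \<in> ?B \<longleftrightarrow> (\<exists>g\<in>lmod_hom \<Lambda> (P i) X. \<forall>x\<in>carrier (P (Suc i)). f x = g (d (Suc i) x))"
    if "f \<in> lmod_hom \<Lambda> (P (Suc i)) X" for f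
    using that unfolding lmod_hom_iff image_iff
    by (intro bex_cong refl) (auto simp: compose_def intro!: extensionalityI)
  have "?Z \<subseteq> ?B \<longleftrightarrow> (\<forall>f\<in>lmod_hom \<Lambda> (P (Suc i)) X.
      (\<forall>x\<in>carrier (P (Suc (Suc i))). f (d (Suc (Suc i)) x) = \<zero>\<^bsub>X\<^esub>) \<longrightarrow> f \<in> ?B)"
    unfolding subset_iff Z by blast
  with triv show ?thesis using B by simp
qed

lemma proj_resolutionD:
  assumes "proj_resolution \<Lambda> P d e M"
  shows "fg_module \<Lambda> (P i)" "projective_module \<Lambda> (P i)" "left_module \<Lambda> (P i)"
    "lin_map \<Lambda> (P (Suc i)) (P i) (d (Suc i))"
    "lin_map \<Lambda> (P 0) M e" "e ` carrier (P 0) = carrier M"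
    "d (Suc 0) ` carrier (P (Suc 0)) = a_kernel (P 0) M e"
    "d (Suc (Suc i)) ` carrier (P (Suc (Suc i))) = a_kernel (P (Suc i)) (P i) (d (Suc i))"
  using assms by (auto simp: proj_resolution_def fg_module_def lmod_hom_iff)

lemma proj_resolution_dd:
  assumes "proj_resolution \<Lambda> P d e M" "x \<in> carrier (P (Suc (Suc i)))"
  shows "d (Suc i) (d (Suc (Suc i)) x) = \<zero>\<^bsub>P i\<^esub>"
  using proj_resolutionD(8)[OF assms(1), of i] assms(2) by (auto simp: a_kernel_def')

lemma some_proj_resolution:
  fixes M :: "('a, 'm) module"
  assumes "artin_algebra R \<phi> \<Lambda>" "fg_module \<Lambda> M"
  obtains P d e where "some_proj_resolution \<Lambda> M = (P, d, e)" "proj_resolution \<Lambda> P d e M"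
proof -
  obtain P :: "nat \<Rightarrow> ('a, nat \<Rightarrow> 'a) module" and d e where "proj_resolution \<Lambda> P d e M"
    using proj_resolution_exists[OF assms] by metis
  then have "\<exists>r::(nat \<Rightarrow> ('a, nat \<Rightarrow> 'a) module) \<times> _ \<times> _. case r of (P, d, e) \<Rightarrow> proj_resolution \<Lambda> P d e M"
    by (intro exI[of _ "(P, d, e)"]) simp
  from someI_ex[OF this]
  have "case some_proj_resolution \<Lambda> M of (P, d, e) \<Rightarrow> proj_resolution \<Lambda> P d e M"
    by (simp only: some_proj_resolution_def)
  moreover obtain P d e where "some_proj_resolution \<Lambda> M = (P, d, e)"
    by (cases "some_proj_resolution \<Lambda> M")
  ultimately show ?thesis by (intro that) auto
qed

lemma trivial_Ext_iff:
  assumes "left_module \<Lambda> X" "some_proj_resolution \<Lambda> M = (P, d, e)" "proj_resolution \<Lambda> P d e M"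
  shows "trivial_group (Ext \<Lambda> (Suc i) M X) \<longleftrightarrow>
    (\<forall>f\<in>lmod_hom \<Lambda> (P (Suc i)) X.
      (\<forall>x\<in>carrier (P (Suc (Suc i))). f (d (Suc (Suc i)) x) = \<zero>\<^bsub>X\<^esub>) \<longrightarrow>
      (\<exists>g\<in>lmod_hom \<Lambda> (P i) X. \<forall>x\<in>carrier (P (Suc i)). f x = g (d (Suc i) x)))"
  unfolding Ext_def assms(2) prod.case
  by (rule trivial_hom_cohomology_iff[OF assms(1)]) (use proj_resolutionD[OF assms(3)] proj_resolution_dd[OF assms(3)] in auto)

text \<open>Any preimage may be used to define g: two of them differ by an element that s, and hence
  f, sends to zero.\<close>

lemma lin_map_factor:
  assumes "lin \<Lambda> A B s" "s ` carrier A = carrier B" "lin \<Lambda> A X f"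
    and "\<And>a. a \<in> carrier A \<Longrightarrow> s a = \<zero>\<^bsub>B\<^esub> \<Longrightarrow> f a = \<zero>\<^bsub>X\<^esub>"
  obtains g where "lin_map \<Lambda> B X g" "\<And>a. a \<in> carrier A \<Longrightarrow> g (s a) = f a"
proof -
  interpret s: lin \<Lambda> A B s by fact
  interpret f: lin \<Lambda> A X f by fact
  define g where "g b = f (SOME a. a \<in> carrier A \<and> s a = b)" for b
  have g: "g (s a) = f a" if a: "a \<in> carrier A" for a
  proof -
    let ?a = "SOME a'. a' \<in> carrier A \<and> s a' = s a"
    have *: "?a \<in> carrier A" "s ?a = s a" using someI[of "\<lambda>a'. a' \<in> carrier A \<and> s a' = s a" a] a by auto
    then have "s (?a \<ominus>\<^bsub>A\<^esub> a) = \<zero>\<^bsub>B\<^esub>" using a by (simp add: s.minus) (simp add: a_minus_def s.N.M.r_neg)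
    then have "f ?a \<ominus>\<^bsub>X\<^esub> f a = \<zero>\<^bsub>X\<^esub>" using assms(4)[of "?a \<ominus>\<^bsub>A\<^esub> a"] * a by (simp add: f.minus)
    then show ?thesis using f.N.add_diff(1)[of "f a" "f ?a"] * a by (simp add: g_def)
  qed
  have all: "\<exists>a\<in>carrier A. b = s a" if "b \<in> carrier B" for b using that assms(2) by blast
  show ?thesis
  proof (rule that[OF _ g])
    show "lin_map \<Lambda> B X g"
    proof (rule lin_mapI)
      fix b assume "b \<in> carrier B"
      then obtain a where a: "a \<in> carrier A" "b = s a" using all by blast
      then show "g b \<in> carrier X" using g by simp
      show "g (r \<odot>\<^bsub>B\<^esub> b) = r \<odot>\<^bsub>X\<^esub> g b" if "r \<in> carrier \<Lambda>" for r
        using g[of "r \<odot>\<^bsub>A\<^esub> a"] g[OF a(1)] a that by (simp add: s.smult f.smult)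
      fix b' assume "b' \<in> carrier B"
      then obtain a' where a': "a' \<in> carrier A" "b' = s a'" using all by blast
      then show "g (b \<oplus>\<^bsub>B\<^esub> b') = g b \<oplus>\<^bsub>X\<^esub> g b'"
        using g[of "a \<oplus>\<^bsub>A\<^esub> a'"] g[OF a(1)] g[OF a'(1)] a by (simp add: s.add f.add)
    qed
  qed
qed

text \<open>Compares the chosen resolution with an arbitrary projective module mapping onto \<open>M\<close>.\<close>

lemma trivial_Ext1_extends:
  fixes M :: "('a, 'm) module" and P0 :: "('a, 'q) module" and X :: "('a, 'x) module"
  assumes "artin_algebra R \<phi> \<Lambda>" "fg_module \<Lambda> M" and X: "left_module \<Lambda> X"
    and ext: "trivial_group (Ext \<Lambda> 1 M X)"
    and db: "dual_basis \<Lambda> P0 n y \<eta>" and p: "lin_map \<Lambda> P0 M p" "p ` carrier P0 = carrier M"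
    and f: "lin_map \<Lambda> (P0\<lparr>carrier := a_kernel P0 M p\<rparr>) X f"
  obtains h where "lin_map \<Lambda> P0 X h" "\<And>x. x \<in> a_kernel P0 M p \<Longrightarrow> h x = f x"
proof -
  obtain W \<delta> w where some: "some_proj_resolution \<Lambda> M = (W, \<delta>, w)" and W: "proj_resolution \<Lambda> W \<delta> w M"
    using some_proj_resolution[OF assms(1,2)] by blast
  note D = proj_resolutionD[OF W]
  have M: "left_module \<Lambda> M" using assms(2) fg_module_iff by blast
  have P0: "left_module \<Lambda> P0" by (rule dual_basisD[OF db])
  interpret p: lin \<Lambda> P0 M p by (intro linI P0 M p)
  interpret w: lin \<Lambda> "W 0" M w by (intro linI D M)
  obtain k x \<xi> where dbW: "dual_basis \<Lambda> (W 0) k x \<xi>" using projective_dual_basis[OF D(1,2)] by metis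
  let ?K = "a_kernel P0 M p"
  have KP: "?K \<subseteq> carrier P0" by (auto simp: p.a_kernel_iff)
  interpret f: lin \<Lambda> "P0\<lparr>carrier := ?K\<rparr>" X f
    by (intro linI X f p.M.submodule_left_module p.submodule_kernel)
  obtain a where a: "lin_map \<Lambda> P0 (W 0) a" "\<And>x. x \<in> carrier P0 \<Longrightarrow> w (a x) = p x"
    by (rule dual_basis_lift[OF db D(3) M D(5) p(1)])
      (use D(6) dual_basisD(2)[OF db] in \<open>auto intro: that\<close>)
  obtain b where b: "lin_map \<Lambda> (W 0) P0 b" "\<And>x. x \<in> carrier (W 0) \<Longrightarrow> p (b x) = w x"
    by (rule dual_basis_lift[OF dbW P0 M p(1) D(5)])
      (use p(2) dual_basisD(2)[OF dbW] in \<open>auto intro: that\<close>)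
  interpret b: lin \<Lambda> "W 0" P0 b by (intro linI D P0 b)
  interpret a: lin \<Lambda> P0 "W 0" a by (intro linI D P0 a)
  have w\<delta>: "\<delta> (Suc 0) u \<in> carrier (W 0) \<and> w (\<delta> (Suc 0) u) = \<zero>\<^bsub>M\<^esub>" if "u \<in> carrier (W (Suc 0))" for u
    using D(7) that by (auto simp: w.a_kernel_iff)
  have b\<delta>: "lin_map \<Lambda> (W (Suc 0)) (P0\<lparr>carrier := ?K\<rparr>) (\<lambda>u. b (\<delta> (Suc 0) u))"
    by (rule lin_map_into_subset[OF lin_map_comp[OF D(4) b(1)]]) (use w\<delta> b(2) in \<open>auto simp: p.a_kernel_iff\<close>)
  \<comment> \<open>Pulled back along the comparison map b, f becomes a cocycle on the chosen
    resolution; triviality of Ext writes it as g composed with \<delta> for some g on W 0.\<close>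
  let ?c = "restrict (\<lambda>u. f (b (\<delta> (Suc 0) u))) (carrier (W (Suc 0)))"
  have "?c \<in> lmod_hom \<Lambda> (W (Suc 0)) X"
    by (rule restrict_lmod_hom[OF D(3) lin_map_comp[OF b\<delta> f]])
  moreover have "?c (\<delta> (Suc (Suc 0)) u) = \<zero>\<^bsub>X\<^esub>" if "u \<in> carrier (W (Suc (Suc 0)))" for u
    using lin_map_closed[OF D(4) that] proj_resolution_dd[OF W that] f.zero by simp
  ultimately obtain g where g: "g \<in> lmod_hom \<Lambda> (W 0) X"
    "\<And>u. u \<in> carrier (W (Suc 0)) \<Longrightarrow> f (b (\<delta> (Suc 0) u)) = g (\<delta> (Suc 0) u)"
    using ext[unfolded One_nat_def trivial_Ext_iff[OF X some W]] by fastforce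
  interpret g: lin \<Lambda> "W 0" X g by (intro linI D X lmod_hom_lin_map g)
  have diff: "lin_map \<Lambda> P0 (P0\<lparr>carrier := ?K\<rparr>) (\<lambda>x. b (a x) \<ominus>\<^bsub>P0\<^esub> x)"
  proof (rule lin_map_into_subset)
    show "lin_map \<Lambda> P0 P0 (\<lambda>x. b (a x) \<ominus>\<^bsub>P0\<^esub> x)"
      by (intro lin_map_minus[OF P0] lin_map_comp[OF a(1) b(1)] lin_map_id)
    show "(\<lambda>x. b (a x) \<ominus>\<^bsub>P0\<^esub> x) ` carrier P0 \<subseteq> ?K"
      by (auto simp: p.a_kernel_iff p.minus a(2) b(2)) (simp add: a_minus_def p.N.M.r_neg)
  qed
  show ?thesis
  proof (rule that)
    \<comment> \<open>On the kernel g (a x) = f (b (a x)). As b a need not be the identity, f (b (a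
      x) - x) is subtracted; it makes sense on all of P0 because b (a x) and x have the same image
      under p.\<close>
    show "lin_map \<Lambda> P0 X (\<lambda>x. g (a x) \<ominus>\<^bsub>X\<^esub> f (b (a x) \<ominus>\<^bsub>P0\<^esub> x))"
      by (intro lin_map_minus[OF X] lin_map_comp[OF a(1) g.map] lin_map_comp[OF diff f])
    fix x assume x: "x \<in> ?K"
    then have xP: "x \<in> carrier P0" "p x = \<zero>\<^bsub>M\<^esub>" by (auto simp: p.a_kernel_iff)
    then have "a x \<in> a_kernel (W 0) M w" using a(2) by (simp add: w.a_kernel_iff)
    then obtain u where u: "u \<in> carrier (W (Suc 0))" "a x = \<delta> (Suc 0) u" using D(7) by blast
    have bK: "b (a x) \<in> ?K" using a(2) b(2) xP by (simp add: p.a_kernel_iff)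
    have dK: "b (a x) \<ominus>\<^bsub>P0\<^esub> x \<in> ?K" using lin_map_closed[OF diff xP(1)] by simp
    have "f (x \<oplus>\<^bsub>P0\<^esub> (b (a x) \<ominus>\<^bsub>P0\<^esub> x)) = f x \<oplus>\<^bsub>X\<^esub> f (b (a x) \<ominus>\<^bsub>P0\<^esub> x)"
      using f.add x dK by simp
    moreover have "x \<oplus>\<^bsub>P0\<^esub> (b (a x) \<ominus>\<^bsub>P0\<^esub> x) = b (a x)" using xP by (simp add: p.M.add_diff(1))
    ultimately have "g (a x) = f x \<oplus>\<^bsub>X\<^esub> f (b (a x) \<ominus>\<^bsub>P0\<^esub> x)"
      using g(2)[OF u(1)] u(2) by simp
    also have "\<dots> = f (b (a x) \<ominus>\<^bsub>P0\<^esub> x) \<oplus>\<^bsub>X\<^esub> f x"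
      using f.closed x dK by (simp add: f.N.M.a_comm)
    finally show "g (a x) \<ominus>\<^bsub>X\<^esub> f (b (a x) \<ominus>\<^bsub>P0\<^esub> x) = f x"
      using f.closed x dK by (simp add: f.N.add_diff(2))
  qed
qed


section \<open>The transpose\<close>

text \<open>
  The cokernel \<open>T\<close> of the dual of \<open>d\<close> has two presentations, by the duals of \<open>P1\<close>, \<open>P0\<close> and by
  \<open>Q1\<close>, \<open>Q0\<close>.  Lifts between them, unique up to homotopy, carry \<open>EXT\<close> from the first presentation
  over to the second one.
\<close>

lemma factor_through_dual_presentation:
  fixes P1 :: "('a, 'p) module" and P0 :: "('a, 'p0) module"
    and Q1 :: "('a, 'q1) module" and Q0 :: "('a, 'q) module"
    and T :: "('a, ('p \<Rightarrow> 'a) set) module"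
  assumes P1: "dual_basis \<Lambda> P1 n1 x \<xi>" and P0: "dual_basis \<Lambda> P0 n0 y \<eta>"
    and d: "lin_map \<Lambda> P1 P0 d" and X: "left_module \<Lambda> X"
    and EXT: "\<And>f. lin_map \<Lambda> P1 X f \<Longrightarrow> (\<And>p. p \<in> carrier P1 \<Longrightarrow> d p = \<zero>\<^bsub>P0\<^esub> \<Longrightarrow> f p = \<zero>\<^bsub>X\<^esub>) \<Longrightarrow>
      \<exists>h. lin_map \<Lambda> P0 X h \<and> (\<forall>p\<in>carrier P1. f p = h (d p))"
    and T: "T = quotient_module (hom_to_ring \<Lambda> P1)
      ((\<lambda>f. compose (carrier P1) f d) ` carrier (hom_to_ring \<Lambda> P0))"
    and Q0: "dual_basis S Q0 k q0 w0" and Q1: "left_module S Q1" and S: "S = opposite_ring \<Lambda>"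
    and \<delta>: "lin_map S Q1 Q0 \<delta>" and \<pi>: "lin_map S Q0 T \<pi>" "\<pi> ` carrier Q0 = carrier T"
    and exact: "\<delta> ` carrier Q1 = a_kernel Q0 T \<pi>"
    and f: "lin_map \<Lambda> (hom_to_ring S Q0) X f"
    and kill: "\<And>w. w \<in> carrier (hom_to_ring S Q0) \<Longrightarrow> (\<And>q. q \<in> carrier Q1 \<Longrightarrow> w (\<delta> q) = \<zero>\<^bsub>\<Lambda>\<^esub>) \<Longrightarrow>
      f w = \<zero>\<^bsub>X\<^esub>"
  shows "\<exists>g. lin_map \<Lambda> (hom_to_ring S Q1) X g \<and>
    (\<forall>w\<in>carrier (hom_to_ring S Q0). f w = g (compose (carrier Q1) w \<delta>))"
proof -
  note DP1 = dual_basisD[OF P1] and DP0 = dual_basisD[OF P0] and DQ0 = dual_basisD[OF Q0]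
  interpret X: left_module \<Lambda> X by (rule X)
  have \<Lambda>: "ring \<Lambda>" by (rule X.R.ring_axioms)
  have SS: "opposite_ring S = \<Lambda>" by (simp add: S)
  have SR: "ring S" unfolding S by (rule opposite_ring_ring[OF \<Lambda>])
  have regS: "left_module S (regular_module S)" by (rule regular_left_module[OF SR])
  have reg: "left_module \<Lambda> (regular_module \<Lambda>)" by (rule regular_left_module[OF \<Lambda>])
  let ?H1 = "hom_to_ring \<Lambda> P1" and ?H0 = "hom_to_ring \<Lambda> P0"
  let ?C0 = "hom_to_ring S Q0" and ?C1 = "hom_to_ring S Q1"
  have H1: "left_module S ?H1" unfolding S by (rule hom_to_ring_left_module[OF DP1(1)])
  have H0: "left_module S ?H0" unfolding S by (rule hom_to_ring_left_module[OF DP0(1)])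
  have C0: "left_module \<Lambda> ?C0" using hom_to_ring_left_module[OF DQ0(1)] unfolding SS .
  have C1: "left_module \<Lambda> ?C1" using hom_to_ring_left_module[OF Q1] unfolding SS .
  interpret H1: left_module S ?H1 by (rule H1)
  interpret d: lin \<Lambda> P1 P0 d by (intro linI DP1 DP0 d)
  let ?B = "(\<lambda>f. compose (carrier P1) f d) ` carrier ?H0"
  have "lin S ?H0 ?H1 (\<lambda>f. compose (carrier P1) f d)"
    using hom_to_ring_comp[OF DP1(1) d] by (intro linI H0 H1) (simp add: S)
  then have B: "submodule ?B S ?H1" by (rule lin.submodule_range)
  let ?c = "\<lambda>u. ?B +>\<^bsub>?H1\<^esub> u"
  note c = H1.quotient_module[OF B, folded T]
  interpret c: lin S ?H1 T ?c by (intro linI H1 c)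
  interpret \<pi>: lin S Q0 T \<pi> by (intro linI DQ0 c \<pi>)
  interpret \<delta>: lin S Q1 Q0 \<delta> by (intro linI DQ0 Q1 \<delta>)
  have \<pi>\<delta>: "\<pi> (\<delta> q) = \<zero>\<^bsub>T\<^esub>" if "q \<in> carrier Q1" for q
  proof -
    have "\<delta> q \<in> a_kernel Q0 T \<pi>" using exact that by blast
    then show ?thesis by (simp add: \<pi>.a_kernel_iff)
  qed
  have lift\<delta>: "\<exists>s\<in>carrier Q1. \<delta> s = q" if "q \<in> carrier Q0" "\<pi> q = \<zero>\<^bsub>T\<^esub>" for q
  proof -
    have "q \<in> \<delta> ` carrier Q1" unfolding exact using that by (simp add: \<pi>.a_kernel_iff)
    then show ?thesis by blast
  qed
  \<comment> \<open>v compares the presentations in one direction, from Q0 to the dual of P1; v'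
    below is its transpose, from P1 to the dual of Q0.\<close>
  obtain v where v: "lin_map S Q0 ?H1 v" "\<And>q. q \<in> carrier Q0 \<Longrightarrow> ?c (v q) = \<pi> q"
    by (rule dual_basis_lift[OF Q0 H1 c(1,2) \<pi>(1)]) (use c(3) DQ0(2) \<pi>.closed in \<open>auto intro: that\<close>)
  note vH = lin_map_closed[OF v(1)]
  have v_eval: "lin_map S Q0 (regular_module S) (\<lambda>q. v q p)" if "p \<in> carrier P1" for p
    using lin_map_comp[OF v(1) hom_to_ring_eval[OF that, of \<Lambda>, folded S]] .
  define v' where "v' p = (\<lambda>q\<in>carrier Q0. v q p)" for p
  have v'C: "v' p \<in> carrier ?C0" if "p \<in> carrier P1" for p
    unfolding v'_def by (rule hom_to_ringI[OF DQ0(1) v_eval[OF that]])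
  have v': "lin_map \<Lambda> P1 ?C0 v'"
  proof (rule lin_mapI)
    fix p p' assume p: "p \<in> carrier P1" "p' \<in> carrier P1"
    show "v' (p \<oplus>\<^bsub>P1\<^esub> p') = v' p \<oplus>\<^bsub>?C0\<^esub> v' p'"
      using p lin_map_add[OF hom_to_ring_lin_map[OF vH]]
      by (auto simp: v'_def hom_to_ring_simps(2-) S)
  next
    fix a p assume p: "a \<in> carrier \<Lambda>" "p \<in> carrier P1"
    show "v' (a \<odot>\<^bsub>P1\<^esub> p) = a \<odot>\<^bsub>?C0\<^esub> v' p"
      using p lin_map_smult[OF hom_to_ring_lin_map[OF vH]]
      by (auto simp: v'_def hom_to_ring_simps(2-) S)
  qed (rule v'C)
  let ?\<xi> = "\<lambda>m. restrict (\<xi> m) (carrier P1)"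
  have \<xi>H: "?\<xi> m \<in> carrier ?H1" if "m < n1" for m by (rule hom_to_ringI[OF DP1(1) DP1(3)[OF that]])
  \<comment> \<open>Preimages in Q0 of the classes of the coordinate functionals. They define the
    comparison map u in the other direction, taking g to the sum of g (x m) r m; by
    \<open>\<pi>_lincomb\<close> it lies over T.\<close>
  have "\<forall>m. \<exists>r. m < n1 \<longrightarrow> r \<in> carrier Q0 \<and> \<pi> r = ?c (?\<xi> m)"
  proof
    fix m
    show "\<exists>r. m < n1 \<longrightarrow> r \<in> carrier Q0 \<and> \<pi> r = ?c (?\<xi> m)"
    proof (cases "m < n1")
      case True
      then have "?c (?\<xi> m) \<in> \<pi> ` carrier Q0" using \<xi>H[OF True] c.closed \<pi>(2) by blast
      then show ?thesis by auto
    qed simp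
  qed
  then obtain r where r: "\<And>m. m < n1 \<Longrightarrow> r m \<in> carrier Q0" "\<And>m. m < n1 \<Longrightarrow> \<pi> (r m) = ?c (?\<xi> m)"
    by metis
  have \<pi>_lincomb: "\<pi> (lincomb Q0 n1 r (\<lambda>m. g (x m))) = ?c g" if g: "g \<in> carrier ?H1" for g
  proof -
    have gx: "g (x m) \<in> carrier S" if "m < n1" for m
      using hom_to_ring_closed[OF g DP1(2)[OF that]] by (simp add: S)
    have "\<pi> (lincomb Q0 n1 r (\<lambda>m. g (x m))) = lincomb T n1 (\<lambda>m. \<pi> (r m)) (\<lambda>m. g (x m))"
      by (rule lin_map_lincomb[OF \<pi>.lin_axioms]) (use r gx in auto)
    also have "\<dots> = lincomb T n1 (\<lambda>m. ?c (?\<xi> m)) (\<lambda>m. g (x m))"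
      by (rule lincomb_cong[OF c(1)]) (use r gx \<xi>H in auto)
    also have "\<dots> = ?c (lincomb ?H1 n1 ?\<xi> (\<lambda>m. g (x m)))"
      by (rule lin_map_lincomb[OF c.lin_axioms, symmetric]) (use \<xi>H gx in auto)
    also have "lincomb ?H1 n1 ?\<xi> (\<lambda>m. g (x m)) = g"
      by (rule dual_basisD(5)[OF dual_basis_dual[OF P1] g])
    finally show ?thesis .
  qed
  define uv where "uv q = lincomb Q0 n1 r (\<lambda>m. v q (x m))" for q
  have uv: "lin_map S Q0 Q0 uv"
    unfolding uv_def
    by (rule lin_map_finsum[OF DQ0(1)]) (use v_eval DP1(2) r(1) in \<open>auto intro!: lin_map_smult_elem[OF DQ0(1)]\<close>)
  interpret uv: lin S Q0 Q0 uv by (intro linI DQ0 uv)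
  have \<pi>uv: "\<pi> (uv q) = \<pi> q" if "q \<in> carrier Q0" for q
    using \<pi>_lincomb[OF vH[OF that]] v(2)[OF that] by (simp add: uv_def)
  have diff: "lin_map S Q0 Q0 (\<lambda>q. uv q \<ominus>\<^bsub>Q0\<^esub> q)"
    by (intro lin_map_minus[OF DQ0(1)] uv lin_map_id)
  \<comment> \<open>The composite uv and the identity both lie over T, so they differ by a homotopy
    s into Q1.\<close>
  obtain s where s: "lin_map S Q0 Q1 s" "\<And>q. q \<in> carrier Q0 \<Longrightarrow> \<delta> (s q) = uv q \<ominus>\<^bsub>Q0\<^esub> q"
  proof (rule dual_basis_lift[OF Q0 Q1 DQ0(1) \<delta> diff])
    show "uv (q0 i) \<ominus>\<^bsub>Q0\<^esub> q0 i \<in> \<delta> ` carrier Q1" if "i < k" for i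
      unfolding exact using DQ0(2)[OF that] \<pi>uv
      by (simp add: \<pi>.a_kernel_iff \<pi>.minus uv.closed) (simp add: a_minus_def c.N.M.r_neg)
  qed (rule that)
  \<comment> \<open>Boundaries vanish in T, so v (\<delta> q) factors through d. Hence v' p vanishes
    on the image of \<delta> whenever d p = 0, and EXT applies to f composed with v'.\<close>
  obtain h where h: "lin_map \<Lambda> P0 X h" "\<And>p. p \<in> carrier P1 \<Longrightarrow> f (v' p) = h (d p)"
  proof -
    have "f (v' p) = \<zero>\<^bsub>X\<^esub>" if p: "p \<in> carrier P1" "d p = \<zero>\<^bsub>P0\<^esub>" for p
    proof (rule kill[OF v'C[OF p(1)]])
      fix q assume q: "q \<in> carrier Q1"
      have "v (\<delta> q) \<in> ?B"
        using c(4)[of "v (\<delta> q)"] v(2)[of "\<delta> q"] \<pi>\<delta>[OF q] vH[of "\<delta> q"] \<delta>.closed[OF q] by simp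
      then obtain g where g: "g \<in> carrier ?H0" "v (\<delta> q) = compose (carrier P1) g d" by blast
      interpret g: lin \<Lambda> P0 "regular_module \<Lambda>" g by (intro linI DP0 reg hom_to_ring_lin_map g)
      show "v' p (\<delta> q) = \<zero>\<^bsub>\<Lambda>\<^esub>" using g(2) g.zero p \<delta>.closed[OF q] by (simp add: v'_def compose_def)
    qed
    from EXT[OF lin_map_comp[OF v' f] this] show ?thesis by (auto intro: that)
  qed
  interpret h: lin \<Lambda> P0 X h by (intro linI DP0 X h)
  interpret f: lin \<Lambda> ?C0 X f by (intro linI C0 X f)
  \<comment> \<open>The lift of u to the next degree: the functional \<eta> l composed with d has
    class zero in T, so u sends it to the image of some \<sigma> l under \<delta>.\<close>
  have "\<forall>l. \<exists>s. l < n0 \<longrightarrow> s \<in> carrier Q1 \<and> \<delta> s = lincomb Q0 n1 r (\<lambda>m. \<eta> l (d (x m)))"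
  proof
    fix l
    show "\<exists>s. l < n0 \<longrightarrow> s \<in> carrier Q1 \<and> \<delta> s = lincomb Q0 n1 r (\<lambda>m. \<eta> l (d (x m)))"
    proof (cases "l < n0")
      case True
      let ?\<eta> = "restrict (\<eta> l) (carrier P0)"
      let ?g = "compose (carrier P1) ?\<eta> d"
      have "?\<eta> \<in> carrier ?H0" by (rule hom_to_ringI[OF DP0(1) DP0(3)[OF True]])
      then have gB: "?g \<in> ?B" by blast
      have g: "?g \<in> carrier ?H1" using H1.submoduleD(1)[OF B] gB by blast
      have \<eta>S: "\<eta> l (d (x m)) \<in> carrier S" if "m < n1" for m
        using DP0(4)[OF True d.closed[OF DP1(2)[OF that]]] by (simp add: S)
      have eq: "lincomb Q0 n1 r (\<lambda>m. ?g (x m)) = lincomb Q0 n1 r (\<lambda>m. \<eta> l (d (x m)))"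
        by (rule lincomb_cong[OF DQ0(1)]) (use r \<eta>S DP1(2) in \<open>auto simp: compose_def\<close>)
      have "\<pi> (lincomb Q0 n1 r (\<lambda>m. \<eta> l (d (x m)))) = \<zero>\<^bsub>T\<^esub>"
        using \<pi>_lincomb[OF g] c(4)[OF g] gB unfolding eq by simp
      then show ?thesis
        using lift\<delta>[OF lincomb_closed[OF DQ0(1), of n1 r "\<lambda>m. \<eta> l (d (x m))"]] r(1) \<eta>S by metis
    qed simp
  qed
  then obtain \<sigma> where \<sigma>: "\<And>l. l < n0 \<Longrightarrow> \<sigma> l \<in> carrier Q1"
    "\<And>l. l < n0 \<Longrightarrow> \<delta> (\<sigma> l) = lincomb Q0 n1 r (\<lambda>m. \<eta> l (d (x m)))"
    by metis
  \<comment> \<open>The transpose of the lift just found, from the dual of Q1 to P0.\<close>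
  define \<kappa> where "\<kappa> w = lincomb P0 n0 y (\<lambda>l. w (\<sigma> l))" for w
  have \<kappa>: "lin_map \<Lambda> ?C1 P0 \<kappa>"
    unfolding \<kappa>_def
    by (rule lin_map_finsum[OF DP0(1)])
      (use hom_to_ring_eval[of _ Q1 S, unfolded SS] \<sigma>(1) DP0(2) in \<open>auto intro!: lin_map_smult_elem[OF DP0(1)]\<close>)
  have cs: "lin_map \<Lambda> ?C1 ?C0 (\<lambda>w. compose (carrier Q0) w s)"
    using hom_to_ring_comp[OF DQ0(1) s(1)] unfolding SS .
  have c\<delta>: "lin_map \<Lambda> ?C0 ?C1 (\<lambda>w. compose (carrier Q1) w \<delta>)"
    using hom_to_ring_comp[OF Q1 \<delta>] unfolding SS .
  show ?thesis
  proof (intro exI conjI ballI)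
    \<comment> \<open>The functional w composed with u is evaluation at some z in P1, so v' z is w
      composed with uv, that is, w plus the homotopy term. Therefore f w is h (d z) minus f of the
      homotopy term, and both depend on w only through w composed with \<delta>.\<close>
    show "lin_map \<Lambda> ?C1 X (\<lambda>w. h (\<kappa> w) \<ominus>\<^bsub>X\<^esub> f (compose (carrier Q0) w s))"
      by (intro lin_map_minus[OF X] lin_map_comp[OF \<kappa> h(1)] lin_map_comp[OF cs f])
    fix w assume w: "w \<in> carrier ?C0"
    interpret w: lin S Q0 "regular_module S" w by (intro linI DQ0 regS hom_to_ring_lin_map w)
    let ?w1 = "compose (carrier Q1) w \<delta>"
    have w1: "?w1 \<in> carrier ?C1" by (rule lin_map_closed[OF c\<delta> w])
    have wr: "w (r m) \<in> carrier \<Lambda>" if "m < n1" for m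
      using hom_to_ring_closed[OF w r(1)[OF that]] by (simp add: S)
    define z where "z = lincomb P1 n1 x (\<lambda>m. w (r m))"
    have z: "z \<in> carrier P1" unfolding z_def by (rule lincomb_closed[OF DP1(1)]) (use DP1(2) wr in auto)
    have transfer: "w (lincomb Q0 n1 r (\<lambda>m. g (x m))) = g z" if g: "lin_map \<Lambda> P1 (regular_module \<Lambda>) g" for g
    proof -
      interpret g: lin \<Lambda> P1 "regular_module \<Lambda>" g by (intro linI DP1 reg g)
      have "w (lincomb Q0 n1 r (\<lambda>m. g (x m))) = lincomb (regular_module S) n1 (\<lambda>m. w (r m)) (\<lambda>m. g (x m))"
        by (rule lin_map_lincomb[OF w.lin_axioms]) (use r g.closed DP1(2) in \<open>auto simp: S\<close>)
      also have "\<dots> = lincomb (regular_module \<Lambda>) n1 (\<lambda>m. g (x m)) (\<lambda>m. w (r m))" by (simp add: S)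
      also have "\<dots> = g z"
        unfolding z_def by (rule lin_map_lincomb[OF g.lin_axioms, symmetric]) (use DP1(2) wr in auto)
      finally show ?thesis .
    qed
    have "\<kappa> ?w1 = lincomb P0 n0 y (\<lambda>l. \<eta> l (d z))"
      unfolding \<kappa>_def
    proof (rule lincomb_cong[OF DP0(1)])
      fix l assume l: "l < n0"
      show "?w1 (\<sigma> l) = \<eta> l (d z)"
        using transfer[OF lin_map_comp[OF d DP0(3)[OF l]]] \<sigma>[OF l] by (simp add: compose_def)
    qed (use DP0(2,4) d.closed[OF z] in auto)
    then have \<kappa>w: "h (\<kappa> ?w1) = f (v' z)" using DP0(5)[OF d.closed[OF z]] h(2)[OF z] by simp
    let ?ws = "compose (carrier Q0) ?w1 s"
    have ws: "?ws \<in> carrier ?C0" by (rule lin_map_closed[OF cs w1])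
    have "v' z = ?ws \<oplus>\<^bsub>?C0\<^esub> w"
    proof (rule hom_to_ring_eqI[OF v'C[OF z] f.M.M.a_closed[OF ws w]])
      fix q assume q: "q \<in> carrier Q0"
      have "v' z q = w (uv q)"
        using transfer[OF hom_to_ring_lin_map[OF vH[OF q]]] q by (simp add: v'_def uv_def)
      also have "uv q = \<delta> (s q) \<oplus>\<^bsub>Q0\<^esub> q"
        using q s(2) by (simp add: \<pi>.M.add_diff(1) \<pi>.M.M.a_comm)
      also have "w \<dots> = ?ws q \<oplus>\<^bsub>S\<^esub> w q"
        using q lin_map_closed[OF s(1) q] by (simp add: w.add compose_def)
      also have "\<dots> = (?ws \<oplus>\<^bsub>?C0\<^esub> w) q" using q by (simp add: hom_to_ring_simps(2-))
      finally show "v' z q = (?ws \<oplus>\<^bsub>?C0\<^esub> w) q" .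
    qed
    then have "h (\<kappa> ?w1) = f ?ws \<oplus>\<^bsub>X\<^esub> f w" using \<kappa>w f.add[OF ws w] by simp
    then show "f w = h (\<kappa> ?w1) \<ominus>\<^bsub>X\<^esub> f ?ws" using f.closed ws w by (simp add: X.add_diff(2))
  qed
qed


section \<open>Dimension shifting\<close>

text \<open>The acyclicity of Hom(C, P) for projective P. The coordinates \<xi> m reduce P to
  \<Lambda>. A map from the dual of Q to \<Lambda> is evaluation at some p in Q by reflexivity;
  killing the coboundaries forces \<delta> p = 0, as functionals separate points of Q', and
  exactness gives p = \<delta>'' s. Evaluation at s is the wanted factor.\<close>

lemma dual_complex_exact:
  fixes P :: "('a, 'p) module"
  assumes P: "dual_basis \<Lambda> P n x \<xi>" and S: "S = opposite_ring \<Lambda>"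
    and Q: "dual_basis S Q k q w" "dual_basis S Q' k' q' w'" "left_module S Q''"
    and \<delta>: "lin_map S Q Q' \<delta>" "lin_map S Q'' Q \<delta>''" "\<delta>'' ` carrier Q'' = a_kernel Q Q' \<delta>"
    and g: "lin_map \<Lambda> (hom_to_ring S Q) P g"
    and kill: "\<And>w. w \<in> carrier (hom_to_ring S Q') \<Longrightarrow> g (compose (carrier Q) w \<delta>) = \<zero>\<^bsub>P\<^esub>"
  obtains h where "lin_map \<Lambda> (hom_to_ring S Q'') P h"
    "\<And>w. w \<in> carrier (hom_to_ring S Q) \<Longrightarrow> g w = h (compose (carrier Q'') w \<delta>'')"
proof -
  note DP = dual_basisD[OF P] and DQ = dual_basisD[OF Q(1)] and DQ' = dual_basisD[OF Q(2)]
  have SS: "opposite_ring S = \<Lambda>" by (simp add: S)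
  interpret \<delta>: lin S Q Q' \<delta> by (intro linI DQ DQ' \<delta>)
  interpret P: left_module \<Lambda> P by (rule DP)
  have reg: "left_module \<Lambda> (regular_module \<Lambda>)" by (rule regular_left_module[OF P.R.ring_axioms])
  have regS: "left_module S (regular_module S)" by (rule regular_left_module[OF \<delta>.M.R.ring_axioms])
  have "\<exists>s\<in>carrier Q''. \<forall>w\<in>carrier (hom_to_ring S Q). \<xi> m (g w) = w (\<delta>'' s)" if m: "m < n" for m
  proof -
    interpret \<xi>: lin \<Lambda> P "regular_module \<Lambda>" "\<xi> m" by (intro linI DP reg m)
    have "lin_map (opposite_ring S) (hom_to_ring S Q) (regular_module (opposite_ring S)) (\<lambda>w. \<xi> m (g w))"
      unfolding SS by (rule lin_map_comp[OF g \<xi>.map])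
    then obtain p where p: "p \<in> carrier Q" "\<And>w. w \<in> carrier (hom_to_ring S Q) \<Longrightarrow> \<xi> m (g w) = w p"
      using dual_basis_reflexive[OF Q(1)] by blast
    have "\<delta> p = \<zero>\<^bsub>Q'\<^esub>"
    proof (rule dual_basis_separates[OF Q(2) \<delta>.closed[OF p(1)] \<delta>.N.M.zero_closed])
      fix w assume w: "w \<in> carrier (hom_to_ring S Q')"
      interpret w: lin S Q' "regular_module S" w by (intro linI DQ' regS hom_to_ring_lin_map w)
      have "compose (carrier Q) w \<delta> \<in> carrier (hom_to_ring S Q)"
        by (rule lin_map_closed[OF hom_to_ring_comp[OF DQ(1) \<delta>(1)] w])
      from p(2)[OF this] have "w (\<delta> p) = \<xi> m \<zero>\<^bsub>P\<^esub>" using p(1) kill[OF w] by (simp add: compose_def)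
      then show "w (\<delta> p) = w \<zero>\<^bsub>Q'\<^esub>" using w.zero \<xi>.zero by (simp add: S)
    qed
    then have "p \<in> \<delta>'' ` carrier Q''" using p(1) unfolding \<delta>(3) by (simp add: \<delta>.a_kernel_iff)
    then show ?thesis using p(2) by auto
  qed
  then obtain s where s: "\<And>m. m < n \<Longrightarrow> s m \<in> carrier Q''"
    "\<And>m w. m < n \<Longrightarrow> w \<in> carrier (hom_to_ring S Q) \<Longrightarrow> \<xi> m (g w) = w (\<delta>'' (s m))"
    by metis
  show ?thesis
  proof (rule that)
    show "lin_map \<Lambda> (hom_to_ring S Q'') P (\<lambda>w. lincomb P n x (\<lambda>m. w (s m)))"
      by (rule lin_map_finsum[OF DP(1)])
        (use hom_to_ring_eval[of _ Q'' S, unfolded SS] s(1) DP(2) in \<open>auto intro!: lin_map_smult_elem[OF DP(1)]\<close>)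
    fix w assume w: "w \<in> carrier (hom_to_ring S Q)"
    have "lincomb P n x (\<lambda>m. compose (carrier Q'') w \<delta>'' (s m)) = lincomb P n x (\<lambda>m. \<xi> m (g w))"
      by (rule lincomb_cong[OF DP(1)])
        (auto simp: compose_def s(1) s(2)[OF _ w, symmetric] DP(2,4) lin_map_closed[OF g w])
    then show "g w = lincomb P n x (\<lambda>m. compose (carrier Q'') w \<delta>'' (s m))"
      using DP(5)[OF lin_map_closed[OF g w]] by simp
  qed
qed

text \<open>
  With \<open>C\<close> the dual of \<open>Q\<close>, this says for \<open>j > 0\<close> that the complex \<open>Hom(C, X)\<close> has no homology
  at \<open>Hom(C j, X)\<close>.  For \<open>j = 0\<close> the hypothesis is that \<open>f\<close> kills the kernel of \<open>C 0 \<rightarrow> C 1\<close>, as it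
  does whenever it factors through \<open>C 1\<close> after composition with an embedding of \<open>X\<close>.
\<close>

definition dual_factors ::
  "'a ring \<Rightarrow> (nat \<Rightarrow> ('a, 'q) module) \<Rightarrow> (nat \<Rightarrow> 'q \<Rightarrow> 'q) \<Rightarrow> nat \<Rightarrow> ('a, 'x) module \<Rightarrow> bool" where
  "dual_factors \<Lambda> Q \<delta> j X \<longleftrightarrow>
    (let C = (\<lambda>i. hom_to_ring (opposite_ring \<Lambda>) (Q i));
         D = (\<lambda>i w. compose (carrier (Q (Suc i))) w (\<delta> (Suc i)))
     in \<forall>f. lin_map \<Lambda> (C j) X f \<longrightarrow>
      (case j of 0 \<Rightarrow> \<forall>w\<in>carrier (C 0). D 0 w = \<zero>\<^bsub>C 1\<^esub> \<longrightarrow> f w = \<zero>\<^bsub>X\<^esub>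
        | Suc i \<Rightarrow> \<forall>w\<in>carrier (C i). f (D i w) = \<zero>\<^bsub>X\<^esub>) \<longrightarrow>
      (\<exists>g. lin_map \<Lambda> (C (Suc j)) X g \<and> (\<forall>w\<in>carrier (C j). f w = g (D j w))))"

text \<open>A map f killing the coboundaries lifts to \<phi> with values in P. Composed with D j,
  \<phi> lands in the kernel of s, and the hypothesis for j writes this composite as \<chi> after D
  j with \<chi> into that kernel. Then \<phi> - \<chi> kills the coboundaries, factors by
  \<open>dual_complex_exact\<close>, and still lifts f.\<close>

lemma dual_factors_step:
  fixes P :: "('a, 'p) module" and Q :: "nat \<Rightarrow> ('a, 'q) module"
  assumes P: "dual_basis \<Lambda> P n x \<xi>" and K: "left_module \<Lambda> K"
    and s: "lin_map \<Lambda> P K s" "s ` carrier P = carrier K"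
    and Q: "proj_resolution (opposite_ring \<Lambda>) Q \<delta> e T"
    and IH: "dual_factors \<Lambda> Q \<delta> j (P\<lparr>carrier := a_kernel P K s\<rparr>)"
  shows "dual_factors \<Lambda> Q \<delta> (Suc j) K"
proof -
  define S where "S = opposite_ring \<Lambda>"
  have SS: "opposite_ring S = \<Lambda>" by (simp add: S_def)
  define C where "C i = hom_to_ring S (Q i)" for i
  define D where "D i w = compose (carrier (Q (Suc i))) w (\<delta> (Suc i))" for i and w :: "'q \<Rightarrow> 'a"
  note R = proj_resolutionD[OF Q, folded S_def] and dd = proj_resolution_dd[OF Q]
  note DP = dual_basisD[OF P]
  interpret s: lin \<Lambda> P K s by (intro linI DP K s)
  let ?L = "P\<lparr>carrier := a_kernel P K s\<rparr>"
  have L: "left_module \<Lambda> ?L" by (rule s.M.submodule_left_module[OF s.submodule_kernel])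
  have C: "left_module \<Lambda> (C i)" for i
    unfolding C_def using hom_to_ring_left_module[OF R(3), of i] unfolding SS .
  have D: "lin \<Lambda> (C i) (C (Suc i)) (D i)" for i
    unfolding C_def D_def[abs_def] using hom_to_ring_comp[OF R(3,4), of i] unfolding SS
    by (intro linI) (use C in \<open>auto simp: C_def\<close>)
  have DD: "D (Suc i) (D i w) = \<zero>\<^bsub>C (Suc (Suc i))\<^esub>" if w: "w \<in> carrier (C i)" for i w
  proof -
    interpret w: lin S "Q i" "regular_module S" w
      using w by (intro linI R(3) regular_left_module left_module.axioms(1)[OF R(3)] hom_to_ring_lin_map) (simp add: C_def)
    show ?thesis
      using w.zero lin_map_closed[OF R(4)] dd
      by (auto simp: D_def C_def hom_to_ring_simps compose_def fun_eq_iff)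
  qed
  have db: "\<exists>k q w. dual_basis S (Q i) k q w" for i
    using projective_dual_basis[OF R(1,2)] by metis
  show ?thesis
    unfolding dual_factors_def Let_def S_def[symmetric] C_def[symmetric] D_def[symmetric] nat.case
  proof (intro allI impI)
    fix f assume f: "lin_map \<Lambda> (C (Suc j)) K f" and kill: "\<forall>w\<in>carrier (C j). f (D j w) = \<zero>\<^bsub>K\<^esub>"
    obtain k q w0 where Qj: "dual_basis S (Q (Suc j)) k q w0" using db by blast
    obtain k' q' w0' where Qj': "dual_basis S (Q j) k' q' w0'" using db by blast
    have dbC: "dual_basis \<Lambda> (C (Suc j)) k (\<lambda>i. restrict (w0 i) (carrier (Q (Suc j)))) (\<lambda>i f. f (q i))"
      using dual_basis_dual[OF Qj] unfolding SS C_def .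
    obtain \<phi> where \<phi>: "lin_map \<Lambda> (C (Suc j)) P \<phi>" "\<And>w. w \<in> carrier (C (Suc j)) \<Longrightarrow> s (\<phi> w) = f w"
      by (rule dual_basis_lift[OF dbC DP(1) K s(1) f])
        (use s(2) lin_map_closed[OF f dual_basisD(2)[OF dbC]] in \<open>auto intro: that\<close>)
    interpret \<phi>: lin \<Lambda> "C (Suc j)" P \<phi> by (intro linI C DP \<phi>)
    interpret D: lin \<Lambda> "C j" "C (Suc j)" "D j" by (rule D)
    have \<psi>: "lin_map \<Lambda> (C j) ?L (\<lambda>w. \<phi> (D j w))"
      by (rule lin_map_into_subset[OF lin_map_comp[OF D.map \<phi>(1)]]) (use kill \<phi>(2) in \<open>auto simp: s.a_kernel_iff\<close>)
    have "\<exists>\<chi>. lin_map \<Lambda> (C (Suc j)) ?L \<chi> \<and> (\<forall>w\<in>carrier (C j). \<phi> (D j w) = \<chi> (D j w))"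
    proof (rule IH[unfolded dual_factors_def Let_def, folded S_def, folded C_def, folded D_def, rule_format, OF \<psi>])
      \<comment> \<open>For j = 0 linearity suffices, as D 0 w = 0 makes \<phi> (D 0 w) zero. For
        later j the condition comes from D D = 0.\<close>
      show "case j of 0 \<Rightarrow> \<forall>w\<in>carrier (C 0). D 0 w = \<zero>\<^bsub>C 1\<^esub> \<longrightarrow> \<phi> (D j w) = \<zero>\<^bsub>?L\<^esub>
        | Suc i \<Rightarrow> \<forall>w\<in>carrier (C i). \<phi> (D j (D i w)) = \<zero>\<^bsub>?L\<^esub>"
        using DD \<phi>.zero by (cases j) auto
    qed
    then obtain \<chi> where \<chi>: "lin_map \<Lambda> (C (Suc j)) ?L \<chi>" "\<And>w. w \<in> carrier (C j) \<Longrightarrow> \<phi> (D j w) = \<chi> (D j w)"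
      by blast
    have \<chi>K: "\<chi> w \<in> carrier P" "s (\<chi> w) = \<zero>\<^bsub>K\<^esub>" if "w \<in> carrier (C (Suc j))" for w
      using lin_map_closed[OF \<chi>(1) that] by (simp_all add: s.a_kernel_iff)
    have \<chi>P: "lin_map \<Lambda> (C (Suc j)) P \<chi>"
      by (rule lin_map_from_subset[OF \<chi>(1)]) (auto simp: s.a_kernel_iff)
    have \<theta>: "lin_map \<Lambda> (C (Suc j)) P (\<lambda>w. \<phi> w \<ominus>\<^bsub>P\<^esub> \<chi> w)"
      by (rule lin_map_minus[OF DP(1) \<phi>(1) \<chi>P])
    have "\<phi> (D j w) \<ominus>\<^bsub>P\<^esub> \<chi> (D j w) = \<zero>\<^bsub>P\<^esub>" if w: "w \<in> carrier (C j)" for w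
      using \<chi>(2)[OF w, symmetric] \<phi>.closed[OF D.closed[OF w]] by (simp add: a_minus_def s.M.M.r_neg)
    then obtain \<rho> where \<rho>: "lin_map \<Lambda> (C (Suc (Suc j))) P \<rho>"
      "\<And>w. w \<in> carrier (C (Suc j)) \<Longrightarrow> \<phi> w \<ominus>\<^bsub>P\<^esub> \<chi> w = \<rho> (D (Suc j) w)"
      using dual_complex_exact[OF P S_def Qj Qj' R(3) R(4) R(4) R(8) \<theta>[unfolded C_def], folded C_def, folded D_def]
      by blast
    have "f w = s (\<rho> (D (Suc j) w))" if w: "w \<in> carrier (C (Suc j))" for w
    proof -
      have "s (\<phi> w \<ominus>\<^bsub>P\<^esub> \<chi> w) = f w"
        using s.minus[OF \<phi>.closed[OF w] \<chi>K(1)[OF w]] \<chi>K(2)[OF w] \<phi>(2)[OF w] lin_map_closed[OF f w]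
        by (simp add: a_minus_def)
      then show ?thesis using \<rho>(2)[OF w] by simp
    qed
    then show "\<exists>g. lin_map \<Lambda> (C (Suc (Suc j))) K g \<and> (\<forall>w\<in>carrier (C (Suc j)). f w = g (D (Suc j) w))"
      using lin_map_comp[OF \<rho>(1) s(1)] by blast
  qed
qed

text \<open>A map P1 -> X vanishing on the kernel of d factors through the image of d, which is the
  kernel of p, and extends from there to P0 since Ext^1 vanishes. The comparison of presentations
  carries this over to Q.\<close>

lemma dual_factors_transpose:
  fixes M :: "('a, 'm) module" and P1 :: "('a, 'p) module" and P0 :: "('a, 'q) module"
  assumes "artin_algebra R \<phi> \<Lambda>" "fg_module \<Lambda> M" and X: "left_module \<Lambda> X"
    and ext: "trivial_group (Ext \<Lambda> 1 M X)"
    and P1: "dual_basis \<Lambda> P1 n1 x \<xi>" and P0: "dual_basis \<Lambda> P0 n0 y \<eta>"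
    and d: "lin_map \<Lambda> P1 P0 d" "d ` carrier P1 = a_kernel P0 M p"
    and p: "lin_map \<Lambda> P0 M p" "p ` carrier P0 = carrier M"
    and Q: "proj_resolution (opposite_ring \<Lambda>) Q \<delta> \<pi> (quotient_module (hom_to_ring \<Lambda> P1)
      ((\<lambda>f. compose (carrier P1) f d) ` carrier (hom_to_ring \<Lambda> P0)))"
  shows "dual_factors \<Lambda> Q \<delta> 0 X"
proof -
  note DP1 = dual_basisD[OF P1] and DP0 = dual_basisD[OF P0] and R = proj_resolutionD[OF Q]
  have M: "left_module \<Lambda> M" using assms(2) fg_module_iff by blast
  interpret p: lin \<Lambda> P0 M p by (intro linI DP0 M p)
  let ?K = "P0\<lparr>carrier := a_kernel P0 M p\<rparr>"
  have K: "left_module \<Lambda> ?K" by (rule p.M.submodule_left_module[OF p.submodule_kernel])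
  have dK: "lin \<Lambda> P1 ?K d" by (intro linI DP1 K lin_map_into_subset d) (simp add: d(2))
  have EXT: "\<exists>h. lin_map \<Lambda> P0 X h \<and> (\<forall>u\<in>carrier P1. f u = h (d u))"
    if f: "lin_map \<Lambda> P1 X f" and kill: "\<And>u. u \<in> carrier P1 \<Longrightarrow> d u = \<zero>\<^bsub>P0\<^esub> \<Longrightarrow> f u = \<zero>\<^bsub>X\<^esub>" for f
  proof -
    obtain f' where f': "lin_map \<Lambda> ?K X f'" "\<And>u. u \<in> carrier P1 \<Longrightarrow> f' (d u) = f u"
      by (rule lin_map_factor[OF dK _ linI[OF DP1(1) X f]]) (use d(2) kill in \<open>auto intro: that\<close>)
    obtain h where "lin_map \<Lambda> P0 X h" "\<And>u. u \<in> a_kernel P0 M p \<Longrightarrow> h u = f' u"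
      using trivial_Ext1_extends[OF assms(1,2) X ext P0 p f'(1)] by blast
    then show ?thesis using f'(2) unfolding d(2)[symmetric] by (intro exI[of _ h]) simp
  qed
  obtain k q w where Q0: "dual_basis (opposite_ring \<Lambda>) (Q 0) k q w"
    using projective_dual_basis[OF R(1,2)] by metis
  show ?thesis
    unfolding dual_factors_def Let_def nat.case
  proof (intro allI impI)
    fix f assume f: "lin_map \<Lambda> (hom_to_ring (opposite_ring \<Lambda>) (Q 0)) X f"
      and kill: "\<forall>w\<in>carrier (hom_to_ring (opposite_ring \<Lambda>) (Q 0)).
        compose (carrier (Q (Suc 0))) w (\<delta> (Suc 0)) = \<zero>\<^bsub>hom_to_ring (opposite_ring \<Lambda>) (Q 1)\<^esub> \<longrightarrow>
        f w = \<zero>\<^bsub>X\<^esub>"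
    show "\<exists>g. lin_map \<Lambda> (hom_to_ring (opposite_ring \<Lambda>) (Q (Suc 0))) X g \<and>
      (\<forall>w\<in>carrier (hom_to_ring (opposite_ring \<Lambda>) (Q 0)).
        f w = g (compose (carrier (Q (Suc 0))) w (\<delta> (Suc 0))))"
    proof (rule factor_through_dual_presentation[OF P1 P0 d(1) X EXT refl Q0 R(3) refl R(4,5,6,7) f])
      fix w assume w: "w \<in> carrier (hom_to_ring (opposite_ring \<Lambda>) (Q 0))"
        and "\<And>q. q \<in> carrier (Q (Suc 0)) \<Longrightarrow> w (\<delta> (Suc 0) q) = \<zero>\<^bsub>\<Lambda>\<^esub>"
      then have "compose (carrier (Q (Suc 0))) w (\<delta> (Suc 0)) = \<zero>\<^bsub>hom_to_ring (opposite_ring \<Lambda>) (Q 1)\<^esub>"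
        by (auto simp: compose_def hom_to_ring_simps(2))
      then show "f w = \<zero>\<^bsub>X\<^esub>" using kill w by blast
    qed
  qed
qed

section \<open>Descent from a syzygy to the resolved module\<close>

lemma syzygy_left_module:
  assumes "proj_resolution \<Lambda> P d e M" shows "left_module \<Lambda> (syzygy P d (Suc k))"
  unfolding syzygy_def diff_Suc_1
  by (intro left_module.submodule_left_module lin.submodule_range linI proj_resolutionD[OF assms])

text \<open>Each shift lowers the index of the syzygy by one and raises the degree by one, so their
  sum stays constant; k varies along the induction for this reason.\<close>

lemma dual_factors_syzygy:
  assumes P: "proj_resolution \<Lambda> P d e M" and Q: "proj_resolution (opposite_ring \<Lambda>) Q \<delta> \<pi> T"
    and "dual_factors \<Lambda> Q \<delta> 0 (syzygy P d (Suc (k + l)))"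
  shows "dual_factors \<Lambda> Q \<delta> l (syzygy P d (Suc k))"
  using assms(3)
proof (induct l arbitrary: k)
  case (Suc l)
  note R = proj_resolutionD[OF P]
  have IH: "dual_factors \<Lambda> Q \<delta> l (syzygy P d (Suc (Suc k)))" using Suc by simp
  obtain n x \<xi> where db: "dual_basis \<Lambda> (P (Suc k)) n x \<xi>" using projective_dual_basis[OF R(1,2)] by metis
  have "a_kernel (P (Suc k)) (syzygy P d (Suc k)) (d (Suc k)) = d (Suc (Suc k)) ` carrier (P (Suc (Suc k)))"
    using R(8)[of k] by (simp add: syzygy_def a_kernel_def')
  then have eq: "syzygy P d (Suc (Suc k)) =
      (P (Suc k))\<lparr>carrier := a_kernel (P (Suc k)) (syzygy P d (Suc k)) (d (Suc k))\<rparr>"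
    by (simp add: syzygy_def)
  show ?case
  proof (rule dual_factors_step[OF db syzygy_left_module[OF P] _ _ Q IH[unfolded eq]])
    show "lin_map \<Lambda> (P (Suc k)) (syzygy P d (Suc k)) (d (Suc k))"
      unfolding syzygy_def diff_Suc_1 by (rule lin_map_into_subset[OF R(4)]) simp
  qed (simp add: syzygy_def)
qed simp

text \<open>The last shift goes along the augmentation P 0 -> M, whose kernel is the first
  syzygy.\<close>

lemma dual_factors_resolved:
  assumes P: "proj_resolution \<Lambda> P d e M" and Q: "proj_resolution (opposite_ring \<Lambda>) Q \<delta> \<pi> T"
    and M: "left_module \<Lambda> M" and 0: "dual_factors \<Lambda> Q \<delta> 0 (syzygy P d (Suc l))"
  shows "dual_factors \<Lambda> Q \<delta> (Suc l) M"
proof -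
  note R = proj_resolutionD[OF P]
  obtain n x \<xi> where db: "dual_basis \<Lambda> (P 0) n x \<xi>" using projective_dual_basis[OF R(1,2)] by metis
  have "dual_factors \<Lambda> Q \<delta> l (syzygy P d (Suc 0))"
    by (rule dual_factors_syzygy[OF P Q]) (simp add: 0)
  then have "dual_factors \<Lambda> Q \<delta> l ((P 0)\<lparr>carrier := a_kernel (P 0) M e\<rparr>)"
    using R(7) by (simp add: syzygy_def)
  then show ?thesis by (rule dual_factors_step[OF db M R(5,6) Q])
qed

text \<open>
  By the adjunction \<open>Hom\<^sub>\<Lambda>(C, D \<Lambda>) = Hom\<^sub>R(C, E)\<close>, a cocycle that is not a coboundary would be
  detected by a map into \<open>D \<Lambda>\<close> vanishing on the coboundaries.
\<close>

lemma dual_factors_coboundary: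
  fixes R :: "'r ring"
  assumes A: "artin_algebra R \<phi> \<Lambda>"
    and env: "injective_envelope R (quotient_module (regular_module R) (jacobson_radical R)) \<iota> E"
    and Q: "proj_resolution (opposite_ring \<Lambda>) Q \<delta> \<pi> T"
    and factors: "dual_factors \<Lambda> Q \<delta> (Suc j) (dual_regular R \<phi> E \<Lambda>)"
    and z: "z \<in> carrier (hom_to_ring (opposite_ring \<Lambda>) (Q (Suc j)))"
    and cocycle: "\<And>q. q \<in> carrier (Q (Suc (Suc j))) \<Longrightarrow> z (\<delta> (Suc (Suc j)) q) = \<zero>\<^bsub>\<Lambda>\<^esub>"
  shows "\<exists>u\<in>carrier (hom_to_ring (opposite_ring \<Lambda>) (Q j)). z = compose (carrier (Q (Suc j))) u (\<delta> (Suc j))"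
proof (rule ccontr)
  assume not_coboundary: "\<not> ?thesis"
  note AD = artin_algebraD[OF A] and QD = proj_resolutionD[OF Q]
  let ?S = "opposite_ring \<Lambda>"
  let ?C = "\<lambda>i. hom_to_ring ?S (Q i)" and ?D = "\<lambda>i w. compose (carrier (Q (Suc i))) w (\<delta> (Suc i))"
  let ?r = "restrict_scalars \<phi>"
  have C: "left_module \<Lambda> (?C i)" for i using hom_to_ring_left_module[OF QD(3), of i] by simp
  have D: "lin \<Lambda> (?C i) (?C (Suc i)) (?D i)" for i
    using hom_to_ring_comp[OF QD(3,4), of i] C by (intro linI) simp_all
  interpret D: lin \<Lambda> "?C j" "?C (Suc j)" "?D j" by (rule D)
  have rC: "left_module R (?r (?C i))" for i by (rule restrict_scalars_left_module[OF C AD(3,5)])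
  let ?B = "?D j ` carrier (?C j)"
  obtain k q w where "dual_basis ?S (Q (Suc j)) k q w" using projective_dual_basis[OF QD(1,2)] by metis
  then have "fg_module \<Lambda> (?C (Suc j))" using dual_basis_fg[OF dual_basis_dual] by fastforce
  then have fg: "fg_module R (?r (?C (Suc j)))"
    by (rule fg_module_restrict_scalars[OF _ AD(3,5,7)])
  have B: "submodule ?B R (?r (?C (Suc j)))"
    by (rule submodule_restrict_scalars[OF C AD(3,5) D.submodule_range])
  \<comment> \<open>The cogenerator E separates z from the coboundaries, but only by a map linear
    over R.\<close>
  obtain \<psi> where \<psi>: "lin_map R (?r (?C (Suc j))) E \<psi>" "\<psi> z \<noteq> \<zero>\<^bsub>E\<^esub>" "\<And>b. b \<in> ?B \<Longrightarrow> \<psi> b = \<zero>\<^bsub>E\<^esub>"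
    by (rule injective_envelope_cogenerates[OF AD(1) env fg B, of z])
      (use z not_coboundary in \<open>auto intro: that\<close>)
  have E: "left_module R E" using env by (simp add: injective_envelope_def injective_module_def)
  interpret \<psi>: lin R "?r (?C (Suc j))" E \<psi> by (intro linI rC E \<psi>(1))
  let ?DL = "dual_regular R \<phi> E \<Lambda>"
  have opp: "artin_algebra R \<phi> ?S" by (rule artin_algebra_opposite[OF A])
  note OD = artin_algebraD[OF opp]
  have regS: "left_module ?S (regular_module ?S)" by (rule regular_left_module[OF OD(4)])
  have rreg: "left_module R (?r (regular_module ?S))" by (rule restrict_scalars_left_module[OF regS OD(3,5)])
  \<comment> \<open>The adjoint of \<psi>, linear over \<Lambda> with values in D \<Lambda>;
    evaluation at 1 recovers \<psi>.\<close>
  define \<Psi> where "\<Psi> w = (\<lambda>a\<in>carrier \<Lambda>. \<psi> (a \<odot>\<^bsub>?C (Suc j)\<^esub> w))" for w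
  have \<phi>c: "\<phi> r \<in> carrier \<Lambda>" if "r \<in> carrier R" for r using AD(5) that by (auto simp: ring_hom_def)
  have \<Psi>: "lin_map \<Lambda> (?C (Suc j)) ?DL \<Psi>"
  proof (rule lin_mapI)
    fix w assume w: "w \<in> carrier (?C (Suc j))"
    have "lin_map R (?r (regular_module ?S)) E (\<lambda>a. \<psi> (a \<odot>\<^bsub>?C (Suc j)\<^esub> w))"
    proof (rule lin_mapI)
      fix r a assume ra: "r \<in> carrier R" "a \<in> carrier (?r (regular_module ?S))"
      then have a: "a \<in> carrier \<Lambda>" by simp
      have "(a \<otimes>\<^bsub>\<Lambda>\<^esub> \<phi> r) \<odot>\<^bsub>?C (Suc j)\<^esub> w = \<phi> r \<odot>\<^bsub>?C (Suc j)\<^esub> (a \<odot>\<^bsub>?C (Suc j)\<^esub> w)"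
        using AD(6)[OF ra(1) a, symmetric] D.N.smult_assoc[OF \<phi>c[OF ra(1)] a w] by simp
      then show "\<psi> ((r \<odot>\<^bsub>?r (regular_module ?S)\<^esub> a) \<odot>\<^bsub>?C (Suc j)\<^esub> w) = r \<odot>\<^bsub>E\<^esub> \<psi> (a \<odot>\<^bsub>?C (Suc j)\<^esub> w)"
        using \<psi>.smult[OF ra(1), of "a \<odot>\<^bsub>?C (Suc j)\<^esub> w"] D.N.smult_closed[OF a w] by simp
    next
      fix a b assume ab: "a \<in> carrier (?r (regular_module ?S))" "b \<in> carrier (?r (regular_module ?S))"
      then show "\<psi> ((a \<oplus>\<^bsub>?r (regular_module ?S)\<^esub> b) \<odot>\<^bsub>?C (Suc j)\<^esub> w) =
          \<psi> (a \<odot>\<^bsub>?C (Suc j)\<^esub> w) \<oplus>\<^bsub>E\<^esub> \<psi> (b \<odot>\<^bsub>?C (Suc j)\<^esub> w)"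
        using w \<psi>.add[of "a \<odot>\<^bsub>?C (Suc j)\<^esub> w" "b \<odot>\<^bsub>?C (Suc j)\<^esub> w"] by (simp add: D.N.smult_l_distr)
    next
      show "\<psi> (a \<odot>\<^bsub>?C (Suc j)\<^esub> w) \<in> carrier E" if "a \<in> carrier (?r (regular_module ?S))" for a
        using \<psi>.closed that D.N.smult_closed[OF _ w] by simp
    qed
    from restrict_lmod_hom[OF rreg this] show "\<Psi> w \<in> carrier ?DL"
      by (simp add: dual_regular_def dual_module_simps \<Psi>_def)
    show "\<Psi> (a \<odot>\<^bsub>?C (Suc j)\<^esub> w) = a \<odot>\<^bsub>?DL\<^esub> \<Psi> w" if "a \<in> carrier \<Lambda>" for a
      using that w monoid.m_closed[OF ring.is_monoid[OF AD(4)]]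
      by (auto simp: dual_regular_def dual_module_simps \<Psi>_def D.N.smult_assoc intro!: restrict_ext)
    fix w' assume w': "w' \<in> carrier (?C (Suc j))"
    show "\<Psi> (w \<oplus>\<^bsub>?C (Suc j)\<^esub> w') = \<Psi> w \<oplus>\<^bsub>?DL\<^esub> \<Psi> w'"
      using w w' \<psi>.add
      by (auto simp: dual_regular_def dual_module_simps \<Psi>_def fun_eq_iff D.N.smult_r_distr)
  qed
  \<comment> \<open>Coboundaries are stable under \<Lambda>, so \<psi> also vanishes on all
    multiples a (D w).\<close>
  have "\<Psi> (?D j w) = \<zero>\<^bsub>?DL\<^esub>" if w: "w \<in> carrier (?C j)" for w
  proof -
    have "\<psi> (a \<odot>\<^bsub>?C (Suc j)\<^esub> ?D j w) = \<zero>\<^bsub>E\<^esub>" if a: "a \<in> carrier \<Lambda>" for a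
      unfolding D.smult[OF a w, symmetric] using w a by (intro \<psi>(3) imageI) simp
    then show ?thesis by (auto simp: \<Psi>_def dual_regular_def dual_module_simps)
  qed
  then obtain \<chi> where \<chi>: "lin_map \<Lambda> (?C (Suc (Suc j))) ?DL \<chi>"
    "\<And>w. w \<in> carrier (?C (Suc j)) \<Longrightarrow> \<Psi> w = \<chi> (?D (Suc j) w)"
    using factors[unfolded dual_factors_def Let_def nat.case] \<Psi> by blast
  have DL: "left_module \<Lambda> ?DL"
    using dual_module_left_module[OF regS E OD(5,6)] by (simp add: dual_regular_def)
  interpret \<chi>: lin \<Lambda> "?C (Suc (Suc j))" ?DL \<chi> by (intro linI C DL \<chi>)
  \<comment> \<open>As z is a cocycle, \<Psi> z is zero, because \<Psi> factors through the
    differential; evaluated at 1 this contradicts the choice of \<psi>.\<close>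
  have "?D (Suc j) z = \<zero>\<^bsub>?C (Suc (Suc j))\<^esub>"
    using cocycle by (auto simp: hom_to_ring_simps(2) compose_def)
  then have "\<Psi> z = \<zero>\<^bsub>?DL\<^esub>" using \<chi>(2)[OF z] \<chi>.zero by simp
  then have "\<Psi> z \<one>\<^bsub>\<Lambda>\<^esub> = \<zero>\<^bsub>E\<^esub>" by (simp add: dual_regular_def dual_module_simps)
  then show False using \<psi>(2) D.N.smult_one[OF z] by (simp add: \<Psi>_def)
qed

section \<open>Conclusion for the chosen presentation and resolution\<close>

lemma some_minimal_proj_presentation:
  fixes M :: "('a, 'm) module"
  assumes "artin_algebra R \<phi> \<Lambda>" "fg_module \<Lambda> M"
  obtains P1 d P0 e where "some_minimal_proj_presentation \<Lambda> M = (P1, d, P0, e)"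
    "minimal_proj_presentation \<Lambda> P1 d P0 e M"
proof -
  obtain P1 :: "('a, nat \<Rightarrow> 'a) module" and d and P0 :: "('a, nat \<Rightarrow> 'a) module" and e
    where "minimal_proj_presentation \<Lambda> P1 d P0 e M"
    using minimal_proj_presentation_exists[OF assms] by metis
  then have "\<exists>r::('a, nat \<Rightarrow> 'a) module \<times> _ \<times> ('a, nat \<Rightarrow> 'a) module \<times> _.
      case r of (P1, d, P0, e) \<Rightarrow> minimal_proj_presentation \<Lambda> P1 d P0 e M"
    by (intro exI[of _ "(P1, d, P0, e)"]) simp
  from someI_ex[OF this]
  have "case some_minimal_proj_presentation \<Lambda> M of (P1, d, P0, e) \<Rightarrow> minimal_proj_presentation \<Lambda> P1 d P0 e M"
    by (simp only: some_minimal_proj_presentation_def)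
  moreover obtain P1 d P0 e where "some_minimal_proj_presentation \<Lambda> M = (P1, d, P0, e)"
    by (cases "some_minimal_proj_presentation \<Lambda> M")
  ultimately show ?thesis by (intro that) auto
qed

theorem proposition3p2:
  fixes R :: "'r ring" and \<phi> :: "'r \<Rightarrow> 'a" and \<Lambda> :: "'a ring"
    and \<iota> :: "'r set \<Rightarrow> 'e" and E :: "('r, 'e) module"
    and P :: "nat \<Rightarrow> ('a, 'p) module" and d :: "nat \<Rightarrow> 'p \<Rightarrow> 'p" and \<epsilon> :: "'p \<Rightarrow> ('a \<Rightarrow> 'e)"
    and M :: "('a, 'm) module" and t :: enat
  assumes "artin_algebra R \<phi> \<Lambda>"
    and "injective_envelope R (quotient_module (regular_module R) (jacobson_radical R)) \<iota> E"
    and "minimal_proj_resolution \<Lambda> P d \<epsilon> (dual_regular R \<phi> E \<Lambda>)"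
    and "fg_module \<Lambda> M"
    and "1 \<le> t"
    and "M \<in> perp1_syzygies \<Lambda> (dual_regular R \<phi> E \<Lambda>) P d t"
  shows "torsionfree \<Lambda> t M"
proof -
  let ?S = "opposite_ring \<Lambda>" and ?DL = "dual_regular R \<phi> E \<Lambda>" and ?T = "transpose_module \<Lambda> M"
  note A = assms(1) and fgM = assms(4)
  have opp: "artin_algebra R \<phi> ?S" by (rule artin_algebra_opposite[OF A])
  note OD = artin_algebraD[OF opp]
  have regS: "left_module ?S (regular_module ?S)" by (rule regular_left_module[OF OD(4)])
  have P: "proj_resolution \<Lambda> P d \<epsilon> ?DL" using assms(3) by (simp add: minimal_proj_resolution_def)
  have E: "left_module R E" using assms(2) by (simp add: injective_envelope_def injective_module_def)
  have DL: "left_module \<Lambda> ?DL"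
    using dual_module_left_module[OF regS E OD(5,6)] by (simp add: dual_regular_def)
  obtain P1 d1 P0 e where some: "some_minimal_proj_presentation \<Lambda> M = (P1, d1, P0, e)"
    and pres: "minimal_proj_presentation \<Lambda> P1 d1 P0 e M"
    using some_minimal_proj_presentation[OF A fgM] by blast
  let ?K = "P0\<lparr>carrier := a_kernel P0 M e\<rparr>"
  have P0: "fg_module \<Lambda> P0" "projective_module \<Lambda> P0" "lin_map \<Lambda> P0 M e" "e ` carrier P0 = carrier M"
    and P1: "fg_module \<Lambda> P1" "projective_module \<Lambda> P1" "lin_map \<Lambda> P1 ?K d1"
      "d1 ` carrier P1 = a_kernel P0 M e"
    using pres by (auto simp: minimal_proj_presentation_def projective_cover_def lmod_hom_iff)
  have d1: "lin_map \<Lambda> P1 P0 d1" by (rule lin_map_from_subset[OF P1(3)]) (auto simp: a_kernel_def')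
  obtain n1 x \<xi> where db1: "dual_basis \<Lambda> P1 n1 x \<xi>" using projective_dual_basis[OF P1(1,2)] by metis
  obtain n0 y \<eta> where db0: "dual_basis \<Lambda> P0 n0 y \<eta>" using projective_dual_basis[OF P0(1,2)] by metis
  let ?B = "(\<lambda>f. compose (carrier P1) f d1) ` carrier (hom_to_ring \<Lambda> P0)"
  have T: "?T = quotient_module (hom_to_ring \<Lambda> P1) ?B" by (simp add: transpose_module_def some)
  interpret H1: left_module ?S "hom_to_ring \<Lambda> P1"
    by (rule hom_to_ring_left_module[OF dual_basisD(1)[OF db1]])
  have "lin ?S (hom_to_ring \<Lambda> P0) (hom_to_ring \<Lambda> P1) (\<lambda>f. compose (carrier P1) f d1)"
    by (intro linI hom_to_ring_left_module hom_to_ring_comp d1 dual_basisD(1)[OF db1] dual_basisD(1)[OF db0])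
  then have "submodule ?B ?S (hom_to_ring \<Lambda> P1)" by (rule lin.submodule_range)
  note c = H1.quotient_module[OF this, folded T]
  have fgT: "fg_module ?S ?T"
    by (rule fg_module_surj_image[OF dual_basis_fg[OF dual_basis_dual[OF db1]] c(1-3)])
  obtain Q \<delta> \<pi> where someQ: "some_proj_resolution ?S ?T = (Q, \<delta>, \<pi>)"
    and Q: "proj_resolution ?S Q \<delta> \<pi> ?T"
    using some_proj_resolution[OF opp fgT] by blast
  show ?thesis
    unfolding torsionfree_def
  proof (intro allI impI, elim conjE)
    fix i :: nat assume i: "1 \<le> i" "enat i \<le> t"
    \<comment> \<open>The bound 1 \<le> i excludes degree 0, where no differential comes in. Degree
      Suc j is matched with the syzygy of the same index.\<close>
    then obtain j where j: "i = Suc j" by (cases i) auto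
    have "trivial_group (Ext \<Lambda> 1 M (syzygy P d (Suc j)))"
      using assms(6) i unfolding perp1_syzygies_def perp1_def j by blast
    then have "dual_factors \<Lambda> Q \<delta> 0 (syzygy P d (Suc j))"
      by (rule dual_factors_transpose[OF A fgM syzygy_left_module[OF P] _ db1 db0 d1 P1(4) P0(3,4) Q[unfolded T]])
    then have factors: "dual_factors \<Lambda> Q \<delta> (Suc j) ?DL"
      by (rule dual_factors_resolved[OF P Q DL])
    show "trivial_group (Ext ?S i ?T (regular_module ?S))"
      unfolding j trivial_Ext_iff[OF regS someQ Q]
    proof (intro ballI impI)
      fix z assume z: "z \<in> lmod_hom ?S (Q (Suc j)) (regular_module ?S)"
        and "\<forall>q\<in>carrier (Q (Suc (Suc j))). z (\<delta> (Suc (Suc j)) q) = \<zero>\<^bsub>regular_module ?S\<^esub>"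
      then have "\<exists>u\<in>carrier (hom_to_ring ?S (Q j)). z = compose (carrier (Q (Suc j))) u (\<delta> (Suc j))"
        by (intro dual_factors_coboundary[OF A assms(2) Q factors]) (simp_all add: hom_to_ring_simps(1))
      then show "\<exists>u\<in>lmod_hom ?S (Q j) (regular_module ?S). \<forall>q\<in>carrier (Q (Suc j)). z q = u (\<delta> (Suc j) q)"
        by (auto simp: hom_to_ring_simps(1) compose_def)
    qed
  qed
qed

end
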